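(* Let $D\subset\mathbb{R}^d$ $(d\geq 3)$ be a domain and let $\xi\in\partial D$ be a strongly minimally convex and locally convex boundary point. Then there exist a neighborhood $U$ of $\xi$ and $c_1,c_2>0$ such that for all $x\in D\cap U$ and $v\in\mathbb{R}^d$ $$g_D(x,v)\geq\max\left\{(1-c_1\delta_D(x))\frac{\|v_N\|}{2\delta_D(x)},\ c_2\frac{\|v_T\|}{\delta_D(x)^{1/2}}\right\}.$$
   Context: A domain is a connected open set; $\delta_D(x)$ is the Euclidean distance from $x$ to $\partial D$. A $\mathcal{C}^2$-smooth local defining function at $\xi\in\partial D$ is a $\mathcal{C}^2$ function $\rho\colon W\to\mathbb{R}$ on a neighborhood $W$ of $\xi$ with $D\cap W=\{\rho<0\}$, $\partial D\cap W=\{\rho=0\}$ and $\nabla\rho\neq0$ on $\partial D\cap W$; if one exists, $\xi$ is a $\mathcal{C}^2$-smooth boundary point, with unit outer normal $n_\xi:=\nabla\rho(\xi)/\|\nabla\rho(\xi)\|$ and tangent space $T_\xi\partial D:=\{v\in\mathbb{R}^d:\langle v,n_\xi\rangle=0\}$. The point $\xi$ is strongly minimally convex if for some (equivalently every) $\mathcal{C}^2$-smooth local defining function $\rho$ at $\xi$, the two smallest eigenvalues $\lambda_1,\lambda_2$ (with multiplicity) of the Hessian of $\rho$ at $\xi$ restricted to $T_\xi\partial D$ satisfy $\lambda_1+\lambda_2>0$. The point $\xi$ is locally convex if there is a neighborhood $W'$ of $\xi$ with $D\cap W'$ convex. $U$ is taken small enough that every $x\in U$ has a unique nearest point $\pi(x)\in\partial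 D$, which is a $\mathcal{C}^2$-smooth boundary point; then $v_N:=\langle v,n_{\pi(x)}\rangle n_{\pi(x)}$ and $v_T:=v-v_N$. Minimal metric: let $\mathbb{D}$ be the open unit disk in $\mathbb{R}^2$ with coordinates $(x,y)$. A map $f\colon\mathbb{D}\to\mathbb{R}^d$ is conformal if $\|f_x\|=\|f_y\|$ and $\langle f_x,f_y\rangle=0$ at every point, and harmonic if each of its components is harmonic. $\mathrm{CH}(\mathbb{D},D)$ is the set of conformal harmonic maps $\mathbb{D}\to D$. The minimal metric is $$g_D(x,v):=\inf\{1/r: r>0,\ f\in\mathrm{CH}(\mathbb{D},D),\ f(0)=x,\ f_x(0)=rv\}.$$ *)

theory Defs
  imports "HOL-Analysis.Analysis" "HOL-Library.Multiset"
begin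

definition gradient :: "('a::euclidean_space \<Rightarrow> real) \<Rightarrow> 'a \<Rightarrow> 'a" where
  "gradient f x = (THE g. GDERIV f x :> g)"

(* The Hessian as a linear operator: the Hessian form is (u, v) |-> hessian f x u \<bullet> v. *)
definition hessian :: "('a::euclidean_space \<Rightarrow> real) \<Rightarrow> 'a \<Rightarrow> 'a \<Rightarrow> 'a" where
  "hessian f x = frechet_derivative (gradient f) (at x)"

(* Only meant for open W. In finite dimension, pointwise continuity of the operators
   hessian f x is the same as continuity of all second partial derivatives. *)
definition C2_on :: "'a set \<Rightarrow> ('a::euclidean_space \<Rightarrow> real) \<Rightarrow> bool" where
  "C2_on W f \<longleftrightarrow>
     (\<forall>x\<in>W. f differentiable (at x)) \<and>
     (\<forall>x\<in>W. gradient f differentiable (at x)) \<and>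
     (\<forall>h. continuous_on W (\<lambda>x. hessian f x h))"

definition local_defining_function ::
    "'a::euclidean_space set \<Rightarrow> 'a \<Rightarrow> 'a set \<Rightarrow> ('a \<Rightarrow> real) \<Rightarrow> bool" where
  "local_defining_function D \<xi> W \<rho> \<longleftrightarrow>
     open W \<and> \<xi> \<in> W \<and> C2_on W \<rho> \<and>
     D \<inter> W = {x \<in> W. \<rho> x < 0} \<and>
     frontier D \<inter> W = {x \<in> W. \<rho> x = 0} \<and>
     (\<forall>x \<in> frontier D \<inter> W. gradient \<rho> x \<noteq> 0)"

definition C2_boundary_point :: "'a::euclidean_space set \<Rightarrow> 'a \<Rightarrow> bool" where
  "C2_boundary_point D \<xi> \<longleftrightarrow>
     \<xi> \<in> frontier D \<and> (\<exists>W \<rho>. local_defining_function D \<xi> W \<rho>)"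

(* Independent of the choice of the defining function: see outer_normal_eq below. *)
definition outer_normal :: "'a::euclidean_space set \<Rightarrow> 'a \<Rightarrow> 'a" where
  "outer_normal D \<xi> =
     (THE n. \<exists>W \<rho>. local_defining_function D \<xi> W \<rho> \<and>
                    n = gradient \<rho> \<xi> /\<^sub>R norm (gradient \<rho> \<xi>))"

definition tangent_space :: "'a::euclidean_space set \<Rightarrow> 'a \<Rightarrow> 'a set" where
  "tangent_space D \<xi> = {v. v \<bullet> outer_normal D \<xi> = 0}"

(* Eigenspaces of the bilinear form (u, v) |-> A u \<bullet> v restricted to the subspace T, i.e. of the
   compression to T of the operator A. *)
definition restricted_eigenspace ::
    "('a::euclidean_space \<Rightarrow> 'a) \<Rightarrow> 'a set \<Rightarrow> real \<Rightarrow> 'a set" where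
  "restricted_eigenspace A T l = {v \<in> T. \<forall>w\<in>T. A v \<bullet> w = l * (v \<bullet> w)}"

(* In increasing order, each repeated according to its (geometric) multiplicity. *)
definition restricted_eigenvalues ::
    "('a::euclidean_space \<Rightarrow> 'a) \<Rightarrow> 'a set \<Rightarrow> real list" where
  "restricted_eigenvalues A T =
     sorted_list_of_multiset
       (\<Sum>l | \<exists>v \<in> restricted_eigenspace A T l. v \<noteq> 0.
          replicate_mset (dim (restricted_eigenspace A T l)) l)"

definition strongly_minimally_convex :: "'a::euclidean_space set \<Rightarrow> 'a \<Rightarrow> bool" where
  "strongly_minimally_convex D \<xi> \<longleftrightarrow>
     \<xi> \<in> frontier D \<and>
     (\<exists>W \<rho>. local_defining_function D \<xi> W \<rho> \<and>
        (let ls = restricted_eigenvalues (hessian \<rho> \<xi>) (tangent_space D \<xi>)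
         in ls ! 0 + ls ! 1 > 0))"

definition locally_convex_at :: "'a::euclidean_space set \<Rightarrow> 'a \<Rightarrow> bool" where
  "locally_convex_at D \<xi> \<longleftrightarrow> (\<exists>W. open W \<and> \<xi> \<in> W \<and> convex (D \<inter> W))"

definition boundary_dist :: "'a::euclidean_space set \<Rightarrow> 'a \<Rightarrow> real" where
  "boundary_dist D x = infdist x (frontier D)"

definition unique_nearest_boundary_point :: "'a::euclidean_space set \<Rightarrow> 'a \<Rightarrow> bool" where
  "unique_nearest_boundary_point D x \<longleftrightarrow>
     (\<exists>!p. p \<in> frontier D \<and> dist x p = boundary_dist D x)"

definition boundary_proj :: "'a::euclidean_space set \<Rightarrow> 'a \<Rightarrow> 'a" where
  "boundary_proj D x = (THE p. p \<in> frontier D \<and> dist x p = boundary_dist D x)"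

definition normal_part :: "'a::euclidean_space set \<Rightarrow> 'a \<Rightarrow> 'a \<Rightarrow> 'a" where
  "normal_part D x v =
     (v \<bullet> outer_normal D (boundary_proj D x)) *\<^sub>R outer_normal D (boundary_proj D x)"

definition tangential_part :: "'a::euclidean_space set \<Rightarrow> 'a \<Rightarrow> 'a \<Rightarrow> 'a" where
  "tangential_part D x v = v - normal_part D x v"

definition harmonic_on :: "'a set \<Rightarrow> ('a::euclidean_space \<Rightarrow> real) \<Rightarrow> bool" where
  "harmonic_on S u \<longleftrightarrow>
     C2_on S u \<and> (\<forall>x\<in>S. (\<Sum>b\<in>Basis. hessian u x b \<bullet> b) = 0)"

(* The plane is identified with the complex numbers, x = Re z and y = Im z. *)
definition partial_x :: "(complex \<Rightarrow> 'a::euclidean_space) \<Rightarrow> complex \<Rightarrow> 'a" where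
  "partial_x f z = frechet_derivative f (at z) 1"

definition partial_y :: "(complex \<Rightarrow> 'a::euclidean_space) \<Rightarrow> complex \<Rightarrow> 'a" where
  "partial_y f z = frechet_derivative f (at z) \<i>"

(* No immersion condition: the partial derivatives may vanish, constant maps are included. *)
definition conformal_harmonic_maps :: "'a::euclidean_space set \<Rightarrow> (complex \<Rightarrow> 'a) set" where
  "conformal_harmonic_maps D =
     {f. f ` ball 0 1 \<subseteq> D \<and>
         (\<forall>b\<in>Basis. harmonic_on (ball 0 1) (\<lambda>z. f z \<bullet> b)) \<and>
         (\<forall>z\<in>ball 0 1. norm (partial_x f z) = norm (partial_y f z) \<and>
                        partial_x f z \<bullet> partial_y f z = 0)}"

(* For x in an open D of dimension at least 2, the set is nonempty (affine discs) and
   bounded below by 0, so the infimum is a genuine one. *)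
definition minimal_metric :: "'a::euclidean_space set \<Rightarrow> 'a \<Rightarrow> 'a \<Rightarrow> real" where
  "minimal_metric D x v =
     Inf {1 / r | r. r > 0 \<and>
            (\<exists>f \<in> conformal_harmonic_maps D. f 0 = x \<and> partial_x f 0 = r *\<^sub>R v)}"

lemma gradient_eq: "GDERIV f x :> g \<Longrightarrow> gradient f x = g"
  unfolding gradient_def
proof (rule the_equality)
  fix k assume "GDERIV f x :> g" "GDERIV f x :> k"
  then have "(\<lambda>h. h \<bullet> k) = (\<lambda>h. h \<bullet> g)"
    unfolding gderiv_def using has_derivative_unique by blast
  then have "\<forall>h. h \<bullet> k = h \<bullet> g" by (rule fun_cong[THEN allI])
  then have "(k - g) \<bullet> k = (k - g) \<bullet> g" by blast
  then have "(k - g) \<bullet> (k - g) = 0" by (simp only: inner_diff_right[of "k - g"] diff_self)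
  then show "k = g" by simp
qed

lemma gderiv_gradient:
  assumes "f differentiable (at x)"
  shows "GDERIV f x :> gradient f x"
proof -
  from assms obtain L where L: "(f has_derivative L) (at x)"
    by (auto simp: differentiable_def)
  then have "linear L" by (rule has_derivative_linear)
  have "L = (\<lambda>h. h \<bullet> (\<Sum>b\<in>Basis. L b *\<^sub>R b))"
  proof
    fix h
    have "L h = L (\<Sum>b\<in>Basis. (h \<bullet> b) *\<^sub>R b)" by (simp add: euclidean_representation)
    also have "\<dots> = (\<Sum>b\<in>Basis. (h \<bullet> b) * L b)"
      using \<open>linear L\<close> by (simp add: linear_sum linear_cmul)
    also have "\<dots> = h \<bullet> (\<Sum>b\<in>Basis. L b *\<^sub>R b)"
      by (simp add: inner_sum_right mult.commute)
    finally show "L h = h \<bullet> (\<Sum>b\<in>Basis. L b *\<^sub>R b)" .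
  qed
  with L have "GDERIV f x :> (\<Sum>b\<in>Basis. L b *\<^sub>R b)" by (simp add: gderiv_def)
  then show ?thesis by (simp add: gradient_eq)
qed

lemma gradient_ray:
  assumes "f differentiable (at x)"
  shows "((\<lambda>t. f (x + t *\<^sub>R h)) has_real_derivative (h \<bullet> gradient f x)) (at 0)"
proof -
  have d: "(f has_derivative (\<lambda>h. h \<bullet> gradient f x)) (at (x + 0 *\<^sub>R h))"
    using gderiv_gradient[OF assms] by (simp add: gderiv_def)
  have l: "((\<lambda>t::real. x + t *\<^sub>R h) has_derivative (\<lambda>t. t *\<^sub>R h)) (at 0)"
    by (auto intro!: derivative_eq_intros)
  have "((\<lambda>t. f (x + t *\<^sub>R h)) has_derivative (\<lambda>t. (t *\<^sub>R h) \<bullet> gradient f x)) (at 0)"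
    using has_derivative_compose[OF l d] by simp
  then show ?thesis by (simp add: has_field_derivative_def mult_commute_abs)
qed

lemma defining_functions_half_space:
  assumes \<xi>: "\<xi> \<in> frontier D"
    and 1: "local_defining_function D \<xi> W \<rho>" and 2: "local_defining_function D \<xi> V \<sigma>"
    and h: "h \<bullet> gradient \<rho> \<xi> < 0"
  shows "h \<bullet> gradient \<sigma> \<xi> \<le> 0"
proof (rule ccontr)
  assume "\<not> ?thesis"
  then have pos: "h \<bullet> gradient \<sigma> \<xi> > 0" by simp
  have o: "open (W \<inter> V)" "\<xi> \<in> W \<inter> V"
    using 1 2 by (auto simp: local_defining_function_def)
  have df: "\<rho> differentiable (at \<xi>)" "\<sigma> differentiable (at \<xi>)"
    using 1 2 by (auto simp: local_defining_function_def C2_on_def)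
  have z: "\<rho> \<xi> = 0" "\<sigma> \<xi> = 0" using 1 2 \<xi> by (auto simp: local_defining_function_def)
  obtain a where a: "a > 0" "\<And>t. 0 < t \<Longrightarrow> t < a \<Longrightarrow> \<rho> (\<xi> + t *\<^sub>R h) < 0"
    using DERIV_neg_dec_right[OF gradient_ray[OF df(1), of h] h] z by auto
  obtain b where b: "b > 0" "\<And>t. 0 < t \<Longrightarrow> t < b \<Longrightarrow> \<sigma> (\<xi> + t *\<^sub>R h) > 0"
    using DERIV_pos_inc_right[OF gradient_ray[OF df(2), of h] pos] z by auto
  have "((\<lambda>t. \<xi> + t *\<^sub>R h) \<longlongrightarrow> \<xi> + 0 *\<^sub>R h) (at_right 0)" by (intro tendsto_intros)
  then have "\<forall>\<^sub>F t in at_right 0. \<xi> + t *\<^sub>R h \<in> W \<inter> V"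
    using o by (auto dest!: topological_tendstoD)
  then obtain c where c: "c > 0" "\<And>t. 0 < t \<Longrightarrow> t < c \<Longrightarrow> \<xi> + t *\<^sub>R h \<in> W \<inter> V"
    by (auto simp: eventually_at_right_field)
  define t where "t = min a (min b c) / 2"
  have t: "0 < t" "t < a" "t < b" "t < c" using a(1) b(1) c(1) by (auto simp: t_def)
  let ?p = "\<xi> + t *\<^sub>R h"
  have "?p \<in> W \<inter> V" "\<rho> ?p < 0" "\<sigma> ?p > 0" using a(2) b(2) c(2) t by auto
  moreover have "D \<inter> W = {x \<in> W. \<rho> x < 0}" "D \<inter> V = {x \<in> V. \<sigma> x < 0}"
    using 1 2 by (auto simp: local_defining_function_def)
  ultimately have "?p \<in> D" "?p \<notin> D" by (blast, force)
  then show False by contradiction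
qed

lemma half_space_unit_normal:
  fixes g k :: "'a::euclidean_space"
  assumes "g \<noteq> 0" "k \<noteq> 0" and hs: "\<And>h. h \<bullet> g < 0 \<Longrightarrow> h \<bullet> k \<le> 0"
  shows "k /\<^sub>R norm k = g /\<^sub>R norm g"
proof -
  define u w where "u = g /\<^sub>R norm g" and "w = k /\<^sub>R norm k"
  have n: "norm u = 1" "norm w = 1" using assms by (auto simp: u_def w_def)
  have le: "h \<bullet> w \<le> 0" if "h \<bullet> u < 0" for h
  proof -
    have "h \<bullet> u = inverse (norm g) * (h \<bullet> g)" by (simp add: u_def)
    with that have "h \<bullet> g < 0" using \<open>g \<noteq> 0\<close> by (simp add: mult_less_0_iff)
    then show ?thesis using hs \<open>k \<noteq> 0\<close> by (simp add: w_def mult_nonneg_nonpos)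
  qed
  have uu: "u \<bullet> u = 1" "w \<bullet> w = 1" using n by (simp_all add: dot_square_norm)
  have "u \<bullet> w \<ge> 1"
  proof (rule ccontr)
    assume less: "\<not> u \<bullet> w \<ge> 1"
    let ?h = "w - u"
    have "?h \<bullet> u < 0" using less uu by (simp add: inner_diff_left inner_commute[of w u])
    then have "?h \<bullet> w \<le> 0" by (rule le)
    moreover have "?h \<bullet> w = 1 - u \<bullet> w" using uu by (simp add: inner_diff_left)
    ultimately show False using less by simp
  qed
  moreover have "(u - w) \<bullet> (u - w) = 2 - 2 * (u \<bullet> w)"
    using uu by (simp add: inner_diff_left inner_diff_right inner_commute)
  ultimately have "(u - w) \<bullet> (u - w) \<le> 0" by simp
  then have "u - w = 0" using inner_gt_zero_iff[of "u - w"] by linarith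
  then show ?thesis by (simp add: u_def w_def)
qed

lemma outer_normal_eq:
  assumes \<xi>: "\<xi> \<in> frontier D" and \<rho>: "local_defining_function D \<xi> W \<rho>"
  shows "outer_normal D \<xi> = gradient \<rho> \<xi> /\<^sub>R norm (gradient \<rho> \<xi>)"
  unfolding outer_normal_def
proof (rule the_equality)
  show "\<exists>W' \<rho>'. local_defining_function D \<xi> W' \<rho>' \<and>
      gradient \<rho> \<xi> /\<^sub>R norm (gradient \<rho> \<xi>) = gradient \<rho>' \<xi> /\<^sub>R norm (gradient \<rho>' \<xi>)"
    using \<rho> by blast
next
  fix n
  assume "\<exists>W' \<rho>'. local_defining_function D \<xi> W' \<rho>' \<and>
      n = gradient \<rho>' \<xi> /\<^sub>R norm (gradient \<rho>' \<xi>)"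
  then obtain V \<sigma> where \<sigma>: "local_defining_function D \<xi> V \<sigma>"
    and n: "n = gradient \<sigma> \<xi> /\<^sub>R norm (gradient \<sigma> \<xi>)" by blast
  have "gradient \<rho> \<xi> \<noteq> 0" "gradient \<sigma> \<xi> \<noteq> 0"
    using \<xi> \<rho> \<sigma> by (auto simp: local_defining_function_def)
  then show "n = gradient \<rho> \<xi> /\<^sub>R norm (gradient \<rho> \<xi>)"
    unfolding n using half_space_unit_normal defining_functions_half_space[OF \<xi> \<rho> \<sigma>] by blast
qed

end

theory Submission
  imports Defs "HOL-Complex_Analysis.Complex_Analysis"
begin

text \<open>Let \<open>f\<close> be a conformal harmonic disc in \<open>D\<close> centred at \<open>x\<close>, let \<open>p\<close> be the boundary point nearest to \<open>x\<close>,
  \<open>\<delta>\<close> the distance and \<open>n\<close> the outer normal at \<open>p\<close>, and put \<open>h y = (p - y) \<bullet> n\<close>. If \<open>D\<close> lay on one side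
  of the tangent hyperplane at \<open>p\<close>, then \<open>h \<circ> f\<close> would be a positive harmonic function with value
  \<open>\<delta>\<close> at the centre, and the Schwarz lemma would give the sharp bound \<open>2 \<delta>\<close> for the normal component of
  the derivative (\<open>positive_harmonic_gradient_bound\<close>). Convexity gives this only near \<open>p\<close>, so
  the point is to show that \<open>f\<close> maps the disc of radius \<open>1 - C \<delta>\<close> into a fixed neighbourhood of
  \<open>p\<close>; this is where the factor \<open>1 - c1 \<delta>\<close> comes from.

  Strong minimal convexity enters through a quadratic form \<open>Q w = A (w \<bullet> w - 2 (w \<bullet> e)^2)\<close>
  with a unit vector \<open>e\<close>. Its trace on every plane is nonnegative, so \<open>Q \<circ> (f - p)\<close> is subharmonic, and
  near \<open>p\<close> the domain satisfies \<open>h y \<ge> Q (y - p) + c |y - p|^2\<close>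
  (\<open>local_boundary_geometry\<close>, uniformly in \<open>p\<close>). Hence the barrier \<open>Q (f - p) - h f\<close>
  is subharmonic, is at most \<open>- c |f - p|^2\<close>, and is at least \<open>- 2 \<delta>\<close> at the centre. In other words
  \<open>|f - p|^2\<close> is dominated by a positive superharmonic function whose value at the centre is
  \<open>O(\<delta>)\<close>. Superharmonic functions obey no Harnack inequality, but the components of \<open>f\<close> are harmonic,
  and a reproducing kernel turns the domination into the pointwise estimate
  \<open>|f z - p|^2 \<le> K \<delta> R / (R - |z|)\<close> whenever \<open>f\<close> maps the disc of radius \<open>R\<close> into the neighbourhood
  (\<open>hardy_pointwise_bound\<close>, \<open>localised_disc_distance\<close>). With a fixed \<open>R\<close> and the gradient bound this is
  already the tangential estimate of order \<open>sqrt \<delta>\<close>.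

  A fixed \<open>R\<close> to start with comes from \<open>conformal_disc_stays_near\<close>: since \<open>ln |f - f 0|^2\<close> is subharmonic for
  conformal harmonic \<open>f\<close>, a large multiple of the barrier can be added to it and the sum
  glued to a constant away from \<open>p\<close>; comparison with \<open>ln |z|\<close> shows that \<open>f\<close> cannot leave the neighbourhood too
  early. Restarting this argument at points \<open>z\<close> close to the boundary of the disc on which \<open>f\<close> is known to stay
  near \<open>p\<close>, where the pointwise estimate keeps \<open>f z\<close> very close to \<open>p\<close>, enlarges that disc
  until its radius is \<open>1 - C \<delta>\<close> (\<open>disc_localisation_bootstrap\<close>).

  Near a \<open>C2\<close> boundary point the nearest boundary point is unique because boundary points \<open>p\<close>, \<open>q\<close> satisfy
  \<open>|(q - p) \<bullet> n| \<le> K |q - p|^2\<close>. Everything about subharmonic functions is derived from the second-derivative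
  test at a maximum along the two coordinate lines.\<close>

section \<open>Second-order calculus of functions with continuous Hessian\<close>

lemma C2_on_gradient:
  assumes "C2_on W f" "x \<in> W"
  shows "(f has_derivative (\<lambda>h. gradient f x \<bullet> h)) (at x)"
  using gderiv_gradient[of f x] assms by (simp add: C2_on_def gderiv_def inner_commute)

lemma C2_on_hessian:
  assumes "C2_on W f" "x \<in> W"
  shows "(gradient f has_derivative hessian f x) (at x)"
  using assms frechet_derivative_works unfolding C2_on_def hessian_def by blast

lemma C2_on_hessian_linear:
  assumes "C2_on W f" "x \<in> W"
  shows "linear (hessian f x)"
  using C2_on_hessian[OF assms] has_derivative_linear by blast

lemma C2_on_hessian_continuous: "C2_on W f \<Longrightarrow> continuous_on W (\<lambda>x. hessian f x h)"
  by (simp add: C2_on_def)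

lemma C2_on_line:
  assumes "C2_on W f" "x + t *\<^sub>R u \<in> W"
  shows "((\<lambda>t. f (x + t *\<^sub>R u)) has_real_derivative gradient f (x + t *\<^sub>R u) \<bullet> u) (at t)"
proof -
  have l: "((\<lambda>t. x + t *\<^sub>R u) has_derivative (\<lambda>s. s *\<^sub>R u)) (at t)"
    by (auto intro!: derivative_eq_intros)
  show ?thesis
    using has_derivative_compose[OF l C2_on_gradient[OF assms]]
    by (simp add: has_field_derivative_def mult_commute_abs)
qed

lemma C2_on_gradient_line:
  assumes "C2_on W f" "x + t *\<^sub>R u \<in> W"
  shows "((\<lambda>t. gradient f (x + t *\<^sub>R u) \<bullet> v) has_real_derivative hessian f (x + t *\<^sub>R u) u \<bullet> v) (at t)"
proof -
  have l: "((\<lambda>t. x + t *\<^sub>R u) has_derivative (\<lambda>s. s *\<^sub>R u)) (at t)"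
    by (auto intro!: derivative_eq_intros)
  have "((\<lambda>t. gradient f (x + t *\<^sub>R u) \<bullet> v) has_derivative (\<lambda>s. hessian f (x + t *\<^sub>R u) (s *\<^sub>R u) \<bullet> v)) (at t)"
    using has_derivative_inner_left[OF has_derivative_compose[OF l C2_on_hessian[OF assms]], of v] by simp
  moreover have "(\<lambda>s. hessian f (x + t *\<^sub>R u) (s *\<^sub>R u) \<bullet> v) = (\<lambda>s. s * (hessian f (x + t *\<^sub>R u) u \<bullet> v))"
    using C2_on_hessian_linear[OF assms] by (simp add: linear_cmul)
  ultimately show ?thesis
    by (simp add: has_field_derivative_def mult_commute_abs)
qed

text \<open>The Lagrange form of the remainder lets the sign of the Hessian near a boundary point control the defining function.\<close>

lemma C2_on_taylor2:
  assumes f: "C2_on W f" and W: "closed_segment p y \<subseteq> W"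
  shows "\<exists>\<zeta>\<in>closed_segment p y.
           f y = f p + gradient f p \<bullet> (y - p) + (hessian f \<zeta> (y - p) \<bullet> (y - p)) / 2"
proof -
  define u where "u = y - p"
  define df where "df m t = (if m = 0 then f (p + t *\<^sub>R u) else if m = 1 then gradient f (p + t *\<^sub>R u) \<bullet> u
     else hessian f (p + t *\<^sub>R u) u \<bullet> u)" for m :: nat and t :: real
  have seg: "p + t *\<^sub>R u \<in> closed_segment p y" if "0 \<le> t" "t \<le> 1" for t
  proof -
    have "p + t *\<^sub>R u = (1 - t) *\<^sub>R p + t *\<^sub>R y" by (simp add: u_def algebra_simps)
    then show ?thesis using that by (auto simp: closed_segment_def)
  qed
  have "\<exists>t::real. 0 < t \<and> t < 1 \<and>
      f (p + 1 *\<^sub>R u) = sum (\<lambda>m. (df m 0 / fact m) * 1 ^ m) {..<2} + (df 2 t / fact 2) * 1 ^ 2"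
  proof (rule Maclaurin)
    show "df 0 = (\<lambda>t. f (p + t *\<^sub>R u))" by (simp add: df_def fun_eq_iff)
    show "\<forall>m t. m < 2 \<and> 0 \<le> t \<and> t \<le> 1 \<longrightarrow> (df m has_real_derivative df (Suc m) t) (at t)"
    proof (intro allI impI)
      fix m :: nat and t :: real assume a: "m < 2 \<and> 0 \<le> t \<and> t \<le> 1"
      then have "p + t *\<^sub>R u \<in> W" using seg W by blast
      then show "(df m has_real_derivative df (Suc m) t) (at t)"
        using C2_on_line[OF f, of p t u] C2_on_gradient_line[OF f, of p t u u] a
        unfolding df_def by (cases "m = 0") simp_all
    qed
  qed auto
  then obtain t where t: "0 < t" "t < 1"
    "f (p + u) = f p + gradient f p \<bullet> u + (hessian f (p + t *\<^sub>R u) u \<bullet> u) / 2"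
    by (auto simp: df_def eval_nat_numeral)
  moreover have "p + u = y" by (simp add: u_def)
  ultimately show ?thesis using seg[of t] unfolding u_def by auto
qed

text \<open>Both mixed second derivatives are limits of the same second difference.\<close>

lemma hessian_symmetric:
  assumes f: "C2_on W f" and W: "open W" "x \<in> W"
  shows "hessian f x u \<bullet> v = hessian f x v \<bullet> u"
proof -
  obtain e where e: "e > 0" "ball x e \<subseteq> W" using W open_contains_ball by blast
  \<comment> \<open>This makes every point reached by steps of size less than \<open>r\<close> along \<open>u\<close> and \<open>v\<close> lie in \<open>W\<close>.\<close>
  define r where "r = e / (1 + norm u + norm v)"
  have npos: "1 + norm u + norm v > 0" by (simp add: add_pos_nonneg)
  have r: "r > 0" using e npos by (simp add: r_def)
  have inW: "x + s *\<^sub>R a + t *\<^sub>R b \<in> W" and inE: "norm (s *\<^sub>R a + t *\<^sub>R b) \<le> q * (1 + norm u + norm v)"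
    if "\<bar>s\<bar> \<le> q" "\<bar>t\<bar> \<le> q" "q < r" "(a, b) = (u, v) \<or> (a, b) = (v, u)" for s t q a b
  proof -
    have "norm (s *\<^sub>R a + t *\<^sub>R b) \<le> \<bar>s\<bar> * norm a + \<bar>t\<bar> * norm b"
      by (rule order_trans[OF norm_triangle_ineq]) simp
    also have "\<dots> \<le> q * norm a + q * norm b"
      using that by (intro add_mono mult_right_mono) auto
    also have "\<dots> \<le> q * (1 + norm u + norm v)" using that by (auto simp: algebra_simps)
    finally show 1: "norm (s *\<^sub>R a + t *\<^sub>R b) \<le> q * (1 + norm u + norm v)" .
    also have "\<dots> < e" using that(3) npos by (simp add: r_def pos_less_divide_eq)
    finally have "x + (s *\<^sub>R a + t *\<^sub>R b) \<in> ball x e" by (metis dist_norm mem_ball norm_minus_commute add_diff_cancel_left')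
    then show "x + s *\<^sub>R a + t *\<^sub>R b \<in> W" using e by (auto simp: add.assoc)
  qed
  have diff2: "\<exists>\<zeta>. dist \<zeta> x \<le> q * (1 + norm u + norm v) \<and>
      f (x + q *\<^sub>R a + q *\<^sub>R b) - f (x + q *\<^sub>R a) - f (x + q *\<^sub>R b) + f x = q * q * (hessian f \<zeta> b \<bullet> a)"
    if q: "0 < q" "q < r" and ab: "(a, b) = (u, v) \<or> (a, b) = (v, u)" for q a b
  proof -
    define k where "k t = f ((x + q *\<^sub>R b) + t *\<^sub>R a) - f (x + t *\<^sub>R a)" for t
    have "\<exists>t>0. t < q \<and> k q - k 0 = (q - 0) * (gradient f ((x + q *\<^sub>R b) + t *\<^sub>R a) \<bullet> a - gradient f (x + t *\<^sub>R a) \<bullet> a)"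
    proof (rule MVT2)
      fix t assume t: "0 \<le> t" "t \<le> q"
      have "x + q *\<^sub>R b + t *\<^sub>R a \<in> W" "x + t *\<^sub>R a \<in> W"
        using inW[of t q q a b] inW[of t q 0 a b] t q ab by (auto simp: algebra_simps)
      then show "(k has_real_derivative gradient f (x + q *\<^sub>R b + t *\<^sub>R a) \<bullet> a - gradient f (x + t *\<^sub>R a) \<bullet> a) (at t)"
        unfolding k_def by (intro DERIV_diff C2_on_line[OF f])
    qed (use q in auto)
    then obtain t where t: "0 < t" "t < q" "k q - k 0 = q * (gradient f ((x + q *\<^sub>R b) + t *\<^sub>R a) \<bullet> a - gradient f (x + t *\<^sub>R a) \<bullet> a)"
      by auto
    have "\<exists>s>0. s < q \<and> gradient f ((x + t *\<^sub>R a) + q *\<^sub>R b) \<bullet> a - gradient f ((x + t *\<^sub>R a) + 0 *\<^sub>R b) \<bullet> a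
         = (q - 0) * (hessian f ((x + t *\<^sub>R a) + s *\<^sub>R b) b \<bullet> a)"
    proof (rule MVT2)
      fix s assume s: "0 \<le> s" "s \<le> q"
      have "x + t *\<^sub>R a + s *\<^sub>R b \<in> W" using inW[of t q s a b] t s q ab by auto
      then show "((\<lambda>s. gradient f ((x + t *\<^sub>R a) + s *\<^sub>R b) \<bullet> a) has_real_derivative
           hessian f ((x + t *\<^sub>R a) + s *\<^sub>R b) b \<bullet> a) (at s)"
        by (intro C2_on_gradient_line[OF f])
    qed (use q in auto)
    then obtain s where s: "0 < s" "s < q"
      "gradient f ((x + t *\<^sub>R a) + q *\<^sub>R b) \<bullet> a - gradient f (x + t *\<^sub>R a) \<bullet> a
         = q * (hessian f ((x + t *\<^sub>R a) + s *\<^sub>R b) b \<bullet> a)" by auto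
    have "dist (x + t *\<^sub>R a + s *\<^sub>R b) x \<le> q * (1 + norm u + norm v)"
      using inE[of t q s a b] t s q ab by (simp add: dist_norm)
    moreover have "k q - k 0 = q * (q * (hessian f ((x + t *\<^sub>R a) + s *\<^sub>R b) b \<bullet> a))"
      using t(3) s(3) by (simp add: algebra_simps)
    ultimately show ?thesis unfolding k_def
      by (intro exI[of _ "x + t *\<^sub>R a + s *\<^sub>R b"]) (simp add: algebra_simps)
  qed
  have cont: "isCont (\<lambda>x. hessian f x a \<bullet> b) x" for a b
    using C2_on_hessian_continuous[OF f, of a] W
    by (auto intro!: continuous_intros simp: continuous_on_eq_continuous_at)
  have "\<bar>hessian f x u \<bullet> v - hessian f x v \<bullet> u\<bar> \<le> \<epsilon>" if \<epsilon>: "\<epsilon> > 0" for \<epsilon>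
  proof -
    obtain d1 where d1: "d1 > 0" "\<And>y. dist y x < d1 \<Longrightarrow> dist (hessian f y u \<bullet> v) (hessian f x u \<bullet> v) < \<epsilon> / 2"
      using cont[of u v] \<epsilon> unfolding continuous_at_eps_delta by (metis half_gt_zero)
    obtain d2 where d2: "d2 > 0" "\<And>y. dist y x < d2 \<Longrightarrow> dist (hessian f y v \<bullet> u) (hessian f x v \<bullet> u) < \<epsilon> / 2"
      using cont[of v u] \<epsilon> unfolding continuous_at_eps_delta by (metis half_gt_zero)
    define d where "d = min d1 d2 / (1 + norm u + norm v)"
    define q where "q = min r d / 2"
    have "d > 0" using d1 d2 npos by (simp add: d_def)
    then have q: "0 < q" "q < r" "q < d" using r by (auto simp: q_def)
    then have qd: "q * (1 + norm u + norm v) < min d1 d2" using npos by (simp add: d_def pos_less_divide_eq)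
    obtain \<zeta>1 where z1: "dist \<zeta>1 x \<le> q * (1 + norm u + norm v)"
      "f (x + q *\<^sub>R u + q *\<^sub>R v) - f (x + q *\<^sub>R u) - f (x + q *\<^sub>R v) + f x = q * q * (hessian f \<zeta>1 v \<bullet> u)"
      using diff2[of q u v] q by auto
    obtain \<zeta>2 where z2: "dist \<zeta>2 x \<le> q * (1 + norm u + norm v)"
      "f (x + q *\<^sub>R v + q *\<^sub>R u) - f (x + q *\<^sub>R v) - f (x + q *\<^sub>R u) + f x = q * q * (hessian f \<zeta>2 u \<bullet> v)"
      using diff2[of q v u] q by auto
    have "x + q *\<^sub>R v + q *\<^sub>R u = x + q *\<^sub>R u + q *\<^sub>R v" by (simp add: algebra_simps)
    then have "q * q * (hessian f \<zeta>1 v \<bullet> u) = q * q * (hessian f \<zeta>2 u \<bullet> v)"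
      using z1(2) z2(2) by (smt (verit))
    then have "hessian f \<zeta>1 v \<bullet> u = hessian f \<zeta>2 u \<bullet> v" using q by simp
    moreover have "dist (hessian f \<zeta>1 v \<bullet> u) (hessian f x v \<bullet> u) < \<epsilon> / 2" using d2(2) z1(1) qd by fastforce
    moreover have "dist (hessian f \<zeta>2 u \<bullet> v) (hessian f x u \<bullet> v) < \<epsilon> / 2" using d1(2) z2(1) qd by fastforce
    ultimately show ?thesis unfolding dist_real_def by linarith
  qed
  then show ?thesis using field_le_epsilon[of "\<bar>hessian f x u \<bullet> v - hessian f x v \<bullet> u\<bar>" 0] by simp
qed

text \<open>Pointwise continuity suffices because a linear map is controlled by its values on a finite basis.\<close>

lemma hessian_form_uniformly_close:
  assumes f: "C2_on W f" and W: "open W" "x \<in> W" and \<epsilon>: "\<epsilon> > 0"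
  obtains r where "r > 0" "ball x r \<subseteq> W"
    "\<And>y w. y \<in> ball x r \<Longrightarrow> \<bar>hessian f y w \<bullet> w - hessian f x w \<bullet> w\<bar> \<le> \<epsilon> * (norm w)\<^sup>2"
proof -
  define N where "N = real DIM('a)"
  have N: "N > 0" by (simp add: N_def)
  have "\<forall>\<^sub>F y in nhds x. dist (hessian f y b) (hessian f x b) < \<epsilon> / N" for b
  proof -
    have "isCont (\<lambda>x. hessian f x b) x"
      using C2_on_hessian_continuous[OF f, of b] W by (simp add: continuous_on_eq_continuous_at)
    moreover have "\<epsilon> / N > 0" using \<epsilon> N by simp
    ultimately show ?thesis
      unfolding continuous_at_eps_delta eventually_nhds_metric by blast
  qed
  then have "\<forall>\<^sub>F y in nhds x. \<forall>b\<in>Basis. dist (hessian f y b) (hessian f x b) < \<epsilon> / N"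
    by (simp add: eventually_ball_finite)
  moreover have "\<forall>\<^sub>F y in nhds x. y \<in> W" using W by (simp add: eventually_nhds_in_open)
  ultimately have "\<forall>\<^sub>F y in nhds x. (\<forall>b\<in>Basis. dist (hessian f y b) (hessian f x b) < \<epsilon> / N) \<and> y \<in> W"
    by (rule eventually_conj)
  then obtain r where r: "r > 0"
    "\<And>y. dist y x < r \<Longrightarrow> (\<forall>b\<in>Basis. dist (hessian f y b) (hessian f x b) < \<epsilon> / N) \<and> y \<in> W"
    unfolding eventually_nhds_metric by blast
  show thesis
  proof (rule that)
    show "r > 0" by fact
    show "ball x r \<subseteq> W" using r(2) by (auto simp: dist_commute)
    fix y w assume y: "y \<in> ball x r"
    then have yd: "dist y x < r" by (simp add: dist_commute)
    have yW: "y \<in> W" using r(2)[OF yd] by simp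
    have exp: "hessian f z w = (\<Sum>b\<in>Basis. (w \<bullet> b) *\<^sub>R hessian f z b)" if "z \<in> W" for z
    proof -
      have "hessian f z w = hessian f z (\<Sum>b\<in>Basis. (w \<bullet> b) *\<^sub>R b)" by (simp add: euclidean_representation)
      also have "\<dots> = (\<Sum>b\<in>Basis. (w \<bullet> b) *\<^sub>R hessian f z b)"
        using C2_on_hessian_linear[OF f that] by (simp add: linear_sum linear_cmul)
      finally show ?thesis .
    qed
    have "norm (hessian f y w - hessian f x w) = norm (\<Sum>b\<in>Basis. (w \<bullet> b) *\<^sub>R (hessian f y b - hessian f x b))"
      using exp[OF yW] exp[OF W(2)] by (simp add: sum_subtractf scaleR_diff_right)
    also have "\<dots> \<le> (\<Sum>b\<in>(Basis::'a set). norm w * (\<epsilon> / N))"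
    proof (rule sum_norm_le)
      fix b :: 'a assume b: "b \<in> Basis"
      have "norm (hessian f y b - hessian f x b) \<le> \<epsilon> / N" using r(2)[OF yd] b by (simp add: dist_norm less_imp_le)
      then have "\<bar>w \<bullet> b\<bar> * norm (hessian f y b - hessian f x b) \<le> norm w * (\<epsilon> / N)"
        using Basis_le_norm[OF b, of w] by (intro mult_mono) auto
      then show "norm ((w \<bullet> b) *\<^sub>R (hessian f y b - hessian f x b)) \<le> norm w * (\<epsilon> / N)"
        by simp
    qed
    also have "\<dots> = \<epsilon> * norm w" using N by (simp add: N_def)
    finally have n: "norm (hessian f y w - hessian f x w) \<le> \<epsilon> * norm w" .
    have "\<bar>hessian f y w \<bullet> w - hessian f x w \<bullet> w\<bar> = \<bar>(hessian f y w - hessian f x w) \<bullet> w\<bar>"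
      by (simp add: inner_diff_left)
    also have "\<dots> \<le> norm (hessian f y w - hessian f x w) * norm w" by (rule Cauchy_Schwarz_ineq2)
    also have "\<dots> \<le> \<epsilon> * norm w * norm w" using n by (simp add: mult_right_mono)
    finally show "\<bar>hessian f y w \<bullet> w - hessian f x w \<bullet> w\<bar> \<le> \<epsilon> * (norm w)\<^sup>2" by (simp add: power2_eq_square mult.assoc)
  qed
qed

section \<open>The two smallest eigenvalues\<close>

text \<open>The first-order condition at a minimum; for small \<open>t\<close> the linear term wins.\<close>

lemma linear_coeff_zero:
  fixes b c :: real
  assumes "\<And>t. 2 * t * b + t\<^sup>2 * c \<ge> 0"
  shows "b = 0"
proof (rule ccontr)
  assume b: "b \<noteq> 0"
  define t where "t = - b / (\<bar>c\<bar> + 1)"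
  have "2 * t * b + t\<^sup>2 * c \<le> 2 * t * b + t\<^sup>2 * (\<bar>c\<bar> + 1)" by (intro add_left_mono mult_left_mono) auto
  also have "t\<^sup>2 * (\<bar>c\<bar> + 1) = - t * b" by (simp add: t_def power2_eq_square)
  also have "2 * t * b + - t * b = - (b\<^sup>2 / (\<bar>c\<bar> + 1))" by (simp add: t_def power2_eq_square)
  also have "\<dots> < 0" using b by simp
  finally show False using assms[of t] by simp
qed

text \<open>The last conclusion, the eigenvector equation tested on \<open>S\<close>, is the vanishing of the first variation at the minimiser.\<close>

lemma minimal_rayleigh_eigenvector:
  fixes A :: "'a::euclidean_space \<Rightarrow> 'a"
  assumes A: "linear A" and sym: "\<And>u v. A u \<bullet> v = A v \<bullet> u"
    and S: "subspace S" "v0 \<in> S" "v0 \<noteq> 0"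
  obtains e where "e \<in> S" "norm e = 1"
    "\<And>w. w \<in> S \<Longrightarrow> A w \<bullet> w \<ge> (A e \<bullet> e) * (w \<bullet> w)"
    "\<And>w. w \<in> S \<Longrightarrow> A e \<bullet> w = (A e \<bullet> e) * (e \<bullet> w)"
proof -
  have "compact (S \<inter> sphere 0 1)" by (intro closed_Int_compact closed_subspace S compact_sphere)
  moreover have "v0 /\<^sub>R norm v0 \<in> S \<inter> sphere 0 1" using S by (simp add: subspace_scale)
  moreover have "continuous_on (S \<inter> sphere 0 1) (\<lambda>w. A w \<bullet> w)"
    using A by (intro continuous_intros linear_continuous_on linear_linear[THEN iffD2])
  ultimately obtain e where e: "e \<in> S \<inter> sphere 0 1" "\<And>w. w \<in> S \<inter> sphere 0 1 \<Longrightarrow> A e \<bullet> e \<le> A w \<bullet> w"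
    using continuous_attains_inf[of "S \<inter> sphere 0 1" "\<lambda>w. A w \<bullet> w"] by blast
  define m where "m = A e \<bullet> e"
  have min: "A w \<bullet> w \<ge> m * (w \<bullet> w)" if "w \<in> S" for w
  proof (cases "w = 0")
    case True then show ?thesis using A by (simp add: linear_0)
  next
    case False
    then have "w /\<^sub>R norm w \<in> S \<inter> sphere 0 1" using that S by (simp add: subspace_scale)
    then have "m \<le> A (w /\<^sub>R norm w) \<bullet> (w /\<^sub>R norm w)" using e(2) m_def by blast
    also have "\<dots> = (A w \<bullet> w) / (norm w)\<^sup>2"
      using A by (simp add: linear_cmul power2_eq_square divide_inverse)
    finally show ?thesis using False by (simp add: pos_le_divide_eq dot_square_norm)
  qed
  have ee: "e \<bullet> e = 1" using e by (simp add: dot_square_norm)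
  have stat: "A e \<bullet> w = m * (e \<bullet> w)" if w: "w \<in> S" for w
  proof -
    have "A e \<bullet> w - m * (e \<bullet> w) = 0"
    proof (rule linear_coeff_zero)
      fix t :: real
      have "e + t *\<^sub>R w \<in> S" using e w S by (simp add: subspace_add subspace_scale)
      from min[OF this] have "A (e + t *\<^sub>R w) \<bullet> (e + t *\<^sub>R w) - m * ((e + t *\<^sub>R w) \<bullet> (e + t *\<^sub>R w)) \<ge> 0" by simp
      also have "A (e + t *\<^sub>R w) \<bullet> (e + t *\<^sub>R w) - m * ((e + t *\<^sub>R w) \<bullet> (e + t *\<^sub>R w))
         = 2 * t * (A e \<bullet> w - m * (e \<bullet> w)) + t\<^sup>2 * (A w \<bullet> w - m * (w \<bullet> w))"
        using A sym[of w e] ee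
        by (simp add: linear_add linear_cmul inner_add_left inner_add_right m_def[symmetric]
            power2_eq_square algebra_simps inner_commute[of w e])
      finally show "2 * t * (A e \<bullet> w - m * (e \<bullet> w)) + t\<^sup>2 * (A w \<bullet> w - m * (w \<bullet> w)) \<ge> 0" .
    qed
    then show ?thesis by simp
  qed
  have "e \<in> S" "norm e = 1" using e by auto
  then show thesis using min stat unfolding m_def by (rule that)
qed

text \<open>Eigenvectors for different eigenvalues are orthogonal. Finiteness matters because the sum that
  defines the multiset of eigenvalues would be zero over an infinite index set.\<close>

lemma finite_restricted_eigenvalues:
  fixes A :: "'a::euclidean_space \<Rightarrow> 'a"
  assumes sym: "\<And>u v. A u \<bullet> v = A v \<bullet> u"
  shows "finite {l. \<exists>v \<in> restricted_eigenspace A T l. v \<noteq> 0}"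
proof -
  let ?E = "{l. \<exists>v \<in> restricted_eigenspace A T l. v \<noteq> 0}"
  define v where "v l = (SOME v. v \<in> restricted_eigenspace A T l \<and> v \<noteq> 0)" for l
  have v: "v l \<in> restricted_eigenspace A T l \<and> v l \<noteq> 0" if "l \<in> ?E" for l
    unfolding v_def by (rule someI_ex) (use that in blast)
  have orth: "v l \<bullet> v m = 0" if "l \<in> ?E" "m \<in> ?E" "l \<noteq> m" for l m
  proof -
    have "A (v l) \<bullet> v m = l * (v l \<bullet> v m)" "A (v m) \<bullet> v l = m * (v m \<bullet> v l)"
      using v[OF that(1)] v[OF that(2)] by (auto simp: restricted_eigenspace_def)
    then have "(l - m) * (v l \<bullet> v m) = 0" using sym[of "v l" "v m"]
      by (simp add: algebra_simps inner_commute)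
    then show ?thesis using that by simp
  qed
  have "inj_on v ?E"
  proof (rule inj_onI, rule ccontr)
    fix l m assume a: "l \<in> ?E" "m \<in> ?E" "v l = v m" "l \<noteq> m"
    then have "v l \<bullet> v l = 0" using orth[of l m] by simp
    then show False using v[OF a(1)] by simp
  qed
  moreover have "finite (v ` ?E)"
  proof -
    have "pairwise orthogonal (v ` ?E)"
      using orth by (auto simp: pairwise_def orthogonal_def)
    moreover have "0 \<notin> v ` ?E" using v by force
    ultimately show ?thesis using pairwise_orthogonal_independent independent_imp_finite by blast
  qed
  ultimately show ?thesis using finite_imageD by blast
qed

lemma sorted_first_two_le:
  fixes xs :: "real list"
  assumes s: "sorted xs" and sub: "{#a, b#} \<subseteq># mset xs" and ab: "a \<le> b"
  shows "xs ! 0 \<le> a" "xs ! 1 \<le> b"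
proof -
  have "size {#a, b#} \<le> size (mset xs)" using sub size_mset_mono by blast
  then obtain x y ys where xs: "xs = x # y # ys"
    by (cases xs; cases "tl xs") auto
  have ain: "a \<in># mset xs" "b \<in># mset xs" using sub by (auto dest: mset_subset_eqD)
  then show "xs ! 0 \<le> a" using s xs by auto
  show "xs ! 1 \<le> b"
  proof (rule ccontr)
    assume "\<not> xs ! 1 \<le> b"
    then have "b < y" using xs by simp
    then have "b \<notin> set (y # ys)" "a \<notin> set (y # ys)" using s xs ab by auto
    then have eq: "b = x" "a = x" using ain xs by auto
    then have "{#x, x#} \<subseteq># add_mset x (mset (y # ys))" using sub xs by simp
    then have "{#x#} \<subseteq># mset (y # ys)" by (simp del: mset.simps)
    then have "x \<in> set (y # ys)" by (metis single_subset_iff set_mset_mset)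
    then show False using \<open>b \<notin> _\<close> eq by simp
  qed
qed

text \<open>The variational characterisation: minimising the Rayleigh quotient over the subspace, and then
  over the orthogonal complement of a minimiser, gives two eigenvectors, whose eigenvalues dominate
  the two smallest ones.\<close>

lemma two_smallest_eigenvalues_bound:
  fixes A :: "'a::euclidean_space \<Rightarrow> 'a"
  assumes A: "linear A" and sym: "\<And>u v. A u \<bullet> v = A v \<bullet> u"
    and T: "subspace T" "dim T \<ge> 2"
    and pos: "restricted_eigenvalues A T ! 0 + restricted_eigenvalues A T ! 1 > 0"
  obtains e a b where "e \<in> T" "norm e = 1" "a \<le> b" "a + b > 0"
    "\<And>w. w \<in> T \<Longrightarrow> A w \<bullet> w \<ge> a * (w \<bullet> e)\<^sup>2 + b * (w \<bullet> w - (w \<bullet> e)\<^sup>2)"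
proof -
  have "T \<noteq> {0}" using T by auto
  then obtain v0 where v0: "v0 \<in> T" "v0 \<noteq> 0" using subspace_0[OF T(1)] by blast
  obtain e where e: "e \<in> T" "norm e = 1"
    "\<And>w. w \<in> T \<Longrightarrow> A w \<bullet> w \<ge> (A e \<bullet> e) * (w \<bullet> w)"
    "\<And>w. w \<in> T \<Longrightarrow> A e \<bullet> w = (A e \<bullet> e) * (e \<bullet> w)"
    using minimal_rayleigh_eigenvector[OF A sym T(1) v0] by blast
  define S where "S = T \<inter> {w. e \<bullet> w = 0}"
  have S: "subspace S" unfolding S_def by (intro subspace_inter T subspace_hyperplane)
  have ee: "e \<bullet> e = 1" using e(2) by (simp add: dot_square_norm)
  have split: "w - (w \<bullet> e) *\<^sub>R e \<in> S" if "w \<in> T" for w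
    using that e(1) T(1) ee by (simp add: S_def subspace_diff subspace_scale inner_diff_right inner_commute)
  have "\<exists>v1\<in>S. v1 \<noteq> 0"
  proof (rule ccontr)
    assume no: "\<not> ?thesis"
    have "T \<subseteq> span {e}"
    proof
      fix w assume "w \<in> T"
      from split[OF this] no have "w = (w \<bullet> e) *\<^sub>R e" by auto
      then show "w \<in> span {e}" by (metis span_base span_scale insertI1)
    qed
    then have "dim T \<le> card {e}" by (intro dim_le_card) auto
    then show False using T by simp
  qed
  then obtain v1 where v1: "v1 \<in> S" "v1 \<noteq> 0" by blast
  obtain g where g: "g \<in> S" "norm g = 1"
    "\<And>w. w \<in> S \<Longrightarrow> A w \<bullet> w \<ge> (A g \<bullet> g) * (w \<bullet> w)"
    "\<And>w. w \<in> S \<Longrightarrow> A g \<bullet> w = (A g \<bullet> g) * (g \<bullet> w)"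
    using minimal_rayleigh_eigenvector[OF A sym S v1] by blast
  define a b where "a = A e \<bullet> e" and "b = A g \<bullet> g"
  have gT: "g \<in> T" "e \<bullet> g = 0" using g(1) by (auto simp: S_def)
  have gg: "g \<bullet> g = 1" using g(2) by (simp add: dot_square_norm)
  have ab: "a \<le> b" using e(3)[OF gT(1)] gg by (simp add: a_def b_def)
  have Aeg: "A g \<bullet> e = 0" using sym[of g e] e(4)[OF gT(1)] gT by simp
  have eig_e: "e \<in> restricted_eigenspace A T a" 
    unfolding restricted_eigenspace_def a_def using e(1,4) by blast
  have eig_g: "g \<in> restricted_eigenspace A T b"
  proof -
    have "A g \<bullet> w = b * (g \<bullet> w)" if "w \<in> T" for w
      using g(4)[OF split[OF that]] Aeg gT by (simp add: inner_diff_right b_def inner_commute[of g e])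
    then show ?thesis using gT by (simp add: restricted_eigenspace_def)
  qed
  have low: "A w \<bullet> w \<ge> a * (w \<bullet> e)\<^sup>2 + b * (w \<bullet> w - (w \<bullet> e)\<^sup>2)" if w: "w \<in> T" for w
  proof -
    define y where "y = w - (w \<bullet> e) *\<^sub>R e"
    have y: "y \<in> S" unfolding y_def by (rule split[OF w])
    then have yT: "y \<in> T" "e \<bullet> y = 0" by (auto simp: S_def)
    have wy: "w = (w \<bullet> e) *\<^sub>R e + y" by (simp add: y_def)
    have Aey: "A e \<bullet> y = 0" "A y \<bullet> e = 0" using e(4)[OF yT(1)] sym[of y e] yT by auto
    have yy: "y \<bullet> y = w \<bullet> w - (w \<bullet> e)\<^sup>2"
      using ee by (simp add: y_def inner_diff_left inner_diff_right inner_commute power2_eq_square)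
    have "A w \<bullet> w = A ((w \<bullet> e) *\<^sub>R e + y) \<bullet> ((w \<bullet> e) *\<^sub>R e + y)" by (simp only: wy[symmetric])
    also have "\<dots> = (w \<bullet> e)\<^sup>2 * a + A y \<bullet> y"
      using A Aey by (simp add: linear_add linear_cmul inner_add_left inner_add_right a_def power2_eq_square)
    finally show ?thesis using g(3)[OF y] yy by (simp add: b_def mult.commute)
  qed
  define M where "M = (\<Sum>l | \<exists>v \<in> restricted_eigenspace A T l. v \<noteq> 0.
          replicate_mset (dim (restricted_eigenspace A T l)) l)"
  define xs where "xs = restricted_eigenvalues A T"
  have xs: "sorted xs" "mset xs = M"
    by (simp_all add: xs_def restricted_eigenvalues_def M_def)
  have count: "count M l = dim (restricted_eigenspace A T l)"
    if "v \<in> restricted_eigenspace A T l" "v \<noteq> 0" for l v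
  proof -
    have "count M l = (\<Sum>k | \<exists>v \<in> restricted_eigenspace A T k. v \<noteq> 0.
       if k = l then dim (restricted_eigenspace A T k) else 0)"
      unfolding M_def count_sum by (intro sum.cong) auto
    also have "\<dots> = dim (restricted_eigenspace A T l)"
      using that finite_restricted_eigenvalues[OF sym, of T] by (subst sum.delta) auto
    finally show ?thesis .
  qed
  have nz: "e \<noteq> 0" "g \<noteq> 0" using ee gg by auto
  have dim1: "dim (restricted_eigenspace A T l) \<ge> 1"
    if "v \<in> restricted_eigenspace A T l" "v \<noteq> 0" for l v
    using that by (metis dim_eq_0 insert_absorb insert_subset less_one linorder_not_le singletonD subsetD)
  have sub: "{#a, b#} \<subseteq># mset xs"
  proof (cases "a = b")
    case False
    then show ?thesis using count[OF eig_e nz(1)] count[OF eig_g nz(2)] dim1[OF eig_e nz(1)] dim1[OF eig_g nz(2)]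
      by (auto simp: subseteq_mset_def xs simp flip: count_greater_zero_iff)
  next
    case True
    have ne: "e \<noteq> g" using gT ee by auto
    have "independent {e, g}"
      using nz gT ne by (intro pairwise_orthogonal_independent)
        (auto simp: pairwise_def orthogonal_def inner_commute)
    then have "card {e, g} \<le> dim (restricted_eigenspace A T a)"
      using eig_e eig_g True by (intro independent_card_le_dim) auto
    then have "2 \<le> count M a" using count[OF eig_e nz(1)] ne by simp
    then show ?thesis using True by (auto simp: subseteq_mset_def xs)
  qed
  have "xs ! 0 \<le> a" "xs ! 1 \<le> b" using sorted_first_two_le[OF xs(1) sub ab] by auto
  then have "a + b > 0" using pos by (simp add: xs_def)
  with that[of e a b] e(1,2) ab low show thesis by blast
qed

section \<open>A Laplacian computed along the two coordinate directions\<close>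

text \<open>Value of the first two derivatives at \<open>0\<close> of a curve. Asking for the first derivative on a whole neighbourhood of \<open>0\<close>
  makes the second derivative meaningful.\<close>

definition jet2 :: "(real \<Rightarrow> 'a::real_normed_vector) \<Rightarrow> 'a \<Rightarrow> 'a \<Rightarrow> bool" where
  "jet2 X d1 d2 \<longleftrightarrow> (\<exists>X'. (\<forall>\<^sub>F t in nhds 0. (X has_vector_derivative X' t) (at t)) \<and>
      X' 0 = d1 \<and> (X' has_vector_derivative d2) (at 0))"

lemma jet2_const: "jet2 (\<lambda>t. c) 0 0"
  unfolding jet2_def by (intro exI[of _ "\<lambda>t. 0"]) auto

lemma jet2_line: "jet2 (\<lambda>t. z + t *\<^sub>R u) u 0"
proof -
  have "((\<lambda>t. z + t *\<^sub>R u) has_vector_derivative u) (at t)" for t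
    by (auto intro!: derivative_eq_intros)
  then show ?thesis unfolding jet2_def by (intro exI[of _ "\<lambda>t. u"]) auto
qed

lemma jet2_add:
  assumes "jet2 X a b" "jet2 Y c d"
  shows "jet2 (\<lambda>t. X t + Y t) (a + c) (b + d)"
proof -
  obtain X' Y' where *:
    "\<forall>\<^sub>F t in nhds 0. (X has_vector_derivative X' t) (at t)" "X' 0 = a" "(X' has_vector_derivative b) (at 0)"
    "\<forall>\<^sub>F t in nhds 0. (Y has_vector_derivative Y' t) (at t)" "Y' 0 = c" "(Y' has_vector_derivative d) (at 0)"
    using assms by (auto simp: jet2_def)
  from *(1,4) have "\<forall>\<^sub>F t in nhds 0. ((\<lambda>t. X t + Y t) has_vector_derivative X' t + Y' t) (at t)"
    by (rule eventually_elim2) (rule has_vector_derivative_add)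
  then show ?thesis unfolding jet2_def using *(2,5) has_vector_derivative_add[OF *(3,6)]
    by (intro exI[of _ "\<lambda>t. X' t + Y' t"]) auto
qed

lemma jet2_sum:
  assumes "finite I" "\<And>i. i \<in> I \<Longrightarrow> jet2 (X i) (a i) (b i)"
  shows "jet2 (\<lambda>t. \<Sum>i\<in>I. X i t) (\<Sum>i\<in>I. a i) (\<Sum>i\<in>I. b i)"
  using assms
proof (induction I)
  case empty then show ?case using jet2_const[of 0] by simp
next
  case (insert i I)
  then have "jet2 (\<lambda>t. X i t + (\<Sum>i\<in>I. X i t)) (a i + (\<Sum>i\<in>I. a i)) (b i + (\<Sum>i\<in>I. b i))"
    by (intro jet2_add) auto
  then show ?case using insert by simp
qed

lemma jet2_rescale:
  fixes X :: "real \<Rightarrow> 'a::real_normed_vector"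
  assumes "jet2 X a b"
  shows "jet2 (\<lambda>t. X (s * t)) (s *\<^sub>R a) (s\<^sup>2 *\<^sub>R b)"
proof -
  obtain X' where *: "\<forall>\<^sub>F t in nhds 0. (X has_vector_derivative X' t) (at t)" "X' 0 = a"
    "(X' has_vector_derivative b) (at 0)"
    using assms by (auto simp: jet2_def)
  have sc: "((\<lambda>t. Y (s * t)) has_vector_derivative s *\<^sub>R Y') (at t)"
    if "(Y has_vector_derivative Y') (at (s * t))" for Y :: "real \<Rightarrow> 'a" and Y' t
  proof -
    have "((\<lambda>t. s * t) has_real_derivative s) (at t)" by (auto intro!: derivative_eq_intros)
    from vector_diff_chain_at[of "\<lambda>t. s * t" s t Y Y'] this that show ?thesis
      by (simp add: o_def has_real_derivative_iff_has_vector_derivative)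
  qed
  have "filterlim (\<lambda>t. s * t) (nhds 0) (nhds 0)"
  proof -
    have "isCont (\<lambda>t. s * t) 0" by (intro continuous_intros)
    then show ?thesis using tendsto_at_iff_tendsto_nhds[of "\<lambda>t. s * t" 0] by (simp add: isCont_def)
  qed
  from eventually_compose_filterlim[OF *(1) this]
  have "\<forall>\<^sub>F t in nhds 0. ((\<lambda>t. X (s * t)) has_vector_derivative s *\<^sub>R X' (s * t)) (at t)"
    by (rule eventually_mono) (rule sc)
  moreover have "((\<lambda>t. s *\<^sub>R X' (s * t)) has_vector_derivative s *\<^sub>R (s *\<^sub>R b)) (at 0)"
    using sc[of X' b 0] *(3) by (intro bounded_linear.has_vector_derivative[OF bounded_linear_scaleR_right]) auto
  ultimately show ?thesis unfolding jet2_def using *(2)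
    by (intro exI[of _ "\<lambda>t. s *\<^sub>R X' (s * t)"]) (auto simp: power2_eq_square)
qed

lemma jet2_bounded_linear:
  assumes L: "bounded_linear L" and X: "jet2 X a b"
  shows "jet2 (\<lambda>t. L (X t)) (L a) (L b)"
proof -
  obtain X' where
    X': "\<forall>\<^sub>F t in nhds 0. (X has_vector_derivative X' t) (at t)" "X' 0 = a" "(X' has_vector_derivative b) (at 0)"
    using X by (auto simp: jet2_def)
  have "\<forall>\<^sub>F t in nhds 0. ((\<lambda>t. L (X t)) has_vector_derivative L (X' t)) (at t)"
    using X'(1) by (rule eventually_mono) (rule bounded_linear.has_vector_derivative[OF L])
  then show ?thesis unfolding jet2_def using X' bounded_linear.has_vector_derivative[OF L X'(3)]
    by (intro exI[of _ "\<lambda>t. L (X' t)"]) auto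
qed

lemma jet2_bounded_bilinear:
  assumes P: "bounded_bilinear P" and "jet2 X a b" "jet2 Y c d"
  shows "jet2 (\<lambda>t. P (X t) (Y t)) (P (X 0) c + P a (Y 0)) (P (X 0) d + P a c + (P a c + P b (Y 0)))"
proof -
  obtain X' Y' where
    *: "\<forall>\<^sub>F t in nhds 0. (X has_vector_derivative X' t) (at t)" "X' 0 = a" "(X' has_vector_derivative b) (at 0)"
    "\<forall>\<^sub>F t in nhds 0. (Y has_vector_derivative Y' t) (at t)" "Y' 0 = c" "(Y' has_vector_derivative d) (at 0)"
    using assms by (auto simp: jet2_def)
  have "\<forall>\<^sub>F t in nhds 0. ((\<lambda>t. P (X t) (Y t)) has_vector_derivative P (X t) (Y' t) + P (X' t) (Y t)) (at t)"
    using eventually_conj[OF *(1,4)]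
    by (rule eventually_mono) (auto intro: bounded_bilinear.has_vector_derivative[OF P])
  moreover have "(X has_vector_derivative X' 0) (at 0)" "(Y has_vector_derivative Y' 0) (at 0)"
    using *(1,4) by (auto dest: eventually_nhds_x_imp_x)
  then have "((\<lambda>t. P (X t) (Y' t) + P (X' t) (Y t)) has_vector_derivative
      (P (X 0) d + P a c + (P a c + P b (Y 0)))) (at 0)"
    using *(2,3,5,6) bounded_bilinear.has_vector_derivative[OF P, of X "X' 0" 0 UNIV Y' d]
      bounded_bilinear.has_vector_derivative[OF P, of X' b 0 UNIV Y "Y' 0"]
    by (auto intro!: has_vector_derivative_add)
  ultimately show ?thesis unfolding jet2_def using *(2,5)
    by (intro exI[of _ "\<lambda>t. P (X t) (Y' t) + P (X' t) (Y t)"]) auto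
qed

lemmas jet2_inner = jet2_bounded_bilinear[OF bounded_bilinear_inner]

lemma jet2_ln:
  fixes q :: "real \<Rightarrow> real"
  assumes q: "jet2 q a b" and pos: "q 0 > 0"
  shows "jet2 (\<lambda>t. ln (q t)) (a / q 0) (b / q 0 - (a / q 0)\<^sup>2)"
proof -
  obtain q' where
    *: "\<forall>\<^sub>F t in nhds 0. (q has_vector_derivative q' t) (at t)" "q' 0 = a" "(q' has_vector_derivative b) (at 0)"
    using q by (auto simp: jet2_def)
  have d0: "(q has_real_derivative a) (at 0)"
    using eventually_nhds_x_imp_x[OF *(1)] *(2) by (simp add: has_real_derivative_iff_has_vector_derivative)
  then have "isCont q 0" by (rule DERIV_isCont)
  then have "\<forall>\<^sub>F t in at 0. q t > 0" using pos
    by (auto simp: isCont_def dest!: order_tendstoD(1)[where a=0])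
  then have "\<forall>\<^sub>F t in nhds 0. q t > 0" using pos eventually_nhds_conv_at by blast
  with *(1) have "\<forall>\<^sub>F t in nhds 0. ((\<lambda>t. ln (q t)) has_vector_derivative q' t / q t) (at t)"
    by (rule eventually_elim2)
       (auto simp flip: has_real_derivative_iff_has_vector_derivative intro!: derivative_eq_intros)
  moreover have "((\<lambda>t. q' t / q t) has_vector_derivative (b / q 0 - (a / q 0)\<^sup>2)) (at 0)"
    unfolding has_real_derivative_iff_has_vector_derivative[symmetric]
    using *(2,3) d0 pos unfolding has_real_derivative_iff_has_vector_derivative[symmetric]
    by (auto intro!: derivative_eq_intros simp: power2_eq_square field_simps)
  ultimately show ?thesis unfolding jet2_def using *(2) by (intro exI[of _ "\<lambda>t. q' t / q t"]) auto
qed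

text \<open>If the second derivative were positive, the first derivative, which vanishes at the maximum, would be positive just to the right of it.\<close>

lemma jet2_local_max:
  fixes q :: "real \<Rightarrow> real"
  assumes q: "jet2 q a b" and max: "\<forall>\<^sub>F t in nhds 0. q t \<le> q 0"
  shows "b \<le> 0"
proof (rule ccontr)
  assume "\<not> b \<le> 0"
  then have b: "b > 0" by simp
  obtain q' where *: "\<forall>\<^sub>F t in nhds 0. (q has_vector_derivative q' t) (at t)" "q' 0 = a" "(q' has_vector_derivative b) (at 0)"
    using q by (auto simp: jet2_def)
  obtain d where d: "d > 0" "\<And>t. dist t 0 < d \<Longrightarrow> (q has_vector_derivative q' t) (at t) \<and> q t \<le> q 0"
    using eventually_conj[OF *(1) max] unfolding eventually_nhds_metric by auto
  have der: "(q has_real_derivative q' t) (at t)" if "\<bar>t\<bar> < d" for t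
    using d(2)[of t] that by (simp add: has_real_derivative_iff_has_vector_derivative)
  have "q' 0 = 0"
    using DERIV_local_max[OF der[of 0] d(1)] d by auto
  moreover have "(q' has_real_derivative b) (at 0)"
    using *(3) by (simp add: has_real_derivative_iff_has_vector_derivative)
  ultimately obtain s where s: "s > 0" "\<And>t. 0 < t \<Longrightarrow> t < s \<Longrightarrow> q' t > 0"
    using DERIV_pos_inc_right[of q' b 0] b by auto
  define t where "t = min s d / 2"
  have t: "0 < t" "t < s" "t < d" using s d by (auto simp: t_def)
  have "\<exists>z. 0 < z \<and> z < t \<and> q t - q 0 = (t - 0) * q' z"
    by (rule MVT2) (use t der in auto)
  then obtain z where "0 < z" "z < t" "q t - q 0 = t * q' z" by auto
  then have "q t > q 0" using s(2)[of z] t by (smt (verit) mult_pos_pos)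
  then show False using d(2)[of t] t by auto
qed

text \<open>The Laplacian is only ever needed at one point and along the coordinate lines, where the one-variable calculus rules apply
  to compositions with vector-valued maps.\<close>

definition laplacian_at :: "(complex \<Rightarrow> real) \<Rightarrow> complex \<Rightarrow> real \<Rightarrow> bool" where
  "laplacian_at q z L \<longleftrightarrow> (\<exists>a1 b1 a2 b2.
     jet2 (\<lambda>t. q (z + t *\<^sub>R 1)) a1 b1 \<and> jet2 (\<lambda>t. q (z + t *\<^sub>R \<i>)) a2 b2 \<and> L = b1 + b2)"

lemma laplacian_add:
  assumes "laplacian_at p z K" "laplacian_at q z L"
  shows "laplacian_at (\<lambda>z. p z + q z) z (K + L)"
proof -
  from assms obtain a1 b1 a2 b2 c1 d1 c2 d2 where
    "jet2 (\<lambda>t. p (z + t *\<^sub>R 1)) a1 b1" "jet2 (\<lambda>t. p (z + t *\<^sub>R \<i>)) a2 b2" "K = b1 + b2"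
    "jet2 (\<lambda>t. q (z + t *\<^sub>R 1)) c1 d1" "jet2 (\<lambda>t. q (z + t *\<^sub>R \<i>)) c2 d2" "L = d1 + d2"
    unfolding laplacian_at_def by blast
  then show ?thesis unfolding laplacian_at_def
    by (intro exI[of _ "a1 + c1"] exI[of _ "b1 + d1"] exI[of _ "a2 + c2"] exI[of _ "b2 + d2"])
       (auto intro: jet2_add)
qed

lemma laplacian_cmult:
  assumes "laplacian_at q z L" shows "laplacian_at (\<lambda>z. c * q z) z (c * L)"
proof -
  obtain a1 b1 a2 b2 where "jet2 (\<lambda>t. q (z + t *\<^sub>R 1)) a1 b1" "jet2 (\<lambda>t. q (z + t *\<^sub>R \<i>)) a2 b2" "L = b1 + b2"
    using assms unfolding laplacian_at_def by blast
  moreover have "bounded_linear ((*) c)" by (rule bounded_linear_mult_right)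
  ultimately show ?thesis unfolding laplacian_at_def
    by (intro exI[of _ "c * a1"] exI[of _ "c * b1"] exI[of _ "c * a2"] exI[of _ "c * b2"])
       (auto intro: jet2_bounded_linear[where L="(*) c"] simp: distrib_left)
qed

lemma laplacian_const: "laplacian_at (\<lambda>z. c) z 0"
  unfolding laplacian_at_def using jet2_const[of c]
  by (intro exI[of _ "0::real"]) simp

lemma tendsto_line: "((\<lambda>t::real. z + t *\<^sub>R (u::complex)) \<longlongrightarrow> z) (nhds 0)"
proof -
  have "isCont (\<lambda>t::real. z + t *\<^sub>R u) 0" by (intro continuous_intros)
  then show ?thesis using tendsto_at_iff_tendsto_nhds[of "\<lambda>t. z + t *\<^sub>R u" 0] by (simp add: isCont_def)
qed

lemma laplacian_cong:
  assumes "\<forall>\<^sub>F w in nhds z. p w = q w"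
  shows "laplacian_at p z L \<longleftrightarrow> laplacian_at q z L"
proof -
  have jc: "jet2 Y a b" if X: "jet2 X a b" and XY: "\<forall>\<^sub>F t in nhds 0. X t = Y t" for X Y :: "real \<Rightarrow> real" and a b
  proof -
    obtain X' where *: "\<forall>\<^sub>F t in nhds 0. (X has_vector_derivative X' t) (at t)" "X' 0 = a"
      "(X' has_vector_derivative b) (at 0)" using X by (auto simp: jet2_def)
    have "\<forall>\<^sub>F t in nhds 0. \<forall>\<^sub>F s in nhds t. X s = Y s" using XY by (simp add: eventually_eventually)
    with *(1) have "\<forall>\<^sub>F t in nhds 0. (Y has_vector_derivative X' t) (at t)"
    proof eventually_elim
      case (elim t)
      then show ?case using has_vector_derivative_cong_ev[where S = UNIV and f = X and g = Y and x = t and f' = "X' t"]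
        by (auto dest: eventually_nhds_x_imp_x)
    qed
    with * show ?thesis by (auto simp: jet2_def)
  qed
  have dir: "laplacian_at q z L" if p: "laplacian_at p z L" and pq: "\<forall>\<^sub>F w in nhds z. p w = q w" for p q
  proof -
    have ev: "\<forall>\<^sub>F t in nhds 0. p (z + t *\<^sub>R u) = q (z + t *\<^sub>R u)" for u
      using eventually_compose_filterlim[OF pq tendsto_line] .
    obtain a1 b1 a2 b2 where
      *: "jet2 (\<lambda>t. p (z + t *\<^sub>R 1)) a1 b1" "jet2 (\<lambda>t. p (z + t *\<^sub>R \<i>)) a2 b2" "L = b1 + b2"
      using p unfolding laplacian_at_def by blast
    from jc[OF *(1) ev] jc[OF *(2) ev] *(3) show ?thesis unfolding laplacian_at_def by blast
  qed
  have "\<forall>\<^sub>F w in nhds z. q w = p w" using assms by (rule eventually_mono) simp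
  then show ?thesis using dir[OF _ assms] dir[of q p] by blast
qed

lemma laplacian_local_max:
  assumes q: "laplacian_at q z L" and max: "\<forall>\<^sub>F w in nhds z. q w \<le> q z"
  shows "L \<le> 0"
proof -
  obtain a1 b1 a2 b2 where *: "jet2 (\<lambda>t. q (z + t *\<^sub>R 1)) a1 b1" "jet2 (\<lambda>t. q (z + t *\<^sub>R \<i>)) a2 b2" "L = b1 + b2"
    using q unfolding laplacian_at_def by blast
  have "\<forall>\<^sub>F t in nhds 0. q (z + t *\<^sub>R u) \<le> q (z + 0 *\<^sub>R u)" for u
    using eventually_compose_filterlim[OF max tendsto_line[of z u]] by simp
  then have "b1 \<le> 0" "b2 \<le> 0" using jet2_local_max[OF *(1)] jet2_local_max[OF *(2)] by auto
  then show ?thesis using *(3) by simp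
qed

lemma laplacian_norm_sq: "laplacian_at (\<lambda>z. (norm z)\<^sup>2) z 4"
proof -
  note j = jet2_line[of z]
  show ?thesis unfolding laplacian_at_def power2_norm_eq_inner
    using jet2_inner[OF j[of 1] j[of 1]] jet2_inner[OF j[of \<i>] j[of \<i>]]
    by (intro exI conjI) (assumption | simp)+
qed

text \<open>Differentiating twice along \<open>\<i>\<close> contributes the factor \<open>\<i>^2 = -1\<close>.\<close>

lemma laplacian_Re_holomorphic:
  assumes F: "F holomorphic_on S" and S: "open S" "z \<in> S"
  shows "laplacian_at (\<lambda>z. Re (F z)) z 0"
proof -
  have F': "deriv F holomorphic_on S" using F S by (simp add: holomorphic_deriv)
  have comp: "((\<lambda>t. G (z + t *\<^sub>R u)) has_vector_derivative u * deriv G (z + t *\<^sub>R u)) (at t)"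
    if "G holomorphic_on S" "z + t *\<^sub>R u \<in> S" for G u t
  proof -
    have "(G has_field_derivative deriv G (z + t *\<^sub>R u)) (at (z + t *\<^sub>R u))"
      using that S holomorphic_derivI by blast
    moreover have "((\<lambda>t. z + t *\<^sub>R u) has_vector_derivative u) (at t)"
      by (auto intro!: derivative_eq_intros)
    ultimately show ?thesis using field_vector_diff_chain_at[of "\<lambda>t. z + t *\<^sub>R u" u t G] by (simp add: o_def)
  qed
  have j: "jet2 (\<lambda>t. Re (F (z + t *\<^sub>R u))) (Re (u * deriv F z)) (Re (u * (u * deriv (deriv F) z)))" for u
  proof (rule jet2_bounded_linear[OF bounded_linear_Re])
    have "\<forall>\<^sub>F t in nhds 0. z + t *\<^sub>R u \<in> S"
      using eventually_compose_filterlim[OF eventually_nhds_in_open[OF S] tendsto_line[of z u]] .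
    then have "\<forall>\<^sub>F t in nhds 0. ((\<lambda>t. F (z + t *\<^sub>R u)) has_vector_derivative u * deriv F (z + t *\<^sub>R u)) (at t)"
      by (rule eventually_mono) (rule comp[OF F])
    moreover have "((\<lambda>t. u * deriv F (z + t *\<^sub>R u)) has_vector_derivative u * (u * deriv (deriv F) z)) (at 0)"
      using comp[OF F', of 0 u] S by (auto intro!: has_vector_derivative_mult_right)
    ultimately show "jet2 (\<lambda>t. F (z + t *\<^sub>R u)) (u * deriv F z) (u * (u * deriv (deriv F) z))"
      unfolding jet2_def by (intro exI[of _ "\<lambda>t. u * deriv F (z + t *\<^sub>R u)"]) auto
  qed
  show ?thesis unfolding laplacian_at_def
    using j[of 1] j[of \<i>] by (intro exI conjI) (assumption | simp)+
qed

lemma laplacian_ln_norm_sq: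
  assumes "z \<noteq> 0" shows "laplacian_at (\<lambda>z. ln ((norm z)\<^sup>2)) z 0"
proof -
  note j = jet2_line[of z]
  define q where "q = z \<bullet> z"
  have q: "q > 0" "q = (Re z)\<^sup>2 + (Im z)\<^sup>2"
    using assms inner_gt_zero_iff[of z] by (simp_all only: q_def) (simp_all add: inner_complex_def power2_eq_square)
  have "2 / q - (2 * Re z / q)\<^sup>2 + (2 / q - (2 * Im z / q)\<^sup>2) = 4 / q - 4 * ((Re z)\<^sup>2 + (Im z)\<^sup>2) / q\<^sup>2"
    by (simp add: power2_eq_square diff_divide_distrib add_divide_distrib algebra_simps)
  also have "\<dots> = 4 / q - 4 * q / q\<^sup>2" by (simp only: q(2)[symmetric])
  also have "\<dots> = 0" using q(1) by (simp add: power2_eq_square)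
  finally have s: "2 / q - (2 * Re z / q)\<^sup>2 + (2 / q - (2 * Im z / q)\<^sup>2) = 0" .
  show ?thesis unfolding laplacian_at_def power2_norm_eq_inner
    using jet2_ln[OF jet2_inner[OF j[of 1] j[of 1]]] jet2_ln[OF jet2_inner[OF j[of \<i>] j[of \<i>]]] s q(1)
    by (intro exI conjI) (assumption | simp add: q_def inner_complex_def)+
qed

section \<open>Conformal harmonic maps of the disc\<close>

text \<open>The harmonicity and conformality conditions at one point, in the form in which they enter the computation of Laplacians.\<close>

definition conformal_jet :: "(complex \<Rightarrow> 'a::euclidean_space) \<Rightarrow> complex \<Rightarrow> bool" where
  "conformal_jet f z \<longleftrightarrow> f differentiable (at z) \<and>
     (\<exists>a b xx yy. jet2 (\<lambda>t. f (z + t *\<^sub>R 1)) a xx \<and> jet2 (\<lambda>t. f (z + t *\<^sub>R \<i>)) b yy \<and>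
        xx + yy = 0 \<and> a \<bullet> a = b \<bullet> b \<and> a \<bullet> b = 0)"

text \<open>Restricting \<open>f\<close> to smaller discs lets the estimates at the centre be used at any point.\<close>

lemma conformal_jet_rescale:
  assumes f: "conformal_jet f (z + s *\<^sub>R \<zeta>)"
  shows "conformal_jet (\<lambda>\<zeta>. f (z + s *\<^sub>R \<zeta>)) \<zeta>"
proof -
  obtain a b xx yy where j: "jet2 (\<lambda>t. f (z + s *\<^sub>R \<zeta> + t *\<^sub>R 1)) a xx"
    "jet2 (\<lambda>t. f (z + s *\<^sub>R \<zeta> + t *\<^sub>R \<i>)) b yy" "xx + yy = 0" "a \<bullet> a = b \<bullet> b" "a \<bullet> b = 0"
    using f by (auto simp: conformal_jet_def)
  have "jet2 (\<lambda>t. f (z + s *\<^sub>R (\<zeta> + t *\<^sub>R 1))) (s *\<^sub>R a) (s\<^sup>2 *\<^sub>R xx)"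
    "jet2 (\<lambda>t. f (z + s *\<^sub>R (\<zeta> + t *\<^sub>R \<i>))) (s *\<^sub>R b) (s\<^sup>2 *\<^sub>R yy)"
    using jet2_rescale[OF j(1), of s] jet2_rescale[OF j(2), of s] by (simp_all add: algebra_simps)
  moreover have "s\<^sup>2 *\<^sub>R xx + s\<^sup>2 *\<^sub>R yy = 0" using j(3) by (metis scaleR_add_right scaleR_zero_right)
  moreover have "(s *\<^sub>R a) \<bullet> (s *\<^sub>R a) = (s *\<^sub>R b) \<bullet> (s *\<^sub>R b)" "(s *\<^sub>R a) \<bullet> (s *\<^sub>R b) = 0" using j by auto
  moreover have "(\<lambda>\<zeta>. f (z + s *\<^sub>R \<zeta>)) differentiable (at \<zeta>)"
  proof -
    have "(f \<circ> (\<lambda>\<zeta>. z + s *\<^sub>R \<zeta>)) differentiable (at \<zeta>)"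
      using f by (intro differentiable_chain_at derivative_intros) (auto simp: conformal_jet_def)
    then show ?thesis by (simp add: o_def)
  qed
  ultimately show ?thesis unfolding conformal_jet_def by blast
qed

lemma jet2_C2_line:
  assumes u: "C2_on S u" and S: "open S" "z \<in> S"
  shows "jet2 (\<lambda>t. u (z + t *\<^sub>R w)) (gradient u z \<bullet> w) (hessian u z w \<bullet> w)"
proof -
  have "isCont (\<lambda>t::real. z + t *\<^sub>R w) 0" by (intro continuous_intros)
  then have "((\<lambda>t::real. z + t *\<^sub>R w) \<longlongrightarrow> z) (nhds 0)"
    using tendsto_at_iff_tendsto_nhds[of "\<lambda>t. z + t *\<^sub>R w" 0] by (simp add: isCont_def)
  from eventually_compose_filterlim[OF eventually_nhds_in_open[OF S] this]
  have "\<forall>\<^sub>F t in nhds 0. ((\<lambda>t. u (z + t *\<^sub>R w)) has_vector_derivative gradient u (z + t *\<^sub>R w) \<bullet> w) (at t)"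
    by (rule eventually_mono)
      (auto intro: C2_on_line[OF u] simp flip: has_real_derivative_iff_has_vector_derivative)
  moreover have "((\<lambda>t. gradient u (z + t *\<^sub>R w) \<bullet> w) has_vector_derivative hessian u z w \<bullet> w) (at 0)"
    using C2_on_gradient_line[OF u, of z 0 w w] S by (simp add: has_real_derivative_iff_has_vector_derivative)
  ultimately show ?thesis unfolding jet2_def by (intro exI[of _ "\<lambda>t. gradient u (z + t *\<^sub>R w) \<bullet> w"]) auto
qed

lemma conformal_harmonic_map_jet:
  fixes f :: "complex \<Rightarrow> 'a::euclidean_space"
  assumes f: "f \<in> conformal_harmonic_maps D" and z: "z \<in> ball 0 1"
  shows "conformal_jet f z"
proof -
  define g where "g b = gradient (\<lambda>z. f z \<bullet> b) z" for b
  define H where "H b = hessian (\<lambda>z. f z \<bullet> b) z" for b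
  have harm: "harmonic_on (ball 0 1) (\<lambda>z. f z \<bullet> b)" if "b \<in> Basis" for b
    using f that by (auto simp: conformal_harmonic_maps_def)
  then have C2: "C2_on (ball 0 1) (\<lambda>z. f z \<bullet> b)" if "b \<in> Basis" for b
    using that by (auto simp: harmonic_on_def)
  have rep: "f w = (\<Sum>b\<in>Basis. (f w \<bullet> b) *\<^sub>R b)" for w by (simp add: euclidean_representation)
  have j: "jet2 (\<lambda>t. f (z + t *\<^sub>R u)) (\<Sum>b\<in>Basis. (g b \<bullet> u) *\<^sub>R b) (\<Sum>b\<in>Basis. (H b u \<bullet> u) *\<^sub>R b)" for u
  proof -
    have "jet2 (\<lambda>t. \<Sum>b\<in>Basis. (f (z + t *\<^sub>R u) \<bullet> b) *\<^sub>R b) (\<Sum>b\<in>Basis. (g b \<bullet> u) *\<^sub>R b) (\<Sum>b\<in>Basis. (H b u \<bullet> u) *\<^sub>R b)"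
      unfolding g_def H_def
      by (intro jet2_sum jet2_bounded_linear[OF bounded_linear_scaleR_left] jet2_C2_line[OF C2 open_ball z] finite_Basis)
    then show ?thesis by (simp only: rep[symmetric])
  qed
  have d: "(f has_derivative (\<lambda>h. \<Sum>b\<in>Basis. (g b \<bullet> h) *\<^sub>R b)) (at z)"
  proof -
    have "((\<lambda>w. \<Sum>b\<in>Basis. (f w \<bullet> b) *\<^sub>R b) has_derivative (\<lambda>h. \<Sum>b\<in>Basis. (g b \<bullet> h) *\<^sub>R b)) (at z)"
      unfolding g_def by (intro has_derivative_sum has_derivative_scaleR_left C2_on_gradient[OF C2 z])
    then show ?thesis by (simp only: rep[symmetric])
  qed
  have px: "partial_x f z = (\<Sum>b\<in>Basis. (g b \<bullet> 1) *\<^sub>R b)" "partial_y f z = (\<Sum>b\<in>Basis. (g b \<bullet> \<i>) *\<^sub>R b)"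
    unfolding partial_x_def partial_y_def frechet_derivative_at[OF d, symmetric] by auto
  have "norm (partial_x f z) = norm (partial_y f z)" "partial_x f z \<bullet> partial_y f z = 0"
    using f z by (auto simp: conformal_harmonic_maps_def)
  then have "partial_x f z \<bullet> partial_x f z = partial_y f z \<bullet> partial_y f z" "partial_x f z \<bullet> partial_y f z = 0"
    by (auto simp: dot_square_norm)
  moreover have "(\<Sum>b\<in>Basis. (H b 1 \<bullet> 1) *\<^sub>R b) + (\<Sum>b\<in>Basis. (H b \<i> \<bullet> \<i>) *\<^sub>R b) = 0"
  proof -
    have "H b 1 \<bullet> 1 + H b \<i> \<bullet> \<i> = 0" if "b \<in> Basis" for b
    proof -
      have "(\<Sum>k\<in>Basis. hessian (\<lambda>z. f z \<bullet> b) z k \<bullet> k) = 0"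
        using harm[OF that] z unfolding harmonic_on_def by blast
      then show ?thesis by (simp add: Basis_complex_def H_def)
    qed
    then show ?thesis by (simp flip: sum.distrib scaleR_add_left)
  qed
  ultimately show ?thesis unfolding conformal_jet_def
    using j[of 1] j[of \<i>] d unfolding px differentiable_def by blast
qed

text \<open>The vectors \<open>a\<close>, \<open>b\<close> form a multiple of an orthonormal pair. This is what limits the energy of a conformal map in a
  single direction to half of the total energy, and so permits one negative eigenvalue.\<close>

lemma conformal_pair_bessel:
  fixes a b e :: "'a::real_inner"
  assumes "a \<bullet> a = b \<bullet> b" "a \<bullet> b = 0"
  shows "(a \<bullet> e)\<^sup>2 + (b \<bullet> e)\<^sup>2 \<le> (a \<bullet> a) * (e \<bullet> e)"
proof (cases "a = 0")
  case True then show ?thesis using assms by simp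
next
  case False
  define s where "s = a \<bullet> a"
  have s: "s > 0" using False by (simp add: s_def)
  define w where "w = s *\<^sub>R e - (a \<bullet> e) *\<^sub>R a - (b \<bullet> e) *\<^sub>R b"
  have "w \<bullet> w = s * (s * (e \<bullet> e) - ((a \<bullet> e)\<^sup>2 + (b \<bullet> e)\<^sup>2))"
    using assms unfolding w_def s_def
    by (simp add: inner_diff_left inner_diff_right inner_commute[of e a] inner_commute[of e b] inner_commute[of b a]
        power2_eq_square algebra_simps)
  moreover have "w \<bullet> w \<ge> 0" by simp
  ultimately have "s * (e \<bullet> e) - ((a \<bullet> e)\<^sup>2 + (b \<bullet> e)\<^sup>2) \<ge> 0" using s by (simp add: zero_le_mult_iff)
  then show ?thesis by (simp add: s_def)
qed

lemma laplacian_linear_conformal: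
  assumes "conformal_jet f z"
  shows "laplacian_at (\<lambda>z. f z \<bullet> w) z 0"
proof -
  obtain a b xx yy where j: "jet2 (\<lambda>t. f (z + t *\<^sub>R 1)) a xx"
    "jet2 (\<lambda>t. f (z + t *\<^sub>R \<i>)) b yy" "xx + yy = 0"
    using assms by (auto simp: conformal_jet_def)
  have "xx \<bullet> w + yy \<bullet> w = 0" using j(3) by (metis inner_add_left inner_zero_left)
  then show ?thesis unfolding laplacian_at_def
    using jet2_bounded_linear[OF bounded_linear_inner_left j(1), of w] jet2_bounded_linear[OF bounded_linear_inner_left j(2), of w]
    by metis
qed

lemma conformal_jet_translate: "conformal_jet f z \<Longrightarrow> conformal_jet (\<lambda>z. f z - p) z"
proof -
  assume f: "conformal_jet f z"
  then obtain a b xx yy where j: "jet2 (\<lambda>t. f (z + t *\<^sub>R 1)) a xx"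
    "jet2 (\<lambda>t. f (z + t *\<^sub>R \<i>)) b yy" "xx + yy = 0" "a \<bullet> a = b \<bullet> b" "a \<bullet> b = 0" "f differentiable at z"
    by (auto simp: conformal_jet_def)
  from jet2_add[OF j(1) jet2_const[of "-p"]] jet2_add[OF j(2) jet2_const[of "-p"]] j(3-)
  show ?thesis unfolding conformal_jet_def by (intro conjI exI[of _ a] exI[of _ b] exI[of _ xx] exI[of _ yy]) auto
qed

text \<open>All three are computed with the same pair \<open>a\<close>, \<open>b\<close> of partial derivatives, so that they can be combined and compared by
  \<open>conformal_pair_bessel\<close>. Second derivatives of \<open>f\<close> drop out by harmonicity.\<close>

lemma laplacian_square_conformal:
  assumes "conformal_jet f z"
  obtains a b where "a \<bullet> a = b \<bullet> b" "a \<bullet> b = 0"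
    "laplacian_at (\<lambda>z. f z \<bullet> f z) z (4 * (a \<bullet> a))"
    "\<forall>e. laplacian_at (\<lambda>z. (f z \<bullet> e)\<^sup>2) z (2 * ((a \<bullet> e)\<^sup>2 + (b \<bullet> e)\<^sup>2))"
    "f z \<noteq> 0 \<longrightarrow> laplacian_at (\<lambda>z. ln (f z \<bullet> f z)) z
       (4 * (a \<bullet> a) / (f z \<bullet> f z) - 4 * ((a \<bullet> f z)\<^sup>2 + (b \<bullet> f z)\<^sup>2) / (f z \<bullet> f z)\<^sup>2)"
proof -
  obtain a b xx yy where j: "jet2 (\<lambda>t. f (z + t *\<^sub>R 1)) a xx"
    "jet2 (\<lambda>t. f (z + t *\<^sub>R \<i>)) b yy" "xx + yy = 0" "a \<bullet> a = b \<bullet> b" "a \<bullet> b = 0"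
    using assms by (auto simp: conformal_jet_def)
  have yy: "yy = - xx" using j(3) by (simp add: eq_neg_iff_add_eq_0 add.commute)
  note q1 = jet2_inner[OF j(1) j(1)] and q2 = jet2_inner[OF j(2) j(2)]
  show thesis
  proof (rule that[OF j(4,5)])
    show "laplacian_at (\<lambda>z. f z \<bullet> f z) z (4 * (a \<bullet> a))" unfolding laplacian_at_def
      using q1 q2 j(4) yy by (intro exI conjI) (assumption | simp add: inner_commute)+
    have "laplacian_at (\<lambda>z. (f z \<bullet> e)\<^sup>2) z (2 * ((a \<bullet> e)\<^sup>2 + (b \<bullet> e)\<^sup>2))" for e
      unfolding laplacian_at_def power2_eq_square
      using jet2_bounded_bilinear[OF bounded_bilinear_mult jet2_bounded_linear[OF bounded_linear_inner_left j(1), of e]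
          jet2_bounded_linear[OF bounded_linear_inner_left j(1), of e]]
        jet2_bounded_bilinear[OF bounded_bilinear_mult jet2_bounded_linear[OF bounded_linear_inner_left j(2), of e]
          jet2_bounded_linear[OF bounded_linear_inner_left j(2), of e]] yy
      by (intro exI conjI) (assumption | simp add: algebra_simps)+
    then show "\<forall>e. laplacian_at (\<lambda>z. (f z \<bullet> e)\<^sup>2) z (2 * ((a \<bullet> e)\<^sup>2 + (b \<bullet> e)\<^sup>2))" by blast
    show "f z \<noteq> 0 \<longrightarrow> laplacian_at (\<lambda>z. ln (f z \<bullet> f z)) z
       (4 * (a \<bullet> a) / (f z \<bullet> f z) - 4 * ((a \<bullet> f z)\<^sup>2 + (b \<bullet> f z)\<^sup>2) / (f z \<bullet> f z)\<^sup>2)"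
    proof
      assume "f z \<noteq> 0"
      define q where "q = f z \<bullet> f z"
      have q: "q > 0" using \<open>f z \<noteq> 0\<close> by (simp add: q_def)
      have l: "jet2 (\<lambda>t. ln (f (z + t *\<^sub>R 1) \<bullet> f (z + t *\<^sub>R 1))) (2 * (a \<bullet> f z) / q)
          ((2 * (xx \<bullet> f z) + 2 * (a \<bullet> a)) / q - (2 * (a \<bullet> f z) / q)\<^sup>2)"
        "jet2 (\<lambda>t. ln (f (z + t *\<^sub>R \<i>) \<bullet> f (z + t *\<^sub>R \<i>))) (2 * (b \<bullet> f z) / q)
          ((2 * (yy \<bullet> f z) + 2 * (b \<bullet> b)) / q - (2 * (b \<bullet> f z) / q)\<^sup>2)"
        using jet2_ln[OF q1] jet2_ln[OF q2] q by (simp_all add: q_def inner_commute algebra_simps)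
      have "(4 * (a \<bullet> a) / q - 4 * ((a \<bullet> f z)\<^sup>2 + (b \<bullet> f z)\<^sup>2) / q\<^sup>2) =
         ((2 * (xx \<bullet> f z) + 2 * (a \<bullet> a)) / q - (2 * (a \<bullet> f z) / q)\<^sup>2) + ((2 * (yy \<bullet> f z) + 2 * (b \<bullet> b)) / q - (2 * (b \<bullet> f z) / q)\<^sup>2)"
        unfolding yy j(4)[symmetric] by (simp add: power_divide power_mult_distrib add_divide_distrib diff_divide_distrib)
      then show "laplacian_at (\<lambda>z. ln (f z \<bullet> f z)) z
         (4 * (a \<bullet> a) / (f z \<bullet> f z) - 4 * ((a \<bullet> f z)\<^sup>2 + (b \<bullet> f z)\<^sup>2) / (f z \<bullet> f z)\<^sup>2)"
        unfolding laplacian_at_def q_def[symmetric] using l by blast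
    qed
  qed
qed

text \<open>The trace of the Hessian of \<open>ln |y|^2\<close> on a plane is proportional to one minus the squared length of the
  projection of the radial direction to the plane.\<close>

lemma laplacian_ln_dist_conformal:
  assumes f: "conformal_jet f z" and y: "f z \<noteq> y"
  obtains L where "L \<ge> 0" "laplacian_at (\<lambda>z. ln ((f z - y) \<bullet> (f z - y))) z L"
proof -
  obtain a b where ab: "a \<bullet> a = b \<bullet> b" "a \<bullet> b = 0"
    "laplacian_at (\<lambda>z. (f z - y) \<bullet> (f z - y)) z (4 * (a \<bullet> a))"
    "\<forall>e. laplacian_at (\<lambda>z. ((f z - y) \<bullet> e)\<^sup>2) z (2 * ((a \<bullet> e)\<^sup>2 + (b \<bullet> e)\<^sup>2))"
    "f z - y \<noteq> 0 \<longrightarrow> laplacian_at (\<lambda>z. ln ((f z - y) \<bullet> (f z - y))) z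
       (4 * (a \<bullet> a) / ((f z - y) \<bullet> (f z - y)) - 4 * ((a \<bullet> (f z - y))\<^sup>2 + (b \<bullet> (f z - y))\<^sup>2) / ((f z - y) \<bullet> (f z - y))\<^sup>2)"
    by (rule laplacian_square_conformal[OF conformal_jet_translate[OF f, of y]])
  define q where "q = (f z - y) \<bullet> (f z - y)"
  have q: "q > 0" using y by (simp add: q_def)
  have "4 * ((a \<bullet> (f z - y))\<^sup>2 + (b \<bullet> (f z - y))\<^sup>2) / q\<^sup>2 \<le> 4 * ((a \<bullet> a) * q) / q\<^sup>2"
    using conformal_pair_bessel[OF ab(1,2), of "f z - y"] by (intro divide_right_mono) (auto simp: q_def)
  also have "\<dots> = 4 * (a \<bullet> a) / q" using q by (simp add: power2_eq_square)
  finally show thesis using ab(5) y by (intro that[of "4 * (a \<bullet> a) / q - 4 * ((a \<bullet> (f z - y))\<^sup>2 + (b \<bullet> (f z - y))\<^sup>2) / q\<^sup>2"])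
      (auto simp: q_def)
qed

text \<open>The quadratic part has nonnegative trace on every plane; the linear part is the negative of the height of
  \<open>y\<close> below the hyperplane through \<open>p\<close> with normal \<open>n\<close>.\<close>

definition barrier :: "real \<Rightarrow> 'a::euclidean_space \<Rightarrow> 'a \<Rightarrow> 'a \<Rightarrow> 'a \<Rightarrow> real" where
  "barrier A e n p y = A * ((y - p) \<bullet> (y - p) - 2 * ((y - p) \<bullet> e)\<^sup>2) + (y - p) \<bullet> n"

lemma laplacian_barrier_conformal:
  assumes f: "conformal_jet f z" and "A \<ge> 0" "norm e = 1"
  obtains L where "L \<ge> 0" "laplacian_at (\<lambda>z. barrier A e n p (f z)) z L"
proof -
  have ft: "conformal_jet (\<lambda>z. f z - p) z" using f by (rule conformal_jet_translate)
  obtain a b where ab: "a \<bullet> a = b \<bullet> b" "a \<bullet> b = 0"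
    "laplacian_at (\<lambda>z. (f z - p) \<bullet> (f z - p)) z (4 * (a \<bullet> a))"
    "\<forall>e. laplacian_at (\<lambda>z. ((f z - p) \<bullet> e)\<^sup>2) z (2 * ((a \<bullet> e)\<^sup>2 + (b \<bullet> e)\<^sup>2))"
    "f z - p \<noteq> 0 \<longrightarrow> laplacian_at (\<lambda>z. ln ((f z - p) \<bullet> (f z - p))) z
       (4 * (a \<bullet> a) / ((f z - p) \<bullet> (f z - p)) - 4 * ((a \<bullet> (f z - p))\<^sup>2 + (b \<bullet> (f z - p))\<^sup>2) / ((f z - p) \<bullet> (f z - p))\<^sup>2)"
    by (rule laplacian_square_conformal[OF ft])
  have "laplacian_at (\<lambda>z. A * ((f z - p) \<bullet> (f z - p) + (-2) * ((f z - p) \<bullet> e)\<^sup>2) + (f z - p) \<bullet> n) z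
     (A * (4 * (a \<bullet> a) + (-2) * (2 * ((a \<bullet> e)\<^sup>2 + (b \<bullet> e)\<^sup>2))) + 0)"
    by (intro laplacian_add laplacian_cmult ab(3) ab(4)[rule_format] laplacian_linear_conformal[OF ft])
  moreover have "(a \<bullet> e)\<^sup>2 + (b \<bullet> e)\<^sup>2 \<le> a \<bullet> a"
    using conformal_pair_bessel[OF ab(1,2), of e] assms by (simp add: dot_square_norm)
  then have "A * (4 * (a \<bullet> a) + (-2) * (2 * ((a \<bullet> e)\<^sup>2 + (b \<bullet> e)\<^sup>2))) + 0 \<ge> 0" using assms by simp
  ultimately show thesis by (intro that) (auto simp: barrier_def)
qed

text \<open>Symmetry and vanishing trace of the Hessian are the Cauchy-Riemann equations for the conjugate of the gradient. Its
  primitive has, up to a constant, the real part \<open>u\<close>.\<close>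

lemma harmonic_eq_Re_holomorphic:
  assumes u: "harmonic_on (ball 0 1) u"
  obtains F where "F holomorphic_on ball 0 1" "\<And>z. z \<in> ball 0 1 \<Longrightarrow> Re (F z) = u z" "Im (F 0) = 0"
proof -
  have C2: "C2_on (ball 0 1) u" using u by (simp add: harmonic_on_def)
  define g where "g z = cnj (gradient u z)" for z
  have "(g has_field_derivative cnj (hessian u z 1)) (at z)" if z: "z \<in> ball 0 1" for z
  proof -
    let ?H = "hessian u z"
    have lin: "linear ?H" using C2_on_hessian_linear[OF C2 z] .
    have tr: "?H 1 \<bullet> 1 + ?H \<i> \<bullet> \<i> = 0"
    proof -
      have "(\<Sum>k\<in>Basis. ?H k \<bullet> k) = 0" using u z unfolding harmonic_on_def by blast
      then show ?thesis by (simp add: Basis_complex_def)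
    qed
    have sy: "?H 1 \<bullet> \<i> = ?H \<i> \<bullet> 1" by (rule hessian_symmetric[OF C2 open_ball z])
    have i: "cnj (?H \<i>) = \<i> * cnj (?H 1)" using tr sy by (auto simp: complex_eq_iff inner_complex_def)
    have "cnj (?H h) = cnj (?H 1) * h" for h
    proof -
      have "h = Re h *\<^sub>R 1 + Im h *\<^sub>R \<i>" by (simp add: complex_eq_iff)
      then have "?H h = ?H (Re h *\<^sub>R 1 + Im h *\<^sub>R \<i>)" by (rule arg_cong)
      then have "cnj (?H h) = Re h *\<^sub>R cnj (?H 1) + Im h *\<^sub>R cnj (?H \<i>)"
        using lin by (simp add: linear_add linear_cmul)
      also have "\<dots> = cnj (?H 1) * (Re h *\<^sub>R 1 + Im h *\<^sub>R \<i>)"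
        unfolding i by (simp add: scaleR_conv_of_real algebra_simps)
      also have "Re h *\<^sub>R 1 + Im h *\<^sub>R \<i> = h" by (simp add: complex_eq_iff)
      finally show ?thesis .
    qed
    then have eq: "(\<lambda>h. cnj (?H h)) = (*) (cnj (?H 1))" by (rule ext)
    have "(g has_derivative (\<lambda>h. cnj (?H h))) (at z)"
      unfolding g_def by (rule has_derivative_cnj[OF C2_on_hessian[OF C2 z]])
    then show ?thesis unfolding eq has_field_derivative_def .
  qed
  then have "g holomorphic_on ball 0 1" unfolding holomorphic_on_open[OF open_ball] by blast
  then obtain G where G: "\<And>z. z \<in> ball 0 1 \<Longrightarrow> (G has_field_derivative g z) (at z within ball 0 1)"
    using holomorphic_convex_primitive'[of "ball 0 1" g] by auto
  have "((\<lambda>z. Re (G z) - u z) has_derivative (\<lambda>h. 0)) (at z within ball 0 1)" if z: "z \<in> ball 0 1" for z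
  proof -
    have "((\<lambda>z. Re (G z)) has_derivative (\<lambda>h. Re (g z * h))) (at z within ball 0 1)"
      using has_derivative_Re[OF G[OF z, unfolded has_field_derivative_def]] by simp
    moreover have "(u has_derivative (\<lambda>h. gradient u z \<bullet> h)) (at z within ball 0 1)"
      using C2_on_gradient[OF C2 z] by (rule has_derivative_at_withinI)
    ultimately have "((\<lambda>z. Re (G z) - u z) has_derivative (\<lambda>h. Re (g z * h) - gradient u z \<bullet> h)) (at z within ball 0 1)"
      by (rule has_derivative_diff)
    moreover have "(\<lambda>h. Re (g z * h) - gradient u z \<bullet> h) = (\<lambda>h. 0)"
      by (simp add: g_def inner_complex_def fun_eq_iff)
    ultimately show ?thesis by simp
  qed
  then obtain k where k: "\<And>z. z \<in> ball 0 1 \<Longrightarrow> Re (G z) - u z = k"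
    using has_derivative_zero_constant[of "ball 0 1" "\<lambda>z. Re (G z) - u z"] by auto
  define F where "F z = G z - (k + \<i> * Im (G 0))" for z
  show thesis
  proof (rule that)
    have "G holomorphic_on ball 0 1" 
      unfolding holomorphic_on_def field_differentiable_def using G by blast
    then show "F holomorphic_on ball 0 1" unfolding F_def by (intro holomorphic_intros)
    show "Re (F z) = u z" if "z \<in> ball 0 1" for z using k[OF that] by (simp add: F_def)
    show "Im (F 0) = 0" by (simp add: F_def)
  qed
qed

lemma conformal_harmonic_component_holomorphic:
  fixes f :: "complex \<Rightarrow> 'a::euclidean_space"
  assumes f: "f \<in> conformal_harmonic_maps D"
  obtains F where "F holomorphic_on ball 0 1" "\<And>z. z \<in> ball 0 1 \<Longrightarrow> Re (F z) = f z \<bullet> w + c" "Im (F 0) = 0"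
    "Re (deriv F 0) = partial_x f 0 \<bullet> w"
proof -
  have "\<forall>b\<in>Basis. \<exists>F. F holomorphic_on ball 0 1 \<and> (\<forall>z\<in>ball 0 1. Re (F z) = f z \<bullet> b) \<and> Im (F 0) = 0"
  proof
    fix b :: 'a assume "b \<in> Basis"
    then have "harmonic_on (ball 0 1) (\<lambda>z. f z \<bullet> b)" using f by (auto simp: conformal_harmonic_maps_def)
    from harmonic_eq_Re_holomorphic[OF this]
    show "\<exists>F. F holomorphic_on ball 0 1 \<and> (\<forall>z\<in>ball 0 1. Re (F z) = f z \<bullet> b) \<and> Im (F 0) = 0" by metis
  qed
  then obtain Fb where Fb: "\<And>b. b \<in> Basis \<Longrightarrow> Fb b holomorphic_on ball 0 1"
    "\<And>b z. b \<in> Basis \<Longrightarrow> z \<in> ball 0 1 \<Longrightarrow> Re (Fb b z) = f z \<bullet> b" "\<And>b. b \<in> Basis \<Longrightarrow> Im (Fb b 0) = 0"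
    by metis
  define F where "F z = (\<Sum>b\<in>Basis. (w \<bullet> b) * Fb b z) + c" for z
  have hol: "F holomorphic_on ball 0 1" unfolding F_def by (intro holomorphic_intros Fb)
  have re: "Re (F z) = f z \<bullet> w + c" if z: "z \<in> ball 0 1" for z
  proof -
    have "Re (F z) = (\<Sum>b\<in>Basis. (w \<bullet> b) * (f z \<bullet> b)) + c" unfolding F_def using Fb(2)[OF _ z] by simp
    then show ?thesis by (simp add: euclidean_inner[of "f z" w] mult.commute)
  qed
  have im: "Im (F 0) = 0" unfolding F_def using Fb(3) by simp
  have "((\<lambda>z. Re (F z)) has_derivative (\<lambda>h. Re (deriv F 0 * h))) (at 0)"
    using has_derivative_Re[OF holomorphic_derivI[OF hol open_ball, of 0, unfolded has_field_derivative_def]] by simp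
  then have 1: "((\<lambda>z. f z \<bullet> w + c) has_derivative (\<lambda>h. Re (deriv F 0 * h))) (at 0)"
    by (rule has_derivative_transform_within_open[of _ _ _ _ "ball 0 1"]) (use re in auto)
  have "f differentiable (at 0)" using conformal_harmonic_map_jet[OF f, of 0] by (simp add: conformal_jet_def)
  then have "(f has_derivative frechet_derivative f (at 0)) (at 0)" by (simp add: frechet_derivative_works)
  then have "((\<lambda>z. f z \<bullet> w + c) has_derivative (\<lambda>h. frechet_derivative f (at 0) h \<bullet> w)) (at 0)"
    by (auto intro!: derivative_eq_intros)
  from has_derivative_unique[OF this 1] have "frechet_derivative f (at 0) 1 \<bullet> w = Re (deriv F 0 * 1)" by metis
  then show thesis using that[OF hol re im] by (simp add: partial_x_def)
qed

section \<open>Estimates from the maximum principle\<close>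

text \<open>Adding \<open>\<epsilon> |z|^2\<close> makes the Laplacian strictly positive, which excludes interior maxima.\<close>

lemma subharmonic_max_principle:
  fixes q :: "complex \<Rightarrow> real"
  assumes s: "s > 0" and cont: "continuous_on (cball 0 s) q"
    and sub: "\<And>z. z \<in> ball 0 s \<Longrightarrow> \<exists>L\<ge>0. laplacian_at q z L"
    and bd: "\<And>z. norm z = s \<Longrightarrow> q z \<le> 0"
    and z: "z \<in> cball 0 s"
  shows "q z \<le> 0"
proof (rule field_le_epsilon)
  fix \<epsilon>' :: real assume \<epsilon>': "\<epsilon>' > 0"
  define \<epsilon> where "\<epsilon> = \<epsilon>' / s\<^sup>2"
  have \<epsilon>: "\<epsilon> > 0" using \<epsilon>' s by (simp add: \<epsilon>_def)
  define Q where "Q z = q z + \<epsilon> * (norm z)\<^sup>2" for z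
  have "continuous_on (cball 0 s) Q" unfolding Q_def by (intro continuous_intros cont)
  then obtain w where w: "w \<in> cball 0 s" "\<And>v. v \<in> cball 0 s \<Longrightarrow> Q v \<le> Q w"
    using continuous_attains_sup[of "cball (0::complex) s" Q] s by auto
  have "w \<notin> ball 0 s"
  proof
    assume wb: "w \<in> ball 0 s"
    then obtain L where L: "L \<ge> 0" "laplacian_at q w L" using sub by blast
    have "laplacian_at Q w (L + \<epsilon> * 4)"
      unfolding Q_def by (intro laplacian_add L laplacian_cmult laplacian_norm_sq)
    moreover have "\<forall>\<^sub>F v in nhds w. Q v \<le> Q w"
      using eventually_nhds_in_open[OF open_ball wb] by (rule eventually_mono) (use w in auto)
    ultimately have "L + \<epsilon> * 4 \<le> 0" by (rule laplacian_local_max)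
    then show False using L \<epsilon> by simp
  qed
  then have ws: "norm w = s" using w by auto
  have "q z \<le> Q z" using \<epsilon> by (simp add: Q_def)
  also have "\<dots> \<le> Q w" using w z by blast
  also have "\<dots> \<le> \<epsilon>'" using bd[OF ws] ws s by (simp add: Q_def \<epsilon>_def)
  finally show "q z \<le> 0 + \<epsilon>'" by simp
qed

text \<open>Since \<open>F 0\<close> is real, \<open>|F|^2 = 2 (Re F)^2 - Re (F^2)\<close> is dominated by the superharmonic function \<open>2 Z - Re (F^2)\<close>,
  whose value at \<open>0\<close> is at most \<open>2 Z 0\<close>. A multiple \<open>\<alpha> F^2\<close> that is positive at \<open>z0\<close> is reproduced at \<open>z0\<close>
  by the Cauchy kernel: \<open>Re (z \<alpha> F(z)^2 / (z - z0))\<close> has, on a circle around \<open>0\<close>, the same values as a harmonic function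
  \<open>Re (G + B)\<close> without pole whose value at \<open>0\<close> is \<open>|F z0|^2\<close>. The maximum principle compares the two; no integral is needed.\<close>

lemma hardy_pointwise_bound:
  assumes F: "F holomorphic_on ball 0 R" and im: "Im (F 0) = 0"
    and Zc: "continuous_on (ball 0 R) Z"
    and Zs: "\<And>z. z \<in> ball 0 R \<Longrightarrow> \<exists>L\<le>0. laplacian_at Z z L"
    and dom: "\<And>z. z \<in> ball 0 R \<Longrightarrow> (Re (F z))\<^sup>2 \<le> Z z"
    and z0: "z0 \<in> ball 0 R"
  shows "(norm (F z0))\<^sup>2 \<le> 4 * Z 0 * R / (R - norm z0)"
proof -
  have R: "R > 0" "norm z0 < R" using z0 by (auto intro: le_less_trans[OF norm_ge_zero])
  have Z0: "Z 0 \<ge> (Re (F 0))\<^sup>2" "Z 0 \<ge> 0" using dom[of 0] R by (auto intro: order_trans[OF zero_le_power2])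
  show ?thesis
  proof (cases "z0 = 0")
    case True
    then have "(norm (F z0))\<^sup>2 = (Re (F 0))\<^sup>2" using im by (simp add: cmod_power2)
    then show ?thesis using True Z0 R by simp
  next
    case False
    \<comment> \<open>Working on a slightly smaller circle gives continuity up to the boundary, at the cost of a factor \<open>2\<close>.\<close>
    define s where "s = (R + norm z0) / 2"
    have s: "norm z0 < s" "s < R" "s > 0" using R by (auto simp: s_def intro: add_pos_nonneg)
    define \<kappa> where "\<kappa> = (norm (F z0))\<^sup>2"
    obtain \<alpha> :: complex where \<alpha>: "norm \<alpha> = 1" "\<alpha> * (F z0)\<^sup>2 = of_real \<kappa>"
    proof (cases "F z0 = 0")
      case True then show ?thesis using that[of 1] by (simp add: \<kappa>_def)
    next
      case nz: False
      define w where "w = (F z0)\<^sup>2"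
      have w: "w \<noteq> 0" "norm w = \<kappa>" using nz by (simp_all add: w_def \<kappa>_def norm_power)
      have "norm (cnj w / of_real (norm w)) = 1" using w(1) by (simp add: norm_divide)
      moreover have "cnj w / of_real (norm w) * w = of_real \<kappa>"
      proof -
        have "w * cnj w = of_real \<kappa> * of_real \<kappa>" "\<kappa> \<noteq> 0"
          using w complex_norm_square[of w] by (simp_all add: power2_eq_square) auto
        then show ?thesis by (simp add: w mult.commute[of "cnj w"])
      qed
      ultimately show ?thesis using that[of "cnj w / of_real (norm w)"] by (simp add: w_def)
    qed
    define N where "N z = z * (\<alpha> * (F z)\<^sup>2)" for z
    have N: "N holomorphic_on ball 0 R" unfolding N_def by (intro holomorphic_intros F)
    define G where "G z = (if z = z0 then deriv N z0 else (N z - N z0) / (z - z0))" for z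
    have G: "G holomorphic_on ball 0 R"
      unfolding G_def by (rule pole_lemma[OF N]) (use z0 in simp)
    \<comment> \<open>Holomorphic in the disc, zero at \<open>0\<close>, and on the circle of radius \<open>s\<close> the conjugate of the polar part at \<open>z0\<close>.\<close>
    define B where "B z = cnj z0 * of_real \<kappa> * z / (of_real (s\<^sup>2) - cnj z0 * z)" for z
    have nz: "of_real (s\<^sup>2) - cnj z0 * z \<noteq> 0" if "norm z \<le> s" for z
    proof
      assume "of_real (s\<^sup>2) - cnj z0 * z = 0"
      then have "norm (of_real (s\<^sup>2) :: complex) = norm (cnj z0 * z)" by simp
      then have "s * s = norm z0 * norm z" by (simp add: norm_mult power2_eq_square abs_mult)
      also have "\<dots> \<le> norm z0 * s" using that by (intro mult_left_mono) auto
      also have "\<dots> < s * s" using s by (intro mult_strict_right_mono) auto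
      finally show False by simp
    qed
    have B: "B holomorphic_on ball 0 s" unfolding B_def by (intro holomorphic_intros) (use nz in auto)
    have Bc: "continuous_on (cball 0 s) B" unfolding B_def by (intro continuous_intros) (use nz in auto)
    define C where "C = s / (s - norm z0)"
    have C: "C > 0" using s by (simp add: C_def)
    define Q where "Q z = Re (G z + B z + C * (F z)\<^sup>2) + (- 2 * C) * Z z" for z
    have sub: "cball 0 s \<subseteq> ball (0::complex) R" "ball 0 s \<subseteq> ball (0::complex) R" using s by auto
    have "Q 0 \<le> 0"
    proof (rule subharmonic_max_principle[OF s(3)])
      show "continuous_on (cball 0 s) Q" unfolding Q_def
        by (intro continuous_intros Bc continuous_on_subset[OF Zc sub(1)]
            continuous_on_subset[OF holomorphic_on_imp_continuous_on[OF G] sub(1)]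
            continuous_on_subset[OF holomorphic_on_imp_continuous_on[OF F] sub(1)])
      show "\<exists>L\<ge>0. laplacian_at Q z L" if z: "z \<in> ball 0 s" for z
      proof -
        obtain L where L: "L \<le> 0" "laplacian_at Z z L" using Zs z sub by blast
        have "(\<lambda>z. G z + B z + C * (F z)\<^sup>2) holomorphic_on ball 0 s"
          by (intro holomorphic_intros B holomorphic_on_subset[OF G sub(2)] holomorphic_on_subset[OF F sub(2)])
        then have "laplacian_at Q z (0 + (- 2 * C) * L)" unfolding Q_def
          by (intro laplacian_add laplacian_cmult L laplacian_Re_holomorphic[of _ "ball 0 s"] open_ball z)
        then show ?thesis using L C by (intro exI[of _ "0 + (- 2 * C) * L"]) (auto simp: mult_nonneg_nonpos)
      qed
      show "Q z \<le> 0" if z: "norm z = s" for z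
      proof -
        have zz: "z \<noteq> z0" "z \<noteq> 0" "z \<in> ball 0 R" using z s by auto
        have "B z = cnj (z0 * of_real \<kappa> / (z - z0))"
        proof -
          have "of_real (s\<^sup>2) = z * cnj z" using complex_norm_square[of z] z by simp
          then have "B z = cnj z0 * of_real \<kappa> * z / (z * (cnj z - cnj z0))" by (simp add: B_def algebra_simps)
          also have "\<dots> = cnj z0 * of_real \<kappa> / (cnj z - cnj z0)" using zz by simp
          finally show ?thesis by simp
        qed
        then have ReB: "Re (B z) = Re (z0 * of_real \<kappa> / (z - z0))" by (simp only: cnj.sel(1))
        have "G z = z * (\<alpha> * (F z)\<^sup>2) / (z - z0) - z0 * of_real \<kappa> / (z - z0)"
          using zz \<alpha>(2) by (simp add: G_def N_def diff_divide_distrib)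
        then have "Re (G z) + Re (B z) = Re (z * (\<alpha> * (F z)\<^sup>2) / (z - z0))" using ReB by simp
        also have "\<dots> \<le> norm (z * (\<alpha> * (F z)\<^sup>2) / (z - z0))" by (rule complex_Re_le_cmod)
        also have "\<dots> = s * (norm (F z))\<^sup>2 / norm (z - z0)" using z \<alpha> by (simp add: norm_mult norm_divide norm_power)
        also have "\<dots> \<le> s * (norm (F z))\<^sup>2 / (s - norm z0)"
          using norm_triangle_ineq2[of z z0] z s by (intro divide_left_mono mult_pos_pos) auto
        also have "\<dots> = C * (norm (F z))\<^sup>2" by (simp add: C_def)
        also have "(norm (F z))\<^sup>2 = 2 * (Re (F z))\<^sup>2 - Re ((F z)\<^sup>2)"
          unfolding cmod_power2 by (simp add: power2_eq_square)
        also have "C * (2 * (Re (F z))\<^sup>2 - Re ((F z)\<^sup>2)) \<le> C * (2 * Z z - Re ((F z)\<^sup>2))"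
          using dom[OF zz(3)] C by (intro mult_left_mono) auto
        finally show ?thesis by (simp add: Q_def algebra_simps)
      qed
    qed (use s in auto)
    moreover have "G 0 = of_real \<kappa>" using False \<alpha>(2) by (simp add: G_def N_def)
    ultimately have "\<kappa> + C * (Re (F 0))\<^sup>2 \<le> 2 * C * Z 0" using im by (simp add: Q_def B_def power2_eq_square)
    then have "\<kappa> \<le> 2 * C * Z 0" using C by (smt (verit) mult_nonneg_nonneg zero_le_power2)
    also have "2 * C * Z 0 \<le> 2 * (2 * R / (R - norm z0)) * Z 0"
    proof -
      have "C = (R + norm z0) / (R - norm z0)" using R by (simp add: C_def s_def field_simps)
      also have "\<dots> \<le> 2 * R / (R - norm z0)" using R by (intro divide_right_mono) auto
      finally show ?thesis using Z0 by (intro mult_right_mono) auto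
    qed
    finally show ?thesis by (simp add: \<kappa>_def mult_ac)
  qed
qed

text \<open>The Cayley transform \<open>(F - F 0) / (F + F 0)\<close> maps the right half-plane to the unit disc, so the Schwarz lemma applies.\<close>

lemma positive_harmonic_gradient_bound:
  assumes F: "F holomorphic_on ball 0 R" and R: "R > 0" and im: "Im (F 0) = 0"
    and pos: "\<And>z. z \<in> ball 0 R \<Longrightarrow> Re (F z) > 0"
  shows "R * norm (deriv F 0) \<le> 2 * Re (F 0)"
proof -
  define d where "d = Re (F 0)"
  have F0: "F 0 = of_real d" using im by (simp add: d_def complex_eq_iff)
  have d: "d > 0" using pos[of 0] R by (simp add: d_def)
  define h where "h z = (F (of_real R * z) - d) / (F (of_real R * z) + d)" for z
  have inR: "of_real R * z \<in> ball 0 R" if "norm z < 1" for z :: complex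
    using that R by (simp add: norm_mult)
  have nz: "F (of_real R * z) + d \<noteq> 0" if "norm z < 1" for z
    using pos[OF inR[OF that]] d by (auto simp: complex_eq_iff)
  have FR: "(\<lambda>z. F (of_real R * z)) holomorphic_on ball 0 1"
  proof -
    have "(\<lambda>z. complex_of_real R * z) ` ball 0 1 \<subseteq> ball 0 R" using inR by auto
    moreover have "(\<lambda>z. complex_of_real R * z) holomorphic_on ball 0 1" by (intro holomorphic_intros)
    ultimately show ?thesis using holomorphic_on_compose_gen[OF _ F] by (auto simp: o_def)
  qed
  have h: "h holomorphic_on ball 0 1" unfolding h_def by (intro holomorphic_intros FR) (use nz in auto)
  have h1: "norm (h z) < 1" if z: "norm z < 1" for z
  proof -
    let ?w = "F (of_real R * z)"
    have "(norm (?w - d))\<^sup>2 < (norm (?w + d))\<^sup>2"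
      using mult_pos_pos[OF pos[OF inR[OF z]] d] unfolding cmod_power2
      by (simp add: power2_eq_square algebra_simps)
    then have "norm (?w - d) < norm (?w + d)" by (rule power2_less_imp_less) simp
    then show ?thesis using nz[OF z] by (simp add: h_def norm_divide)
  qed
  have "h 0 = 0" by (simp add: h_def F0)
  then have "norm (deriv h 0) \<le> 1" using Schwarz_Lemma(2)[OF h _ h1, of 0] by simp
  moreover have "deriv h 0 = of_real R * deriv F 0 / (2 * of_real d)"
  proof -
    have F': "(F has_field_derivative deriv F 0) (at (of_real R * 0))"
      using holomorphic_derivI[OF F open_ball, of 0] R by simp
    have "((\<lambda>z. of_real R * z) has_field_derivative of_real R) (at 0)" by (auto intro!: derivative_eq_intros)
    from DERIV_chain2[OF F' this]
    have "((\<lambda>z. F (of_real R * z)) has_field_derivative deriv F 0 * of_real R) (at 0)" .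
    then have "(h has_field_derivative (deriv F 0 * of_real R * (2 * d) - 0) / ((2 * d) * (2 * d))) (at 0)"
      unfolding h_def using nz[of 0] d
      by (auto intro!: derivative_eq_intros simp: F0 algebra_simps)
    then show ?thesis using d by (simp add: DERIV_imp_deriv mult.commute)
  qed
  ultimately have "R * norm (deriv F 0) / (2 * d) \<le> 1" using R d by (simp add: norm_mult norm_divide)
  then show ?thesis using d by (simp add: d_def[symmetric] divide_le_eq)
qed

section \<open>Localisation near the boundary\<close>

text \<open>Near \<open>p\<close> the set lies on one side of the hyperplane with normal \<open>n\<close>, and bends away from it fast enough, in the
  sense of traces on planes, for the barrier to have a strict quadratic maximum at \<open>p\<close>.\<close>

definition quadratic_support ::
    "'a::euclidean_space set \<Rightarrow> 'a \<Rightarrow> real \<Rightarrow> real \<Rightarrow> real \<Rightarrow> 'a \<Rightarrow> 'a \<Rightarrow> bool" where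
  "quadratic_support G p r A c e n \<longleftrightarrow> norm e = 1 \<and> norm n = 1 \<and>
     (\<forall>y\<in>G \<inter> ball p r. (y - p) \<bullet> n \<le> 0 \<and> barrier A e n p y \<le> - c * ((y - p) \<bullet> (y - p)))"

lemma barrier_lower_bound:
  assumes "norm n = 1" "A \<ge> 0"  "norm e = 1"
  shows "barrier A e n p y \<ge> - (norm (y - p) + A * (norm (y - p))\<^sup>2)"
proof -
  define w where "w = y - p"
  have "\<bar>w \<bullet> n\<bar> \<le> norm w" using Cauchy_Schwarz_ineq2[of w n] assms by simp
  moreover have "(w \<bullet> e)\<^sup>2 \<le> w \<bullet> w" using Cauchy_Schwarz_ineq[of w e] assms by (simp add: dot_square_norm)
  then have "A * (w \<bullet> w - 2 * (w \<bullet> e)\<^sup>2) \<ge> A * (- (w \<bullet> w))" using assms by (intro mult_left_mono) auto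
  ultimately show ?thesis by (simp add: barrier_def w_def[symmetric] dot_square_norm)
qed

text \<open>In the gluing below the weight is \<open>exp (l * barrier)\<close>. At distance \<open>a\<close> from \<open>p\<close> the barrier is at least
  \<open>- (a + A a^2)\<close>, at distance \<open>r\<close> at most \<open>- c r^2\<close>. If the first number is at most half of the second in absolute value, a large
  \<open>l\<close> separates the weighted functions at the two distances, and \<open>m\<close> is a level between them.\<close>

lemma localisation_constants:
  fixes r A c :: real
  assumes "r > 0" "A \<ge> 0" "c > 0"
  obtains a l m where "0 < a" "a < r" "l \<ge> 0" "m > 0" "m \<le> 4 * r\<^sup>2"
    "a\<^sup>2 / 4 * exp (- l * (a + A * a\<^sup>2)) > m" "4 * r\<^sup>2 * exp (- l * (c * r\<^sup>2)) < m"
proof -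
  \<comment> \<open>The second bound makes \<open>a + A a^2\<close> at most \<open>c r^2 / 2\<close>.\<close>
  define a where "a = min (r / 2) (c * r\<^sup>2 / (2 * (1 + A * r)))"
  have Ar: "1 + A * r > 0" using assms by (simp add: add_pos_nonneg)
  have a: "a > 0" "a < r" using assms Ar by (auto simp: a_def)
  have "a \<le> c * r\<^sup>2 / (2 * (1 + A * r))" by (simp add: a_def)
  then have "a * (2 * (1 + A * r)) \<le> c * r\<^sup>2" using Ar by (simp add: pos_le_divide_eq)
  moreover have "A * a\<^sup>2 \<le> a * (A * r)" using a assms by (simp add: power2_eq_square mult_mono mult.left_commute)
  ultimately have aA: "a + A * a\<^sup>2 \<le> c * r\<^sup>2 / 2" by (simp add: algebra_simps)
  have ar2: "a\<^sup>2 < r\<^sup>2" using a by (intro power_strict_mono) auto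
  \<comment> \<open>With \<open>E = exp (- l c r^2 / 2)\<close> the inequalities to be satisfied become \<open>4 r^2 E^2 < m < a^2 E / 4\<close>.\<close>
  define E where "E = a\<^sup>2 / (32 * r\<^sup>2)"
  note ar2
  moreover have "r\<^sup>2 > 0" using assms by simp
  ultimately have "a\<^sup>2 < 32 * r\<^sup>2" by linarith
  then have E: "E > 0" "E < 1" using a assms by (auto simp: E_def)
  define l where "l = - 2 * ln E / (c * r\<^sup>2)"
  have l: "l \<ge> 0" using E assms by (simp add: l_def divide_nonpos_pos)
  have "- l * (c * r\<^sup>2) = ln E + ln E" using assms by (simp add: l_def)
  then have e2: "exp (- l * (c * r\<^sup>2)) = E * E" using E by (simp only: exp_add exp_ln)
  have "l * (a + A * a\<^sup>2) \<le> l * (c * r\<^sup>2 / 2)" using aA l by (rule mult_left_mono)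
  also have "\<dots> = - ln E" using assms by (simp add: l_def)
  finally have "ln E \<le> - l * (a + A * a\<^sup>2)" by simp
  then have "exp (ln E) \<le> exp (- l * (a + A * a\<^sup>2))" by (simp only: exp_le_cancel_iff)
  then have e1: "exp (- l * (a + A * a\<^sup>2)) \<ge> E" using E by simp
  define m where "m = a\<^sup>2 * E / 6"
  have m: "m > 0" using a E by (simp add: m_def)
  have "m \<le> 4 * r\<^sup>2"
  proof -
    have "a\<^sup>2 * E \<le> r\<^sup>2 * 1" using ar2 E by (intro mult_mono) auto
    then show ?thesis using zero_le_power2[of r] unfolding m_def by linarith
  qed
  moreover have "a\<^sup>2 / 4 * exp (- l * (a + A * a\<^sup>2)) > m"
  proof -
    have "m < a\<^sup>2 / 4 * E" using a E by (simp add: m_def)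
    also have "\<dots> \<le> a\<^sup>2 / 4 * exp (- l * (a + A * a\<^sup>2))" using e1 by (intro mult_left_mono) auto
    finally show ?thesis .
  qed
  moreover have "4 * r\<^sup>2 * exp (- l * (c * r\<^sup>2)) < m"
  proof -
    have "4 * r\<^sup>2 * E = a\<^sup>2 / 8" using assms by (simp add: E_def)
    then have "4 * r\<^sup>2 * (E * E) = (a\<^sup>2 * E) / 8" by (simp add: mult.assoc[symmetric])
    also have "\<dots> < m" using a E by (simp add: m_def)
    finally show ?thesis using e2 by simp
  qed
  ultimately show thesis using that[OF a l m] by blast
qed

text \<open>This removes the singularity at \<open>0\<close> of the quotient that is maximised below.\<close>

lemma differentiable_square_increment:
  fixes f :: "complex \<Rightarrow> 'a::euclidean_space"
  assumes "f differentiable (at 0)"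
  shows "((\<lambda>z. (norm (f z - f 0))\<^sup>2 / norm z) \<longlongrightarrow> 0) (at 0)"
proof -
  obtain L where L: "(f has_derivative L) (at 0)" using assms by (auto simp: differentiable_def)
  then have bl: "bounded_linear L" by (rule has_derivative_bounded_linear)
  then obtain K where K: "\<And>x. norm (L x) \<le> norm x * K" using bounded_linear.bounded by blast
  have "((\<lambda>h. norm (f (0 + h) - f 0 - L h) / norm h) \<longlongrightarrow> 0) (at 0)"
    using L by (simp add: has_derivative_at)
  then have ev: "\<forall>\<^sub>F h in at 0. norm (f h - f 0 - L h) / norm h < 1"
    by (auto dest: order_tendstoD(2)[where a=1])
  have "\<forall>\<^sub>F z in at 0. norm ((norm (f z - f 0))\<^sup>2 / norm z) \<le> (1 + K)\<^sup>2 * norm z"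
    using ev eventually_neq_at_within[of "0::complex" 0 UNIV]
  proof eventually_elim
    case (elim z)
    then have nz: "norm z > 0" by auto
    have "norm (f z - f 0) \<le> norm (f z - f 0 - L z) + norm (L z)" using norm_triangle_ineq[of "f z - f 0 - L z" "L z"] by simp
    also have "\<dots> \<le> norm z + norm z * K" using elim(1) nz K[of z] by (intro add_mono) (auto simp: divide_less_eq)
    finally have "norm (f z - f 0) \<le> (1 + K) * norm z" by (simp add: algebra_simps)
    then have "(norm (f z - f 0))\<^sup>2 \<le> ((1 + K) * norm z)\<^sup>2" by (intro power_mono) auto
    then show ?case using nz by (simp add: divide_le_eq power2_eq_square mult_ac)
  qed
  moreover have "((\<lambda>z::complex. (1 + K)\<^sup>2 * norm z) \<longlongrightarrow> (1 + K)\<^sup>2 * norm (0::complex)) (at 0)" by (intro tendsto_intros)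
  then have "((\<lambda>z::complex. (1 + K)\<^sup>2 * norm z) \<longlongrightarrow> 0) (at 0)" by simp
  ultimately show ?thesis by (rule Lim_null_comparison)
qed

text \<open>The function \<open>|f - f 0|^2 exp (l * barrier)\<close> has a subharmonic logarithm, but only while \<open>f\<close> is near \<open>p\<close>. It exceeds the
  level \<open>m\<close> at distance \<open>a\<close> from \<open>p\<close> and is below \<open>m\<close> at distance \<open>r1\<close>, so replacing it by the
  maximum with \<open>m\<close> in between, and by \<open>m\<close> further out, gives a function \<open>P\<close> on the whole disc that is continuous and has a
  subharmonic logarithm in the sense of touching from below. It vanishes to second order at \<open>0\<close>, so
  \<open>P z exp (|z|^2) / |z|\<close> takes its maximum over the disc of radius \<open>1/2\<close> on the boundary circle. Hence \<open>P = O(|z|)\<close>, so \<open>P < m\<close> for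
  small \<open>|z|\<close>, and that forces \<open>f z\<close> to be within \<open>a\<close> of \<open>p\<close>. All constants are independent of \<open>f\<close>, \<open>p\<close> and the set.\<close>

lemma conformal_disc_stays_near:
  fixes r A c :: real
  assumes r: "r > 0" and A: "A \<ge> 0" and c: "c > 0"
  obtains a t where "0 < a" "a < r" "0 < t" "t \<le> 1/2"
    "\<And>(f :: complex \<Rightarrow> 'a::euclidean_space) G p e n z.
       \<lbrakk>quadratic_support G p r A c e n; f ` ball 0 1 \<subseteq> G; \<And>z. z \<in> ball 0 1 \<Longrightarrow> conformal_jet f z;
        norm (f 0 - p) < a / 2; z \<in> ball 0 t\<rbrakk> \<Longrightarrow> norm (f z - p) < a"
proof -
  define r1 where "r1 = r / 2"
  have r1: "r1 > 0" "r1 < r" using r by (auto simp: r1_def)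
  obtain a l m where k: "0 < a" "a < r1" "l \<ge> 0" "m > 0" "m \<le> 4 * r1\<^sup>2"
    "a\<^sup>2 / 4 * exp (- l * (a + A * a\<^sup>2)) > m" "4 * r1\<^sup>2 * exp (- l * (c * r1\<^sup>2)) < m"
    using localisation_constants[OF r1(1) A c] by blast
  define M where "M = 4 * r1\<^sup>2"
  have M: "M > 0" using r1 by (simp add: M_def)
  define t where "t = min (1/2) (m / (6 * M))"
  have t: "0 < t" "t \<le> 1/2" using k M by (auto simp: t_def)
  show thesis
  proof (rule that[of a t])
    show "0 < a" "a < r" "0 < t" "t \<le> 1/2" using k r1 t by auto
    fix f :: "complex \<Rightarrow> 'a" and G p e n and z1 :: complex
    assume qs: "quadratic_support G p r A c e n" and fG: "f ` ball 0 1 \<subseteq> G"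
      and cj: "\<And>z. z \<in> ball 0 1 \<Longrightarrow> conformal_jet f z"
      and f0: "norm (f 0 - p) < a / 2" and z1: "z1 \<in> ball 0 t"
    define y where "y = f 0"
    define v where "v z = barrier A e n p (f z)" for z
    define g where "g z = (norm (f z - y))\<^sup>2 * exp (l * v z)" for z
    define d where "d z = norm (f z - p)" for z
    have en: "norm e = 1" "norm n = 1" using qs by (auto simp: quadratic_support_def)
    have vle: "v z \<le> - c * (d z)\<^sup>2" if "z \<in> ball 0 1" "d z < r" for z
    proof -
      have "f z \<in> G \<inter> ball p r" using fG that by (auto simp: dist_norm norm_minus_commute d_def)
      then have "barrier A e n p (f z) \<le> - c * ((f z - p) \<bullet> (f z - p))"
        using qs unfolding quadratic_support_def by blast
      then show ?thesis by (simp add: v_def d_def dot_square_norm)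
    qed
    have fcont: "isCont f z" if "z \<in> ball 0 1" for z
      using cj[OF that] differentiable_imp_continuous_within by (auto simp: conformal_jet_def)
    have dcont: "isCont d z" and vcont: "isCont v z" and gcont: "isCont g z" if "z \<in> ball 0 1" for z
      unfolding d_def g_def v_def barrier_def using fcont[OF that] by (auto intro!: continuous_intros)
    have ybd: "norm (f z - y) \<le> d z + a / 2" "norm (f z - y) \<ge> d z - a / 2" for z
      using norm_triangle_ineq4[of "f z - p" "y - p"] norm_triangle_ineq2[of "f z - p" "y - p"] f0
      by (auto simp: d_def y_def)
    have g_small: "g z \<le> M" if "z \<in> ball 0 1" "d z \<le> r1" for z
    proof -
      have "v z \<le> - c * (d z)\<^sup>2" using vle that r1 by auto
      also have "\<dots> \<le> 0" using c by simp
      finally have "exp (l * v z) \<le> 1" using k by (simp add: mult_nonneg_nonpos)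
      moreover have "(norm (f z - y))\<^sup>2 \<le> (2 * r1)\<^sup>2" using ybd(1)[of z] that k by (intro power_mono) auto
      ultimately have "g z \<le> (2 * r1)\<^sup>2 * 1" unfolding g_def by (intro mult_mono) auto
      then show ?thesis by (simp add: M_def power_mult_distrib)
    qed
    have g_outer: "g z < m" if "z \<in> ball 0 1" "d z = r1" for z
    proof -
      have "v z \<le> - (c * r1\<^sup>2)" using vle that r1 by auto
      then have "l * v z \<le> - l * (c * r1\<^sup>2)" using k mult_left_mono[of "v z" "- (c * r1\<^sup>2)" l] by simp
      moreover have "(norm (f z - y))\<^sup>2 \<le> (2 * r1)\<^sup>2" using ybd(1)[of z] that k by (intro power_mono) auto
      ultimately have "g z \<le> (2 * r1)\<^sup>2 * exp (- l * (c * r1\<^sup>2))" unfolding g_def by (intro mult_mono) auto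
      then show ?thesis using k(7) by (simp add: power_mult_distrib)
    qed
    have g_inner: "g z > m" if "z \<in> ball 0 1" "d z = a" for z
    proof -
      have "v z \<ge> - (a + A * a\<^sup>2)" using barrier_lower_bound[OF en(2) A en(1), where p = p and y = "f z"] that by (simp add: v_def d_def)
      then have "l * v z \<ge> - l * (a + A * a\<^sup>2)" using k mult_left_mono[of "- (a + A * a\<^sup>2)" "v z" l] by (simp only: mult_minus_left mult_minus_right)
      moreover have "(norm (f z - y))\<^sup>2 \<ge> (a / 2)\<^sup>2" using ybd(2)[of z] that k by (intro power_mono) auto
      ultimately have "g z \<ge> (a / 2)\<^sup>2 * exp (- l * (a + A * a\<^sup>2))" unfolding g_def by (intro mult_mono) auto
      then show ?thesis using k(6) by (simp add: power_divide)
    qed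
    define P where "P z = (if d z < a then g z else if d z < r1 then max (g z) m else m)" for z
    have near: "(\<forall>\<^sub>F w in nhds z. d w < s)" if "z \<in> ball 0 1" "d z < s" for z s
      using dcont[OF that(1)] that(2) by (auto simp: isCont_def tendsto_at_iff_tendsto_nhds dest: order_tendstoD)
    have far: "(\<forall>\<^sub>F w in nhds z. d w > s)" if "z \<in> ball 0 1" "d z > s" for z s
      using dcont[OF that(1)] that(2) by (auto simp: isCont_def tendsto_at_iff_tendsto_nhds dest: order_tendstoD)
    have gnear: "(\<forall>\<^sub>F w in nhds z. g w < s)" if "z \<in> ball 0 1" "g z < s" for z s
      using gcont[OF that(1)] that(2) by (auto simp: isCont_def tendsto_at_iff_tendsto_nhds dest: order_tendstoD)
    have gfar: "(\<forall>\<^sub>F w in nhds z. g w > s)" if "z \<in> ball 0 1" "g z > s" for z s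
      using gcont[OF that(1)] that(2) by (auto simp: isCont_def tendsto_at_iff_tendsto_nhds dest: order_tendstoD)
    \<comment> \<open>The three pieces agree near the two interfaces, so each point sees only one of them.\<close>
    have P1: "\<forall>\<^sub>F w in nhds z. P w = g w" if z: "z \<in> ball 0 1" "d z \<le> a" for z
    proof (cases "d z < a")
      case True
      from near[OF z(1) True] show ?thesis by (rule eventually_mono) (simp add: P_def)
    next
      case False
      then have "d z = a" using z by simp
      then have "m < g z" "d z < r1" using g_inner[OF z(1)] k by auto
      from gfar[OF z(1) this(1)] near[OF z(1) this(2)] show ?thesis
        by (rule eventually_elim2) (simp add: P_def)
    qed
    have P2: "\<forall>\<^sub>F w in nhds z. P w = max (g w) m" if z: "z \<in> ball 0 1" "a < d z" "d z < r1" for z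
      using far[OF z(1,2)] near[OF z(1,3)] by (rule eventually_elim2) (simp add: P_def)
    have P3: "\<forall>\<^sub>F w in nhds z. P w = m" if z: "z \<in> ball 0 1" "d z \<ge> r1" for z
    proof (cases "d z > r1")
      case True
      from far[OF z(1) True] show ?thesis by (rule eventually_mono) (use k in \<open>auto simp: P_def\<close>)
    next
      case False
      then have "d z = r1" using z by simp
      then have "g z < m" "a < d z" using g_outer[OF z(1)] k by auto
      from gnear[OF z(1) this(1)] far[OF z(1) this(2)] show ?thesis
        by (rule eventually_elim2) (auto simp: P_def)
    qed
    have Pcont: "isCont P z" if z: "z \<in> ball 0 1" for z
    proof -
      consider "d z \<le> a" | "a < d z" "d z < r1" | "d z \<ge> r1" by linarith
      then show ?thesis
      proof cases
        case 1 then show ?thesis using isCont_cong[OF P1[OF z]] gcont[OF z] by simp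
      next
        case 2
        have "isCont (\<lambda>w. max (g w) m) z" using gcont[OF z] by (intro continuous_intros)
        then show ?thesis using isCont_cong[OF P2[OF z 2]] by simp
      next
        case 3 
        have "isCont (\<lambda>w. m) z" by simp
        then show ?thesis using isCont_cong[OF P3[OF z 3]] by simp
      qed
    qed
    have Ple: "P z \<le> M" if "z \<in> ball 0 1" for z
      using g_small[OF that] k unfolding P_def M_def by auto
    \<comment> \<open>Every point admits a lower contact function whose logarithm is twice differentiable there.\<close>
    have touch: "\<exists>G\<in>{g, \<lambda>w. m}. G z = P z \<and> (\<forall>\<^sub>F w in nhds z. G w \<le> P w)" if z: "z \<in> ball 0 1" for z
    proof -
      consider "d z \<le> a" | "a < d z" "d z < r1" "g z \<ge> m" | "a < d z" "d z < r1" "g z < m" | "d z \<ge> r1" by linarith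
      then show ?thesis
      proof cases
        case 1
        have "\<forall>\<^sub>F w in nhds z. g w \<le> P w" using P1[OF z 1] by (rule eventually_mono) simp
        moreover have "P z = g z" using eventually_nhds_x_imp_x[OF P1[OF z 1]] by simp
        ultimately show ?thesis by simp
      next
        case 2
        have "\<forall>\<^sub>F w in nhds z. g w \<le> P w" using P2[OF z 2(1,2)] by (rule eventually_mono) simp
        moreover have "P z = g z" using eventually_nhds_x_imp_x[OF P2[OF z 2(1,2)]] 2 by simp
        ultimately show ?thesis by simp
      next
        case 3
        have "\<forall>\<^sub>F w in nhds z. m \<le> P w" using P2[OF z 3(1,2)] by (rule eventually_mono) simp
        moreover have "P z = m" using eventually_nhds_x_imp_x[OF P2[OF z 3(1,2)]] 3 by simp
        ultimately show ?thesis by simp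
      next
        case 4
        have "\<forall>\<^sub>F w in nhds z. m \<le> P w" using P3[OF z 4] by (rule eventually_mono) simp
        moreover have "P z = m" using eventually_nhds_x_imp_x[OF P3[OF z 4]] by simp
        ultimately show ?thesis by simp
      qed
    qed
    have lapG: "\<exists>L\<ge>0. laplacian_at (\<lambda>w. ln (G w)) z L" if z: "z \<in> ball 0 1" and G: "G \<in> {g, \<lambda>w. m}" "G z > 0" for z G
    proof (cases "G = g")
      case False
      then show ?thesis using G laplacian_const[of "ln m" z] by auto
    next
      case True
      then have ne: "f z \<noteq> y" using G by (auto simp: g_def)
      obtain L1 where L1: "L1 \<ge> 0" "laplacian_at (\<lambda>z. ln ((f z - y) \<bullet> (f z - y))) z L1"
        using laplacian_ln_dist_conformal[OF cj[OF z] ne] by blast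
      obtain L2 where L2: "L2 \<ge> 0" "laplacian_at v z L2"
        using laplacian_barrier_conformal[OF cj[OF z] A en(1)] unfolding v_def by blast
      have L: "laplacian_at (\<lambda>w. ln ((f w - y) \<bullet> (f w - y)) + l * v w) z (L1 + l * L2)"
        by (intro laplacian_add laplacian_cmult L1 L2)
      have ev: "\<forall>\<^sub>F w in nhds z. ln (g w) = ln ((f w - y) \<bullet> (f w - y)) + l * v w"
      proof -
        have "g z > 0" using True G by simp
        from gfar[OF z this] show ?thesis
          by (rule eventually_mono) (auto simp: g_def ln_mult dot_square_norm zero_less_mult_iff)
      qed
      show ?thesis using L L1 L2 k True laplacian_cong[OF ev] by (intro exI[of _ "L1 + l * L2"]) auto
    qed
    \<comment> \<open>The factor \<open>exp (|z|^2)\<close> makes the Laplacian of the logarithm strictly positive.\<close>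
    define T where "T z = P z * exp ((norm z)\<^sup>2) / norm z" for z
    have T0: "T 0 = 0" by (simp add: T_def)
    have Tcont: "continuous_on (cball 0 (1/2)) T"
    proof (intro continuous_at_imp_continuous_on ballI)
      fix z :: complex assume "z \<in> cball 0 (1/2)"
      then have z: "z \<in> ball 0 1" by auto
      show "isCont T z"
      proof (cases "z = 0")
        case False
        then show ?thesis unfolding T_def by (intro continuous_intros Pcont z) auto
      next
        case True
        have "\<forall>\<^sub>F w in nhds 0. P w = g w" using P1[of 0] f0 k by (simp add: d_def)
        then have "\<forall>\<^sub>F w in at 0. T w = (norm (f w - f 0))\<^sup>2 / norm w * (exp (l * v w) * exp ((norm w)\<^sup>2))"
          unfolding eventually_at_filter by (rule eventually_mono) (auto simp: T_def g_def y_def)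
        moreover have "((\<lambda>w. (norm (f w - f 0))\<^sup>2 / norm w * (exp (l * v w) * exp ((norm w)\<^sup>2))) \<longlongrightarrow>
            0 * (exp (l * v 0) * exp ((norm (0::complex))\<^sup>2))) (at 0)"
          using vcont[of 0] cj[of 0] unfolding isCont_def
          by (intro tendsto_intros differentiable_square_increment) (auto simp: conformal_jet_def)
        ultimately show ?thesis using True T0 unfolding isCont_def by (simp add: tendsto_cong)
      qed
    qed
    have nomax: "\<not> (\<forall>\<^sub>F w in nhds z. T w \<le> T z)" if z: "z \<in> ball 0 1" "z \<noteq> 0" "T z > 0" for z
    proof
      assume mx: "\<forall>\<^sub>F w in nhds z. T w \<le> T z"
      obtain G where G: "G \<in> {g, \<lambda>w. m}" "G z = P z" "\<forall>\<^sub>F w in nhds z. G w \<le> P w" using touch[OF z(1)] by blast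
      have Pz: "P z > 0" using z by (auto simp: T_def zero_less_mult_iff zero_less_divide_iff)
      then have Gz: "G z > 0" using G by simp
      obtain L where L: "L \<ge> 0" "laplacian_at (\<lambda>w. ln (G w)) z L" using lapG[OF z(1) G(1) Gz] by blast
      define q where "q w = ln (G w) + (norm w)\<^sup>2 + (-1/2) * ln ((norm w)\<^sup>2)" for w
      have lq: "laplacian_at q z (L + 4 + (-1/2) * 0)" unfolding q_def
        by (intro laplacian_add laplacian_cmult L laplacian_norm_sq laplacian_ln_norm_sq z)
      have expq: "exp (q w) = G w * exp ((norm w)\<^sup>2) / norm w" if "G w > 0" "w \<noteq> 0" for w
      proof -
        have "(-1/2) * ln ((norm w)\<^sup>2) = - ln (norm w)" using that by (simp add: ln_realpow)
        then have "q w = ln (G w) + (norm w)\<^sup>2 + - ln (norm w)" by (simp only: q_def)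
        moreover have "exp (ln (G w)) = G w" "exp (ln (norm w)) = norm w" using that by auto
        ultimately show ?thesis by (simp only: exp_add exp_minus divide_inverse)
      qed
      have Gpos: "\<forall>\<^sub>F w in nhds z. G w > 0"
        using G(1) Gz k gfar[OF z(1), of 0] by auto
      have nz: "\<forall>\<^sub>F w in nhds z. w \<noteq> 0" using z by (auto intro: t1_space_nhds)
      have "\<forall>\<^sub>F w in nhds z. q w \<le> q z"
        using mx Gpos nz G(3)
      proof eventually_elim
        case (elim w)
        have "exp (q w) \<le> T w" unfolding expq[OF elim(2,3)] T_def using elim by (intro divide_right_mono mult_right_mono) auto
        also have "\<dots> \<le> T z" by fact
        also have "T z = exp (q z)" unfolding expq[OF Gz z(2)] T_def using G by simp
        finally show ?case by simp
      qed
      from laplacian_local_max[OF lq this] L show False by simp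
    qed
    obtain zm where zm: "zm \<in> cball 0 (1/2)" "\<And>w. w \<in> cball 0 (1/2) \<Longrightarrow> T w \<le> T zm"
      using continuous_attains_sup[OF _ _ Tcont] by auto
    have Tzm: "T zm \<le> 6 * M"
    proof (cases "T zm > 0")
      case False then show ?thesis using M by simp
    next
      case True
      then have nz: "zm \<noteq> 0" using T0 by auto
      have "zm \<notin> ball 0 (1/2)"
      proof
        assume b: "zm \<in> ball 0 (1/2)"
        have "\<forall>\<^sub>F w in nhds zm. T w \<le> T zm"
          using eventually_nhds_in_open[OF open_ball b] by (rule eventually_mono) (use zm in auto)
        then show False using nomax[of zm] b nz True by auto
      qed
      then have h: "norm zm = 1/2" using zm by auto
      have "exp ((1/2)\<^sup>2) \<le> exp (1::real)" by (simp add: power2_eq_square)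
      then have "exp ((1/2)\<^sup>2) \<le> (3::real)" using exp_le by linarith
      moreover have "P zm \<le> M" using Ple h by simp
      ultimately have "P zm * exp ((1/2)\<^sup>2) \<le> M * 3" using M by (intro mult_mono) auto
      then show ?thesis by (simp add: T_def h)
    qed
    have zb: "norm z1 < 1/2" "norm z1 < m / (6 * M)" using z1 by (auto simp: t_def)
    have "P z1 < m"
    proof (cases "z1 = 0")
      case True
      then show ?thesis using f0 k by (simp add: P_def d_def g_def y_def)
    next
      case False
      have "P z1 \<le> P z1 * exp ((norm z1)\<^sup>2) \<or> P z1 \<le> 0" by (cases "P z1 \<le> 0") (auto simp: mult_le_cancel_left1)
      moreover have "P z1 * exp ((norm z1)\<^sup>2) / norm z1 \<le> 6 * M" using zm(2)[of z1] Tzm zb by (auto simp: T_def)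
      then have "P z1 * exp ((norm z1)\<^sup>2) \<le> 6 * M * norm z1" using False by (simp add: divide_le_eq)
      moreover have "6 * M * norm z1 < m" using zb M by (simp add: field_simps)
      ultimately show ?thesis using k by linarith
    qed
    then show "norm (f z1 - p) < a" by (auto simp: P_def d_def[symmetric] split: if_splits)
  qed
qed

section \<open>Estimates for conformal harmonic discs\<close>

text \<open>The barrier divided by \<open>- c\<close> is a superharmonic majorant of \<open>|f - p|^2\<close> with value at most \<open>2 \<delta> / c\<close> at the
  centre. Applying the pointwise bound to the component of \<open>f - p\<close> in the direction of \<open>f z - p\<close> avoids a factor depending on the dimension.\<close>

lemma localised_disc_distance:
  fixes f :: "complex \<Rightarrow> 'a::euclidean_space"
  assumes qs: "quadratic_support G p r A c e n" and A: "A \<ge> 0" and c: "c > 0"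
    and f: "f \<in> conformal_harmonic_maps G" and f0: "f 0 = p - \<delta> *\<^sub>R n"
    and \<delta>: "0 < \<delta>" "A * \<delta> \<le> 1"
    and loc: "f ` ball 0 R \<subseteq> ball p r" and R: "R \<le> 1" and z: "z \<in> ball 0 R"
  shows "(norm (f z - p))\<^sup>2 \<le> 8 * \<delta> / c * (R / (R - norm z))"
proof -
  have en: "norm e = 1" "norm n = 1" using qs by (auto simp: quadratic_support_def)
  have sub: "ball (0::complex) R \<subseteq> ball 0 1" using R by auto
  have fG: "f ` ball 0 1 \<subseteq> G" using f by (simp add: conformal_harmonic_maps_def)
  have cj: "conformal_jet f w" if "w \<in> ball 0 R" for w
    using conformal_harmonic_map_jet[OF f] sub that by blast
  define Z where "Z w = (- (1 / c)) * barrier A e n p (f w)" for w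
  define b where "b = sgn (f z - p)"
  have b: "norm b \<le> 1" by (simp add: b_def norm_sgn)
  obtain F where F: "F holomorphic_on ball 0 1" "\<And>w. w \<in> ball 0 1 \<Longrightarrow> Re (F w) = f w \<bullet> b + (- (p \<bullet> b))" "Im (F 0) = 0"
    using conformal_harmonic_component_holomorphic[OF f, of b "- (p \<bullet> b)"] by blast
  have ReF: "Re (F w) = (f w - p) \<bullet> b" if "w \<in> ball 0 R" for w
    using F(2)[of w] sub that by (auto simp: inner_diff_left)
  have "(norm (F z))\<^sup>2 \<le> 4 * Z 0 * R / (R - norm z)"
  proof (rule hardy_pointwise_bound[where F = F and Z = Z, OF _ F(3) _ _ _ z])
    show "F holomorphic_on ball 0 R" using F(1) sub by (rule holomorphic_on_subset)
    have "continuous_on (ball 0 R) f"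
      using cj by (intro continuous_at_imp_continuous_on) (auto simp: conformal_jet_def intro: differentiable_imp_continuous_within)
    then show "continuous_on (ball 0 R) Z" unfolding Z_def barrier_def by (intro continuous_intros)
    fix w :: complex assume w: "w \<in> ball 0 R"
    obtain L where L: "L \<ge> 0" "laplacian_at (\<lambda>z. barrier A e n p (f z)) w L"
      using laplacian_barrier_conformal[OF cj[OF w] A en(1)] by blast
    have "laplacian_at Z w (- (1 / c) * L)" unfolding Z_def using L(2) by (rule laplacian_cmult)
    moreover have "- (1 / c) * L \<le> 0" using L c by simp
    ultimately show "\<exists>L\<le>0. laplacian_at Z w L" by blast
    have "f w \<in> G \<inter> ball p r" using image_subset_iff[THEN iffD1, OF fG] image_subset_iff[THEN iffD1, OF loc] w sub by blast
    then have "barrier A e n p (f w) \<le> - c * ((f w - p) \<bullet> (f w - p))"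
      using qs unfolding quadratic_support_def by blast
    then have "(norm (f w - p))\<^sup>2 \<le> Z w" using c by (simp add: Z_def field_simps dot_square_norm)
    moreover have "\<bar>(f w - p) \<bullet> b\<bar> \<le> norm (f w - p) * 1"
      using Cauchy_Schwarz_ineq2[of "f w - p" b] mult_left_mono[OF b norm_ge_zero[of "f w - p"]] by linarith
    then have "((f w - p) \<bullet> b)\<^sup>2 \<le> (norm (f w - p))\<^sup>2" by (simp add: abs_le_square_iff[symmetric])
    ultimately show "(Re (F w))\<^sup>2 \<le> Z w" by (simp add: ReF[OF w])
  qed
  moreover have "(norm (f z - p))\<^sup>2 \<le> (norm (F z))\<^sup>2"
  proof -
    have "Re (F z) = norm (f z - p)"
      using ReF[OF z] by (cases "f z = p") (auto simp: b_def sgn_div_norm dot_square_norm power2_eq_square)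
    then show ?thesis by (simp add: cmod_power2)
  qed
  moreover have "Z 0 \<le> 2 * \<delta> / c"
  proof -
    have "barrier A e n p (f 0) \<ge> - (norm (f 0 - p) + A * (norm (f 0 - p))\<^sup>2)"
      by (rule barrier_lower_bound[OF en(2) A en(1)])
    also have "norm (f 0 - p) = \<delta>" using f0 en \<delta> by simp
    finally have "barrier A e n p (f 0) \<ge> - (\<delta> + A * \<delta>\<^sup>2)" .
    moreover have "A * \<delta>\<^sup>2 \<le> \<delta>" using \<delta> by (simp add: power2_eq_square mult.assoc[symmetric])
    ultimately have "- barrier A e n p (f 0) \<le> 2 * \<delta>" by linarith
    then show ?thesis using c divide_right_mono[of "- barrier A e n p (f 0)" "2 * \<delta>" c] by (simp add: Z_def)
  qed
  moreover have Rz: "R - norm z > 0" "R > 0" using z by (auto intro: le_less_trans[OF norm_ge_zero])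
  then have "4 * Z 0 * R / (R - norm z) \<le> 4 * (2 * \<delta> / c) * R / (R - norm z)"
    using \<open>Z 0 \<le> 2 * \<delta> / c\<close> by (intro divide_right_mono mult_right_mono mult_left_mono) auto
  moreover have "4 * (2 * \<delta> / c) * R / (R - norm z) = 8 * \<delta> / c * (R / (R - norm z))" by simp
  ultimately show ?thesis by linarith
qed

text \<open>Shifting the component of \<open>f - p\<close> in the direction of the derivative by \<open>2 m\<close> makes it positive.\<close>

lemma disc_tangential_estimate:
  fixes f :: "complex \<Rightarrow> 'a::euclidean_space"
  assumes f: "f \<in> conformal_harmonic_maps G" and t: "t > 0" "t \<le> 1" and m: "m > 0"
    and near: "\<And>z. z \<in> ball 0 t \<Longrightarrow> norm (f z - p) \<le> m"
  shows "norm (partial_x f 0) \<le> 6 * m / t"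
proof -
  define w where "w = sgn (partial_x f 0)"
  have w: "norm w \<le> 1" by (simp add: w_def norm_sgn)
  obtain F where F: "F holomorphic_on ball 0 1" "\<And>z. z \<in> ball 0 1 \<Longrightarrow> Re (F z) = f z \<bullet> w + (2 * m - p \<bullet> w)"
    "Im (F 0) = 0" "Re (deriv F 0) = partial_x f 0 \<bullet> w"
    using conformal_harmonic_component_holomorphic[OF f, of w "2 * m - p \<bullet> w"] by blast
  have bd: "m \<le> Re (F z) \<and> Re (F z) \<le> 3 * m" if z: "z \<in> ball 0 t" for z
  proof -
    have "\<bar>(f z - p) \<bullet> w\<bar> \<le> norm (f z - p) * 1"
      using Cauchy_Schwarz_ineq2[of "f z - p" w] mult_left_mono[OF w norm_ge_zero[of "f z - p"]] by linarith
    then have "\<bar>(f z - p) \<bullet> w\<bar> \<le> m" using near[OF z] by simp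
    moreover have "Re (F z) = (f z - p) \<bullet> w + 2 * m" using F(2)[of z] z t by (simp add: inner_diff_left)
    ultimately show ?thesis by linarith
  qed
  have "ball (0::complex) t \<subseteq> ball 0 1" using t by auto
  then have "F holomorphic_on ball 0 t" using F(1) holomorphic_on_subset by blast
  then have "t * norm (deriv F 0) \<le> 2 * Re (F 0)"
    by (rule positive_harmonic_gradient_bound[where F = F, OF _ t(1) F(3)]) (use bd m in force)
  also have "\<dots> \<le> 6 * m" using bd[of 0] t by simp
  finally have "norm (deriv F 0) \<le> 6 * m / t" using t by (simp add: pos_le_divide_eq mult.commute)
  moreover have "norm (partial_x f 0) = partial_x f 0 \<bullet> w"
    by (cases "partial_x f 0 = 0") (auto simp: w_def sgn_div_norm dot_square_norm power2_eq_square)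
  ultimately show ?thesis using F(4) complex_Re_le_cmod[of "deriv F 0"] by simp
qed

text \<open>Openness of \<open>G\<close> turns the weak inequality \<open>(y - p) \<bullet> n \<le> 0\<close> into a strict one.\<close>

lemma disc_normal_estimate:
  fixes f :: "complex \<Rightarrow> 'a::euclidean_space"
  assumes qs: "quadratic_support G p r A c e n" and G: "open G"
    and f: "f \<in> conformal_harmonic_maps G" and f0: "f 0 = p - \<delta> *\<^sub>R n"
    and loc: "f ` ball 0 R \<subseteq> ball p r" and R: "0 < R" "R \<le> 1"
  shows "R * \<bar>partial_x f 0 \<bullet> n\<bar> \<le> 2 * \<delta>"
proof -
  have n: "norm n = 1" using qs by (simp add: quadratic_support_def)
  then have nn: "n \<bullet> n = 1" by (simp add: dot_square_norm)
  have sub: "ball (0::complex) R \<subseteq> ball 0 1" using R by auto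
  have fG: "f ` ball 0 1 \<subseteq> G" using f by (simp add: conformal_harmonic_maps_def)
  obtain F where F: "F holomorphic_on ball 0 1" "\<And>z. z \<in> ball 0 1 \<Longrightarrow> Re (F z) = f z \<bullet> (- n) + p \<bullet> n"
    "Im (F 0) = 0" "Re (deriv F 0) = partial_x f 0 \<bullet> (- n)"
    using conformal_harmonic_component_holomorphic[OF f, of "- n" "p \<bullet> n"] by blast
  have strict: "(y - p) \<bullet> n < 0" if y: "y \<in> G \<inter> ball p r" for y
  proof -
    have "open (G \<inter> ball p r)" using G by auto
    then obtain \<epsilon> where \<epsilon>: "\<epsilon> > 0" "ball y \<epsilon> \<subseteq> G \<inter> ball p r" using y open_contains_ball by blast
    have "y + (\<epsilon> / 2) *\<^sub>R n \<in> ball y \<epsilon>" using \<epsilon> n by (simp add: dist_norm)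
    then have "(y + (\<epsilon> / 2) *\<^sub>R n - p) \<bullet> n \<le> 0" using \<epsilon> qs unfolding quadratic_support_def by blast
    then show ?thesis using \<epsilon> nn by (simp add: inner_diff_left inner_add_left)
  qed
  have pos: "Re (F z) > 0" if z: "z \<in> ball 0 R" for z
  proof -
    have "f z \<in> G \<inter> ball p r" using image_subset_iff[THEN iffD1, OF fG] image_subset_iff[THEN iffD1, OF loc] z sub by blast
    from strict[OF this] show ?thesis using F(2)[of z] z sub by (auto simp: inner_diff_left)
  qed
  have "F holomorphic_on ball 0 R" using F(1) sub by (rule holomorphic_on_subset)
  then have "R * norm (deriv F 0) \<le> 2 * Re (F 0)"
    by (rule positive_harmonic_gradient_bound[where F = F, OF _ R(1) F(3) pos])
  moreover have "Re (F 0) = \<delta>" using F(2)[of 0] f0 nn by (simp add: inner_diff_left)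
  moreover have "\<bar>partial_x f 0 \<bullet> n\<bar> \<le> norm (deriv F 0)" using F(4) abs_Re_le_cmod[of "deriv F 0"] by simp
  then have "R * \<bar>partial_x f 0 \<bullet> n\<bar> \<le> R * norm (deriv F 0)" using R by (intro mult_left_mono) auto
  ultimately show ?thesis by linarith
qed

text \<open>Let \<open>R\<close> be the largest radius such that \<open>f\<close> stays within \<open>a\<close> of \<open>p\<close>. On the disc of radius \<open>s = R (1 - C1 \<delta>)\<close> it
  even stays within \<open>a / 2\<close>, so the assumption \<open>stay\<close>, applied to \<open>f\<close> on the discs of centre \<open>z\<close> and radius \<open>1 - s\<close> with \<open>|z| = s\<close>, shows that
  \<open>f\<close> stays within \<open>a\<close> on the disc of radius \<open>s + t (1 - s)\<close>. If \<open>1 - R\<close> were larger than a multiple of \<open>\<delta>\<close>, this radius would exceed \<open>R\<close>.\<close>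

lemma disc_localisation_bootstrap:
  fixes f :: "complex \<Rightarrow> 'a::euclidean_space"
  assumes qs: "quadratic_support G p r A c e n" and A: "A \<ge> 0" and c: "c > 0"
    and f: "f \<in> conformal_harmonic_maps G" and f0: "f 0 = p - \<delta> *\<^sub>R n"
    and at: "0 < a" "a < r" "0 < t" "t \<le> 1/2"
    and stay: "\<And>(f :: complex \<Rightarrow> 'a) z.
       \<lbrakk>f ` ball 0 1 \<subseteq> G; \<And>z. z \<in> ball 0 1 \<Longrightarrow> conformal_jet f z;
        norm (f 0 - p) < a / 2; z \<in> ball 0 t\<rbrakk> \<Longrightarrow> norm (f z - p) < a"
    and \<delta>: "0 < \<delta>" "A * \<delta> \<le> 1" "\<delta> < a / 2"
    and C1: "C1 = 64 / (c * a\<^sup>2)" "C1 * \<delta> < 1"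
  shows "f ` ball 0 (1 - 2 * C1 / t * \<delta>) \<subseteq> ball p a"
proof (rule ccontr)
  assume contra: "\<not> ?thesis"
  define R0 where "R0 = 1 - 2 * C1 / t * \<delta>"
  have C1p: "C1 > 0" using c at C1 by simp
  have n: "norm n = 1" using qs by (simp add: quadratic_support_def)
  have fG: "f ` ball 0 1 \<subseteq> G" using f by (simp add: conformal_harmonic_maps_def)
  note cj = conformal_harmonic_map_jet[OF f]
  \<comment> \<open>The choice of \<open>C1\<close> is what makes the pointwise bound smaller than \<open>(a / 2)^2\<close> on the disc of radius \<open>s\<close> below.\<close>
  define S where "S = {R. 0 < R \<and> R \<le> 1 \<and> f ` ball 0 R \<subseteq> ball p a}"
  have bdd: "bdd_above S" by (auto simp: S_def bdd_above_def)
  have "norm (f 0 - p) < a / 2" using f0 n \<delta> by simp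
  then have "t \<in> S" using stay[OF fG cj] at by (auto simp: S_def dist_norm norm_minus_commute)
  define R where "R = Sup S"
  have Rt: "t \<le> R" unfolding R_def using \<open>t \<in> S\<close> bdd by (rule cSup_upper)
  have R1: "R \<le> 1" unfolding R_def using \<open>t \<in> S\<close> by (intro cSup_least) (auto simp: S_def)
  have locR: "norm (f w - p) < a" if w: "norm w < R" for w
  proof -
    obtain R' where "R' \<in> S" "norm w < R'" using less_cSup_iff[of S "norm w"] w \<open>t \<in> S\<close> bdd R_def by auto
    then have "w \<in> ball 0 R'" "f ` ball 0 R' \<subseteq> ball p a" by (auto simp: S_def)
    then have "f w \<in> ball p a" by blast
    then show ?thesis by (simp add: dist_norm norm_minus_commute)
  qed
  have RR0: "R < R0"
  proof (rule ccontr)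
    assume "\<not> R < R0"
    then have "f ` ball 0 R0 \<subseteq> ball p a" using locR by (auto simp: dist_norm norm_minus_commute)
    then show False using contra by (simp add: R0_def)
  qed
  define s where "s = R * (1 - C1 * \<delta>)"
  have s: "s < R" "0 < s" using Rt at C1 C1p \<delta> by (auto simp: s_def)
  have close: "norm (f w - p) < a / 2" if w: "norm w \<le> s" for w
  proof -
    have wR: "R - norm w \<ge> R * (C1 * \<delta>)" "w \<in> ball 0 R" using w s by (auto simp: s_def algebra_simps)
    have "(norm (f w - p))\<^sup>2 \<le> 8 * \<delta> / c * (R / (R - norm w))"
      using localised_disc_distance[OF qs A c f f0 \<delta>(1,2) _ R1 wR(2)] locR at
      by (force simp: dist_norm norm_minus_commute)
    also have "\<dots> \<le> 8 * \<delta> / c * (R / (R * (C1 * \<delta>)))"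
      using wR Rt at C1p \<delta> c by (intro mult_left_mono divide_left_mono mult_pos_pos) auto
    also have "\<dots> = 8 / (c * C1)" using Rt at \<delta> C1p c by simp
    also have "\<dots> = a\<^sup>2 / 8" using c at C1 by simp
    also have "\<dots> < (a / 2)\<^sup>2" using at by (simp add: power_divide)
    finally show ?thesis by (rule power2_less_imp_less) (use at in simp)
  qed
  have "R + C1 * \<delta> \<in> S"
  proof -
    have "4 * (C1 * \<delta>) \<le> 2 * C1 / t * \<delta>"
      using at C1p \<delta> by (simp add: pos_le_divide_eq)
    then have "R + C1 * \<delta> \<le> 1" using RR0 C1p \<delta> mult_pos_pos[OF C1p \<delta>(1)] unfolding R0_def by linarith
    moreover have "norm (f w - p) < a" if w: "norm w < R + C1 * \<delta>" for w
    proof (cases "norm w \<le> s")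
      case True then show ?thesis using close[OF True] at by simp
    next
      case False
      then have w0: "norm w > s" "w \<noteq> 0" using s by auto
      define z where "z = (s / norm w) *\<^sub>R w"
      have nz: "norm z = s" using w0 s by (simp add: z_def)
      have s1: "s < 1" using s R1 by simp
      define h where "h \<zeta> = f (z + (1 - s) *\<^sub>R \<zeta>)" for \<zeta>
      have inb: "z + (1 - s) *\<^sub>R \<zeta> \<in> ball 0 1" if "\<zeta> \<in> ball 0 1" for \<zeta>
      proof -
        have "norm (z + (1 - s) *\<^sub>R \<zeta>) \<le> s + (1 - s) * norm \<zeta>"
          using norm_triangle_ineq[of z "(1 - s) *\<^sub>R \<zeta>"] nz s1 by simp
        also have "\<dots> < s + (1 - s) * 1" using that s1 by (intro add_strict_left_mono mult_strict_left_mono) auto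
        finally show ?thesis by simp
      qed
      define \<zeta>w where "\<zeta>w = (1 / (1 - s)) *\<^sub>R (w - z)"
      have hw: "h \<zeta>w = f w" using s1 by (simp add: h_def \<zeta>w_def)
      have "w - z = (1 - s / norm w) *\<^sub>R w" by (simp add: z_def algebra_simps)
      then have "norm (w - z) = \<bar>1 - s / norm w\<bar> * norm w" by simp
      also have "\<dots> = norm w - s" using w0 s by (simp add: field_simps)
      also have "\<dots> < R + C1 * \<delta> - R * (1 - C1 * \<delta>)" using w by (simp add: s_def)
      also have "\<dots> = C1 * \<delta> + R * (C1 * \<delta>)" by (simp add: algebra_simps)
      also have "\<dots> \<le> 2 * (C1 * \<delta>)" using R1 C1p \<delta> by (simp add: mult_le_cancel_right1)
      also have "\<dots> = t * (2 * C1 / t * \<delta>)" using at by simp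
      also have "\<dots> \<le> t * (1 - s)" using at RR0 s unfolding R0_def by (intro mult_left_mono) auto
      finally have "norm \<zeta>w < t" using s1 by (simp add: \<zeta>w_def divide_less_eq)
      moreover have "h ` ball 0 1 \<subseteq> G" using inb fG by (auto simp: h_def)
      moreover have "conformal_jet h \<zeta>" if "\<zeta> \<in> ball 0 1" for \<zeta>
        unfolding h_def by (intro conformal_jet_rescale cj inb that)
      moreover have "norm (h 0 - p) < a / 2" using close[of z] nz by (simp add: h_def)
      ultimately have "norm (h \<zeta>w - p) < a" by (intro stay) auto
      then show ?thesis by (simp add: hw)
    qed
    moreover have "0 < R + C1 * \<delta>" using Rt at C1p \<delta> by (simp add: add_pos_pos)
    ultimately show ?thesis by (auto simp: S_def dist_norm norm_minus_commute)
  qed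
  then have "R + C1 * \<delta> \<le> R" unfolding R_def using bdd by (rule cSup_upper)
  then show False using mult_pos_pos[OF C1p \<delta>(1)] by simp
qed

lemma conformal_disc_derivative_estimates:
  fixes r A c :: real
  assumes r: "r > 0" and A: "A \<ge> 0" and c: "c > 0"
  obtains C K d where "C > 0" "K > 0" "d > 0"
    "\<And>(f :: complex \<Rightarrow> 'a::euclidean_space) G p e n \<delta>.
       \<lbrakk>quadratic_support G p r A c e n; open G; f \<in> conformal_harmonic_maps G; f 0 = p - \<delta> *\<^sub>R n; 0 < \<delta>; \<delta> < d\<rbrakk>
       \<Longrightarrow> (1 - C * \<delta>) * \<bar>partial_x f 0 \<bullet> n\<bar> \<le> 2 * \<delta> \<and> norm (partial_x f 0) \<le> K * sqrt \<delta>"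
proof -
  obtain a t where at: "0 < a" "a < r" "0 < t" "t \<le> 1/2"
    and stay: "\<And>(f :: complex \<Rightarrow> 'a) G p e n z.
       \<lbrakk>quadratic_support G p r A c e n; f ` ball 0 1 \<subseteq> G; \<And>z. z \<in> ball 0 1 \<Longrightarrow> conformal_jet f z;
        norm (f 0 - p) < a / 2; z \<in> ball 0 t\<rbrakk> \<Longrightarrow> norm (f z - p) < a"
    using conformal_disc_stays_near[OF r A c, where ?'a = 'a] by metis
  define C1 where "C1 = 64 / (c * a\<^sup>2)"
  have C1: "C1 > 0" using c at by (simp add: C1_def)
  define C where "C = 2 * C1 / t"
  have C: "C > 0" using C1 at by (simp add: C_def)
  define K where "K = 48 / (t * sqrt c)"
  have K: "K > 0" using at c by (simp add: K_def)
  define d where "d = min (min (1 / (A + 1)) (a / 2)) (min (1 / C1) (1 / C))"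
  have d: "d > 0" using A at C1 C by (simp add: d_def add_nonneg_pos)
  show thesis
  proof (rule that[OF C K d])
    fix f :: "complex \<Rightarrow> 'a" and G p e n \<delta>
    assume qs: "quadratic_support G p r A c e n" and G: "open G" and f: "f \<in> conformal_harmonic_maps G"
      and f0: "f 0 = p - \<delta> *\<^sub>R n" and \<delta>: "0 < \<delta>" "\<delta> < d"
    have d1: "\<delta> * (A + 1) < 1" "\<delta> < a / 2" "C1 * \<delta> < 1" "C * \<delta> < 1"
      using \<delta> A C1 C by (auto simp: d_def pos_less_divide_eq add_nonneg_pos mult.commute)
    then have A\<delta>: "A * \<delta> \<le> 1" using \<delta> by (simp add: algebra_simps)
    have n: "norm n = 1" using qs by (simp add: quadratic_support_def)
    have loc: "f ` ball 0 (1 - C * \<delta>) \<subseteq> ball p a" unfolding C_def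
    proof (rule disc_localisation_bootstrap[OF qs A c f f0 at _ \<delta>(1) A\<delta> d1(2) C1_def d1(3)])
      fix h :: "complex \<Rightarrow> 'a" and z :: complex
      assume "h ` ball 0 1 \<subseteq> G" "\<And>z. z \<in> ball 0 1 \<Longrightarrow> conformal_jet h z" "norm (h 0 - p) < a / 2" "z \<in> ball 0 t"
      then show "norm (h z - p) < a" by (rule stay[OF qs])
    qed
    then have "f ` ball 0 (1 - C * \<delta>) \<subseteq> ball p r" using at by (meson less_imp_le order_trans subset_ball)
    then have 1: "(1 - C * \<delta>) * \<bar>partial_x f 0 \<bullet> n\<bar> \<le> 2 * \<delta>"
      by (rule disc_normal_estimate[OF qs G f f0]) (use d1 C \<delta> in auto)
    define m where "m = 4 * sqrt (\<delta> / c)"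
    have m: "m > 0" using \<delta> c by (simp add: m_def)
    have fG: "f ` ball 0 1 \<subseteq> G" using f by (simp add: conformal_harmonic_maps_def)
    have "norm (f 0 - p) < a / 2" using f0 n \<delta> d1 by simp
    then have ft: "norm (f z - p) < a" if "z \<in> ball 0 t" for z
      using stay[OF qs fG conformal_harmonic_map_jet[OF f]] that by blast
    have "norm (partial_x f 0) \<le> 6 * m / (t / 2)"
    proof (rule disc_tangential_estimate[OF f _ _ m])
      fix z :: complex assume z: "z \<in> ball 0 (t / 2)"
      then have zt: "z \<in> ball 0 t" using at by simp
      have "f ` ball 0 t \<subseteq> ball p r" using ft at by (force simp: dist_norm norm_minus_commute)
      then have "(norm (f z - p))\<^sup>2 \<le> 8 * \<delta> / c * (t / (t - norm z))"
        by (rule localised_disc_distance[OF qs A c f f0 \<delta>(1) A\<delta> _ _ zt]) (use at in simp)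
      also have "\<dots> \<le> 8 * \<delta> / c * 2"
        using z at \<delta> c by (intro mult_left_mono) (auto simp: divide_le_eq)
      also have "\<dots> = m\<^sup>2" using \<delta> c by (simp add: m_def power_mult_distrib)
      finally show "norm (f z - p) \<le> m" by (rule power2_le_imp_le) (use m in simp)
    qed (use at in auto)
    also have "\<dots> = K * sqrt \<delta>" by (simp add: K_def m_def real_sqrt_divide)
    finally show "(1 - C * \<delta>) * \<bar>partial_x f 0 \<bullet> n\<bar> \<le> 2 * \<delta> \<and> norm (partial_x f 0) \<le> K * sqrt \<delta>"
      using 1 by blast
  qed
qed

section \<open>Geometry of the boundary\<close>

text \<open>Passing from the tangent space to the whole space costs a multiple of the normal component of \<open>w\<close>, which is small for chords of the boundary.\<close>

lemma restricted_form_extension: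
  fixes H :: "'a::euclidean_space \<Rightarrow> 'a"
  assumes H: "linear H" and bd: "\<And>x. norm (H x) \<le> B * norm x" and n: "norm n = 1"
    and e: "e \<bullet> n = 0" and A: "A \<ge> 0" and c: "c \<ge> 0"
    and T: "\<And>w. w \<bullet> n = 0 \<Longrightarrow> H w \<bullet> w \<ge> A * (w \<bullet> w - 2 * (w \<bullet> e)\<^sup>2) + c * (w \<bullet> w)"
    and sym: "\<And>u v. H u \<bullet> v = H v \<bullet> u"
  shows "H w \<bullet> w \<ge> A * (w \<bullet> w - 2 * (w \<bullet> e)\<^sup>2) + c * (w \<bullet> w) - (A + c + 3 * B) * (\<bar>w \<bullet> n\<bar> * norm w)"
proof -
  define s where "s = w \<bullet> n"
  define y where "y = w - s *\<^sub>R n"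
  have nn: "n \<bullet> n = 1" using n by (simp add: dot_square_norm)
  have B: "B \<ge> 0" using bd[of n] n norm_ge_zero[of "H n"] by (metis mult.right_neutral order_trans)
  have yn: "y \<bullet> n = 0" using nn by (simp add: y_def s_def inner_diff_left)
  have ye: "y \<bullet> e = w \<bullet> e" using e by (simp add: y_def inner_diff_left inner_commute[of n e])
  have yy: "y \<bullet> y = w \<bullet> w - s\<^sup>2"
    using nn by (simp add: y_def s_def inner_diff_left inner_diff_right inner_commute power2_eq_square)
  have sw: "\<bar>s\<bar> \<le> norm w" using Cauchy_Schwarz_ineq2[of w n] n by (simp add: s_def)
  have s2: "s\<^sup>2 \<le> \<bar>s\<bar> * norm w"
  proof -
    have "s\<^sup>2 = \<bar>s\<bar> * \<bar>s\<bar>" by (simp add: power2_eq_square)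
    also have "\<dots> \<le> \<bar>s\<bar> * norm w" using sw by (intro mult_left_mono) auto
    finally show ?thesis .
  qed
  have "w = y + s *\<^sub>R n" by (simp add: y_def)
  then have "H w \<bullet> w = H (y + s *\<^sub>R n) \<bullet> (y + s *\<^sub>R n)" by metis
  also have "\<dots> = H y \<bullet> y + 2 * s * (H n \<bullet> y) + s\<^sup>2 * (H n \<bullet> n)"
    using H sym[of y n] by (simp add: linear_add linear_cmul inner_add_left inner_add_right power2_eq_square algebra_simps)
  also have "\<dots> \<ge> H y \<bullet> y - 2 * (B * (\<bar>s\<bar> * norm w)) - B * (\<bar>s\<bar> * norm w)"
  proof -
    have "norm y \<le> norm w"
    proof (rule power2_le_imp_le)
      show "(norm y)\<^sup>2 \<le> (norm w)\<^sup>2" using yy by (simp flip: dot_square_norm)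
    qed simp
    moreover have "\<bar>H n \<bullet> y\<bar> \<le> norm (H n) * norm y" by (rule Cauchy_Schwarz_ineq2)
    moreover have "norm (H n) * norm y \<le> B * norm w" using bd[of n] n B \<open>norm y \<le> norm w\<close> by (intro mult_mono) auto
    ultimately have "\<bar>H n \<bullet> y\<bar> \<le> B * norm w" by linarith
    then have "\<bar>s\<bar> * \<bar>H n \<bullet> y\<bar> \<le> \<bar>s\<bar> * (B * norm w)" by (rule mult_left_mono) simp
    then have 1: "\<bar>s * (H n \<bullet> y)\<bar> \<le> B * (\<bar>s\<bar> * norm w)" by (simp add: abs_mult mult.left_commute)
    have "\<bar>H n \<bullet> n\<bar> \<le> B" using Cauchy_Schwarz_ineq2[of "H n" n] bd[of n] n by simp
    then have "\<bar>s\<^sup>2 * (H n \<bullet> n)\<bar> \<le> s\<^sup>2 * B" by (simp add: abs_mult mult_left_mono)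
    also have "\<dots> \<le> B * (\<bar>s\<bar> * norm w)" using s2 B by (metis mult.commute mult_left_mono)
    finally show ?thesis using 1 by (simp add: mult.assoc)
  qed
  finally have "H w \<bullet> w \<ge> H y \<bullet> y - 3 * B * (\<bar>s\<bar> * norm w)" by (simp add: algebra_simps)
  moreover have "H y \<bullet> y \<ge> A * (w \<bullet> w - 2 * (w \<bullet> e)\<^sup>2) + c * (w \<bullet> w) - (A + c) * s\<^sup>2"
    using T[OF yn] unfolding yy ye by (simp add: algebra_simps)
  moreover have "(A + c) * s\<^sup>2 \<le> (A + c) * (\<bar>s\<bar> * norm w)" using s2 A c by (intro mult_left_mono) auto
  ultimately show ?thesis unfolding s_def[symmetric] by (simp add: algebra_simps)
qed

lemma defining_function_closure:
  assumes "local_defining_function D \<xi> W \<rho>" "y \<in> closure D" "y \<in> W"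
  shows "\<rho> y \<le> 0"
proof (cases "y \<in> D")
  case True
  then have "y \<in> {x \<in> W. \<rho> x < 0}" using assms unfolding local_defining_function_def by blast
  then show ?thesis by simp
next
  case False
  then have "y \<in> frontier D" using assms(2) interior_subset unfolding frontier_def by blast
  then have "y \<in> {x \<in> W. \<rho> x = 0}" using assms unfolding local_defining_function_def by blast
  then show ?thesis by simp
qed

text \<open>The segment from \<open>p\<close> to \<open>y\<close> stays in the closure of \<open>D\<close>, where the defining function is at most its value \<open>0\<close> at \<open>p\<close>.\<close>

lemma convex_side_of_tangent:
  assumes ld: "local_defining_function D \<xi> W \<rho>" and W2: "open W2" "convex (D \<inter> W2)"
    and p: "p \<in> frontier D" "p \<in> W" "p \<in> W2" and y: "y \<in> D" "y \<in> W2"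
  shows "gradient \<rho> p \<bullet> (y - p) \<le> 0"
proof (rule ccontr)
  assume "\<not> ?thesis"
  then have pos: "(y - p) \<bullet> gradient \<rho> p > 0" by (simp add: inner_commute)
  have W: "open W" and C2: "C2_on W \<rho>" using ld by (auto simp: local_defining_function_def)
  have p0: "\<rho> p = 0" using ld p by (auto simp: local_defining_function_def)
  have d: "((\<lambda>t. \<rho> (p + t *\<^sub>R (y - p))) has_real_derivative ((y - p) \<bullet> gradient \<rho> p)) (at 0)"
    by (rule gradient_ray) (use C2 p in \<open>auto simp: C2_on_def\<close>)
  obtain a where a: "a > 0" "\<And>t. 0 < t \<Longrightarrow> t < a \<Longrightarrow> \<rho> (p + t *\<^sub>R (y - p)) > 0"
    using DERIV_pos_inc_right[OF d pos] p0 by auto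
  have "((\<lambda>t. p + t *\<^sub>R (y - p)) \<longlongrightarrow> p + 0 *\<^sub>R (y - p)) (at_right 0)" by (intro tendsto_intros)
  then have "\<forall>\<^sub>F t in at_right 0. p + t *\<^sub>R (y - p) \<in> W"
    using W p by (auto dest!: topological_tendstoD)
  then obtain b where b: "b > 0" "\<And>t. 0 < t \<Longrightarrow> t < b \<Longrightarrow> p + t *\<^sub>R (y - p) \<in> W"
    by (auto simp: eventually_at_right_field)
  define t where "t = min 1 (min a b) / 2"
  have t: "0 < t" "t < a" "t < b" "t < 1" using a b by (auto simp: t_def)
  have "p \<in> closure (W2 \<inter> D)"
    using open_Int_closure_subset[OF W2(1), of D] p by (auto simp: frontier_def)
  moreover have "y \<in> closure (W2 \<inter> D)" using y by (intro closure_subset[THEN subsetD]) auto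
  moreover have "convex (closure (W2 \<inter> D))" using W2 by (simp add: convex_closure Int_commute)
  ultimately have "(1 - t) *\<^sub>R p + t *\<^sub>R y \<in> closure (W2 \<inter> D)" using t by (intro convexD) auto
  moreover have "(1 - t) *\<^sub>R p + t *\<^sub>R y = p + t *\<^sub>R (y - p)" by (simp add: algebra_simps)
  ultimately have "p + t *\<^sub>R (y - p) \<in> closure D" using closure_mono[of "W2 \<inter> D" D] by auto
  then have "\<rho> (p + t *\<^sub>R (y - p)) \<le> 0" using defining_function_closure[OF ld] b t by blast
  then show False using a(2)[of t] t by simp
qed

text \<open>Taylor expansion of the defining function at \<open>p\<close>, evaluated at a point \<open>y\<close> of \<open>D\<close> or of the boundary, bounds the height of \<open>y\<close> over the tangent
  hyperplane by the Hessian at a nearby point, hence by the Hessian at \<open>\<xi>\<close> up to a small multiple of \<open>|y - p|^2\<close>. If \<open>\<alpha>\<close>, \<open>\<beta>\<close>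
  are the numbers provided by \<open>two_smallest_eigenvalues_bound\<close>, the form \<open>\<alpha> (w \<bullet> e)^2 + \<beta> (w \<bullet> w - (w \<bullet> e)^2)\<close> equals
  \<open>(\<beta> - \<alpha>)/2 * (w \<bullet> w - 2 (w \<bullet> e)^2) + (\<alpha> + \<beta>)/2 * (w \<bullet> w)\<close>, and the last coefficient is positive. The
  radius \<open>r\<close> is chosen so small that the error terms use up at most half of it.\<close>

lemma local_boundary_geometry:
  fixes D :: "'a::euclidean_space set"
  assumes dim: "DIM('a) \<ge> 3" and smc: "strongly_minimally_convex D \<xi>" and lc: "locally_convex_at D \<xi>"
  obtains W \<rho> r A c e K where "local_defining_function D \<xi> W \<rho>" "r > 0" "A \<ge> 0" "c > 0" "K > 0"
    "ball \<xi> r \<subseteq> W"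
    "\<And>p. p \<in> frontier D \<inter> ball \<xi> r \<Longrightarrow> quadratic_support D p r A c e (outer_normal D p)"
    "\<And>p q. p \<in> frontier D \<inter> ball \<xi> r \<Longrightarrow> q \<in> frontier D \<inter> ball \<xi> r \<Longrightarrow>
        \<bar>(q - p) \<bullet> outer_normal D p\<bar> \<le> K * ((q - p) \<bullet> (q - p))"
proof -
  obtain W \<rho> where \<xi>: "\<xi> \<in> frontier D" and ld: "local_defining_function D \<xi> W \<rho>"
    and ev: "restricted_eigenvalues (hessian \<rho> \<xi>) (tangent_space D \<xi>) ! 0 +
             restricted_eigenvalues (hessian \<rho> \<xi>) (tangent_space D \<xi>) ! 1 > 0"
    using smc by (auto simp: strongly_minimally_convex_def Let_def)
  obtain W2 where W2: "open W2" "\<xi> \<in> W2" "convex (D \<inter> W2)" using lc by (auto simp: locally_convex_at_def)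
  have W: "open W" "\<xi> \<in> W" and C2: "C2_on W \<rho>" using ld by (auto simp: local_defining_function_def)
  have ldp: "local_defining_function D p W \<rho>" if "p \<in> W" for p
    using ld that by (auto simp: local_defining_function_def)
  define g where "g = gradient \<rho>"
  have gnz: "g p \<noteq> 0" if "p \<in> frontier D" "p \<in> W" for p
    using ld that by (auto simp: local_defining_function_def g_def)
  have normal: "outer_normal D p = g p /\<^sub>R norm (g p)" if "p \<in> frontier D" "p \<in> W" for p
    unfolding g_def by (rule outer_normal_eq[OF that(1) ldp[OF that(2)]])
  define H where "H = hessian \<rho> \<xi>"
  define m0 where "m0 = norm (g \<xi>)"
  define n0 where "n0 = outer_normal D \<xi>"
  have m0: "m0 > 0" using gnz \<xi> W by (simp add: m0_def)
  have n0: "g \<xi> = m0 *\<^sub>R n0" "norm n0 = 1" using normal[OF \<xi> W(2)] m0 by (auto simp: n0_def m0_def)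
  have H: "linear H" unfolding H_def by (rule C2_on_hessian_linear[OF C2 W(2)])
  have sym: "H u \<bullet> v = H v \<bullet> u" for u v unfolding H_def by (rule hessian_symmetric[OF C2 W])
  have T: "tangent_space D \<xi> = {v. n0 \<bullet> v = 0}" by (simp add: tangent_space_def n0_def inner_commute)
  have "n0 \<noteq> 0" using n0 by auto
  then have dT: "dim (tangent_space D \<xi>) \<ge> 2" unfolding T using dim by (simp add: dim_hyperplane)
  obtain e \<alpha> \<beta> where e: "e \<in> tangent_space D \<xi>" "norm e = 1" "\<alpha> \<le> \<beta>" "\<alpha> + \<beta> > 0"
    "\<And>w. w \<in> tangent_space D \<xi> \<Longrightarrow> H w \<bullet> w \<ge> \<alpha> * (w \<bullet> e)\<^sup>2 + \<beta> * (w \<bullet> w - (w \<bullet> e)\<^sup>2)"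
  proof (rule two_smallest_eigenvalues_bound[OF H sym _ dT])
    show "subspace (tangent_space D \<xi>)" unfolding T by (rule subspace_hyperplane)
    show "restricted_eigenvalues H (tangent_space D \<xi>) ! 0 + restricted_eigenvalues H (tangent_space D \<xi>) ! 1 > 0"
      using ev by (simp add: H_def)
  qed blast
  define A0 c0 where "A0 = (\<beta> - \<alpha>) / 2" and "c0 = (\<alpha> + \<beta>) / 2"
  have A0: "A0 \<ge> 0" "c0 > 0" using e by (auto simp: A0_def c0_def)
  obtain B where B: "B > 0" "\<And>x. norm (H x) \<le> B * norm x" 
    using linear_bounded_pos[OF H] by blast
  define K1 where "K1 = A0 + c0 + 3 * B"
  have K1: "K1 > 0" using A0 B by (simp add: K1_def)
  have Hlow: "H w \<bullet> w \<ge> A0 * (w \<bullet> w - 2 * (w \<bullet> e)\<^sup>2) + c0 * (w \<bullet> w) - K1 * (\<bar>w \<bullet> n0\<bar> * norm w)" for w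
    unfolding K1_def
  proof (rule restricted_form_extension[OF H B(2) n0(2)])
    show "e \<bullet> n0 = 0" using e(1) T by (simp add: inner_commute)
    fix v assume "v \<bullet> n0 = 0"
    then have "v \<in> tangent_space D \<xi>" by (simp add: T inner_commute)
    from e(5)[OF this] show "H v \<bullet> v \<ge> A0 * (v \<bullet> v - 2 * (v \<bullet> e)\<^sup>2) + c0 * (v \<bullet> v)"
      by (simp add: A0_def c0_def field_simps)
  qed (use A0 sym in auto)
  \<comment> \<open>The first bound keeps the norm of the gradient between \<open>m0 / 2\<close> and \<open>2 m0\<close>; the second makes the errors from the variation
    of the Hessian and of the normal together at most \<open>c0 / 2\<close>.\<close>
  define \<eta> where "\<eta> = min (m0 / 2) (c0 / (2 * (1 + K1 / m0)))"
  have \<eta>: "\<eta> > 0" "\<eta> \<le> m0 / 2" "\<eta> * (1 + K1 / m0) \<le> c0 / 2"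
  proof -
    have k: "1 + K1 / m0 > 0" using K1 m0 by (simp add: add_pos_pos)
    then show "\<eta> > 0" using m0 A0 by (simp add: \<eta>_def)
    show "\<eta> \<le> m0 / 2" unfolding \<eta>_def by (rule min.cobounded1)
    have "\<eta> \<le> c0 / (2 * (1 + K1 / m0))" by (simp add: \<eta>_def)
    also have "\<dots> = (c0 / 2) / (1 + K1 / m0)" by simp
    finally show "\<eta> * (1 + K1 / m0) \<le> c0 / 2" using k by (simp only: pos_le_divide_eq)
  qed
  obtain r1 where r1: "r1 > 0" "ball \<xi> r1 \<subseteq> W"
    "\<And>y w. y \<in> ball \<xi> r1 \<Longrightarrow> \<bar>hessian \<rho> y w \<bullet> w - H w \<bullet> w\<bar> \<le> \<eta> * (norm w)\<^sup>2"
    using hessian_form_uniformly_close[OF C2 W \<eta>(1)] unfolding H_def by blast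
  have "isCont g \<xi>" unfolding g_def using has_derivative_continuous[OF C2_on_hessian[OF C2 W(2)]] .
  then obtain r2 where r2: "r2 > 0" "\<And>p. dist p \<xi> < r2 \<Longrightarrow> dist (g p) (g \<xi>) < \<eta>"
    using \<eta>(1) unfolding continuous_at_eps_delta by blast
  obtain r3 where r3: "r3 > 0" "ball \<xi> r3 \<subseteq> W2" using W2 open_contains_ball by blast
  \<comment> \<open>The factors \<open>1/2\<close> ensure that balls of radius \<open>r\<close> around points of \<open>ball \<xi> r\<close> stay where the Hessian is controlled and
    \<open>D\<close> is convex.\<close>
  define r where "r = min (min (r1 / 2) r2) (min (r3 / 2) (m0 / K1))"
  have r: "r > 0" "2 * r \<le> r1" "r \<le> r2" "2 * r \<le> r3" "r \<le> m0 / K1"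
    using r1 r2 r3 m0 K1 by (auto simp: r_def)
  have Kr: "K1 * r / m0 \<le> 1" using r(5) K1 m0 by (simp add: pos_le_divide_eq mult.commute)
  define A c K where "A = A0 / (6 * m0)" and "c = c0 / (12 * m0)" and "K = (B + \<eta>) / m0"
  have Ac: "A \<ge> 0" "c > 0" "K > 0" using A0 m0 B \<eta> by (auto simp: A_def c_def K_def)
  have "ball \<xi> r \<subseteq> ball \<xi> r1" using r by (intro subset_ball) linarith
  then have rW: "ball \<xi> r \<subseteq> W" using r1(2) by blast
  have near: "dist (g p) (g \<xi>) < \<eta>" "m0 / 2 \<le> norm (g p)" "norm (g p) \<le> 2 * m0" if "p \<in> ball \<xi> r" for p
  proof -
    show 1: "dist (g p) (g \<xi>) < \<eta>" using r2(2)[of p] that r by (simp add: dist_commute)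
    show "m0 / 2 \<le> norm (g p)" "norm (g p) \<le> 2 * m0"
      using 1 \<eta>(2) norm_triangle_ineq2[of "g p" "g \<xi>"] norm_triangle_ineq2[of "g \<xi>" "g p"] m0
      by (auto simp: dist_norm m0_def norm_minus_commute)
  qed
  have taylor: "\<exists>\<zeta>\<in>ball \<xi> r1. \<rho> y = \<rho> p + g p \<bullet> (y - p) + (hessian \<rho> \<zeta> (y - p) \<bullet> (y - p)) / 2"
    if p: "p \<in> ball \<xi> r" and y: "y \<in> ball \<xi> r1" for p y
  proof -
    have "closed_segment p y \<subseteq> ball \<xi> r1" using p y r by (intro closed_segment_subset) auto
    then show ?thesis using C2_on_taylor2[OF C2, of p y] r1(2) unfolding g_def by blast
  qed
  show thesis
  proof (rule that[OF ld r(1) Ac rW])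
    fix p assume pf: "p \<in> frontier D \<inter> ball \<xi> r"
    define n where "n = outer_normal D p"
    define m where "m = norm (g p)"
    have pW: "p \<in> W" using pf rW by blast
    have p0: "\<rho> p = 0" using ld pf pW by (auto simp: local_defining_function_def)
    have m: "m > 0" "m \<le> 2 * m0" using gnz pf pW near(3) by (auto simp: m_def)
    have n: "g p = m *\<^sub>R n" "norm n = 1" using normal[of p] pf pW m by (auto simp: n_def m_def)
    have "(y - p) \<bullet> n \<le> 0 \<and> barrier A e n p y \<le> - c * ((y - p) \<bullet> (y - p))" if y: "y \<in> D \<inter> ball p r" for y
    proof -
      define w where "w = y - p"
      have wr: "norm w < r" using y by (simp add: w_def dist_norm norm_minus_commute)
      have yr: "y \<in> ball \<xi> (2 * r)"
        using y pf dist_triangle[of \<xi> y p] by auto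
      then have y1: "y \<in> ball \<xi> r1" "y \<in> ball \<xi> r3" using r by auto
      have "p \<in> ball \<xi> r3" using pf r by auto
      then have "g p \<bullet> w \<le> 0" unfolding g_def w_def
        using convex_side_of_tangent[OF ld W2(1,3), of p y] pf pW y y1 r3 by blast
      then have h: "w \<bullet> n \<le> 0" using m by (simp add: n inner_commute mult_le_0_iff)
      have "\<rho> y < 0" using ld y y1 r1(2) unfolding local_defining_function_def by blast
      moreover obtain \<zeta> where \<zeta>: "\<zeta> \<in> ball \<xi> r1" "\<rho> y = \<rho> p + g p \<bullet> w + (hessian \<rho> \<zeta> w \<bullet> w) / 2"
        using taylor[of p y] pf y1 unfolding w_def by blast
      ultimately have t1: "hessian \<rho> \<zeta> w \<bullet> w \<le> 2 * (m * (- (w \<bullet> n)))"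
        using p0 by (simp add: n inner_commute)
      have "\<bar>w \<bullet> n0\<bar> * m0 \<le> m * (- (w \<bullet> n)) + \<eta> * norm w"
      proof -
        define q where "q = w \<bullet> (g \<xi> - g p)"
        define b where "b = m * (- (w \<bullet> n))"
        have "m0 * (w \<bullet> n0) = w \<bullet> g \<xi>" using n0 by simp
        also have "\<dots> = q - b" using n by (simp add: q_def b_def inner_diff_right)
        finally have "m0 * (w \<bullet> n0) = q - b" .
        moreover have "\<bar>q\<bar> \<le> norm w * norm (g \<xi> - g p)" unfolding q_def by (rule Cauchy_Schwarz_ineq2)
        moreover have "norm w * norm (g \<xi> - g p) \<le> norm w * \<eta>"
          using near(1)[of p] pf by (intro mult_left_mono) (auto simp: dist_norm norm_minus_commute)
        moreover have "b \<ge> 0" using h m by (simp add: b_def mult_nonneg_nonpos)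
        ultimately have "\<bar>m0 * (w \<bullet> n0)\<bar> \<le> b + norm w * \<eta>" by linarith
        then show ?thesis using m0 by (simp add: abs_mult b_def mult.commute)
      qed
      then have "\<bar>w \<bullet> n0\<bar> \<le> (m * (- (w \<bullet> n)) + \<eta> * norm w) / m0" using m0 by (simp add: pos_le_divide_eq)
      then have "K1 * (\<bar>w \<bullet> n0\<bar> * norm w) \<le> K1 * ((m * (- (w \<bullet> n)) + \<eta> * norm w) / m0 * norm w)"
        using K1 by (intro mult_left_mono mult_right_mono) auto
      also have "\<dots> = (K1 * norm w / m0) * (m * (- (w \<bullet> n))) + K1 / m0 * \<eta> * (w \<bullet> w)"
        by (simp add: dot_square_norm power2_eq_square add_divide_distrib diff_divide_distrib algebra_simps)
      also have "\<dots> \<le> 1 * (m * (- (w \<bullet> n))) + K1 / m0 * \<eta> * (w \<bullet> w)"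
      proof (intro add_right_mono mult_right_mono)
        have "K1 * norm w / m0 \<le> K1 * r / m0" using wr K1 m0 by (intro divide_right_mono mult_left_mono) auto
        then show "K1 * norm w / m0 \<le> 1" using Kr by linarith
        show "0 \<le> m * - (w \<bullet> n)" using m h by (simp add: mult_nonneg_nonpos)
      qed
      finally have t2: "K1 * (\<bar>w \<bullet> n0\<bar> * norm w) \<le> m * (- (w \<bullet> n)) + K1 / m0 * \<eta> * (w \<bullet> w)" by simp
      have t3: "H w \<bullet> w \<le> hessian \<rho> \<zeta> w \<bullet> w + \<eta> * (w \<bullet> w)"
        using r1(3)[OF \<zeta>(1), of w] by (simp add: dot_square_norm)
      have t4: "\<eta> * (w \<bullet> w) + K1 / m0 * \<eta> * (w \<bullet> w) \<le> c0 / 2 * (w \<bullet> w)"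
        using mult_right_mono[OF \<eta>(3) inner_ge_zero[of w]] by (simp add: algebra_simps)
      define X where "X = w \<bullet> w - 2 * (w \<bullet> e)\<^sup>2"
      have "A0 * X + c0 / 2 * (w \<bullet> w) \<le> 3 * (m * (- (w \<bullet> n)))"
      proof -
        have "c0 * (w \<bullet> w) = 2 * (c0 / 2 * (w \<bullet> w))" by simp
        then show ?thesis using Hlow[of w, folded X_def] t1 t2 t3 t4 by linarith
      qed
      also have "\<dots> \<le> 3 * (2 * m0 * (- (w \<bullet> n)))" using m h by (intro mult_left_mono mult_right_mono) auto
      finally have "A0 * X + c0 / 2 * (w \<bullet> w) \<le> 6 * m0 * (- (w \<bullet> n))" by simp
      then have "(A0 * X + c0 / 2 * (w \<bullet> w)) / (6 * m0) \<le> - (w \<bullet> n)" using m0 by (simp add: pos_divide_le_eq mult.commute)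
      moreover have "(A0 * X + c0 / 2 * (w \<bullet> w)) / (6 * m0) = A * X + c * (w \<bullet> w)"
        by (simp add: A_def c_def add_divide_distrib)
      ultimately have "A * X + w \<bullet> n \<le> - c * (w \<bullet> w)" by simp
      then show ?thesis using h unfolding barrier_def w_def[symmetric] X_def by simp
    qed
    then show "quadratic_support D p r A c e (outer_normal D p)"
      using e(2) n(2) unfolding quadratic_support_def n_def by blast
    fix q assume qf: "q \<in> frontier D \<inter> ball \<xi> r"
    define w where "w = q - p"
    have "q \<in> ball \<xi> r1" using qf r by auto
    then obtain \<zeta> where \<zeta>: "\<zeta> \<in> ball \<xi> r1" "\<rho> q = \<rho> p + g p \<bullet> w + (hessian \<rho> \<zeta> w \<bullet> w) / 2"
      using taylor[of p q] pf unfolding w_def by blast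
    have "\<rho> q = 0" using ld qf rW by (auto simp: local_defining_function_def)
    then have eq: "2 * (m * (w \<bullet> n)) = - (hessian \<rho> \<zeta> w \<bullet> w)" using \<zeta>(2) p0 by (simp add: n inner_commute)
    have "\<bar>H w \<bullet> w\<bar> \<le> norm (H w) * norm w" by (rule Cauchy_Schwarz_ineq2)
    also have "\<dots> \<le> B * norm w * norm w" using B by (intro mult_right_mono) auto
    finally have "\<bar>hessian \<rho> \<zeta> w \<bullet> w\<bar> \<le> (B + \<eta>) * (w \<bullet> w)"
      using r1(3)[OF \<zeta>(1), of w] by (simp add: dot_square_norm power2_eq_square algebra_simps)
    moreover have "\<bar>2 * (m * (w \<bullet> n))\<bar> = 2 * m * \<bar>w \<bullet> n\<bar>" using m by (simp add: abs_mult)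
    ultimately have "2 * m * \<bar>w \<bullet> n\<bar> \<le> (B + \<eta>) * (w \<bullet> w)" using eq by simp
    moreover have "m0 * \<bar>w \<bullet> n\<bar> \<le> 2 * m * \<bar>w \<bullet> n\<bar>"
      using near(2)[of p] pf by (intro mult_right_mono) (auto simp: m_def)
    ultimately have "m0 * \<bar>w \<bullet> n\<bar> \<le> (B + \<eta>) * (w \<bullet> w)" by linarith
    then show "\<bar>(q - p) \<bullet> outer_normal D p\<bar> \<le> K * ((q - p) \<bullet> (q - p))"
      using m0 unfolding w_def n_def K_def by (simp add: pos_le_divide_eq mult.commute)
  qed
qed

section \<open>Nearest boundary points\<close>

text \<open>A ball on which the defining function has a constant sign touches the boundary at \<open>p\<close>. Directions \<open>h\<close> pointing from \<open>p\<close> into the ball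
  therefore see a one-sided derivative of that sign.\<close>

lemma gradient_at_ball_contact:
  assumes ld: "local_defining_function D \<xi> W \<rho>" and p: "p \<in> frontier D" "p \<in> W"
    and side: "\<And>y. y \<in> ball x \<delta> \<Longrightarrow> y \<in> W \<Longrightarrow> \<sigma> * \<rho> y \<le> 0"
    and d: "dist x p = \<delta>" and h: "h \<bullet> (p - x) < 0"
  shows "h \<bullet> (\<sigma> *\<^sub>R gradient \<rho> p) \<le> 0"
proof (rule ccontr)
  assume "\<not> ?thesis"
  then have pos: "\<sigma> * (h \<bullet> gradient \<rho> p) > 0" by simp
  have W: "open W" and C2: "C2_on W \<rho>" using ld by (auto simp: local_defining_function_def)
  have p0: "\<rho> p = 0" using ld p by (auto simp: local_defining_function_def)
  have "((\<lambda>t. \<rho> (p + t *\<^sub>R h)) has_real_derivative (h \<bullet> gradient \<rho> p)) (at 0)"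
    by (rule gradient_ray) (use C2 p in \<open>auto simp: C2_on_def\<close>)
  then have dr: "((\<lambda>t. \<sigma> * \<rho> (p + t *\<^sub>R h)) has_real_derivative (\<sigma> * (h \<bullet> gradient \<rho> p))) (at 0)"
    by (rule DERIV_cmult)
  obtain a where a: "a > 0" "\<And>t. 0 < t \<Longrightarrow> t < a \<Longrightarrow> \<sigma> * \<rho> (p + t *\<^sub>R h) > 0"
    using DERIV_pos_inc_right[OF dr pos] p0 by auto
  have "((\<lambda>t. p + t *\<^sub>R h) \<longlongrightarrow> p + 0 *\<^sub>R h) (at_right 0)" by (intro tendsto_intros)
  then have "\<forall>\<^sub>F t in at_right 0. p + t *\<^sub>R h \<in> W"
    using W p by (auto dest!: topological_tendstoD)
  then obtain b where b: "b > 0" "\<And>t. 0 < t \<Longrightarrow> t < b \<Longrightarrow> p + t *\<^sub>R h \<in> W"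
    by (auto simp: eventually_at_right_field)
  have hh: "h \<bullet> h > 0" using h by auto
  define b2 where "b2 = - 2 * (h \<bullet> (p - x)) / (h \<bullet> h)"
  have b2: "b2 > 0" using h hh by (simp add: b2_def divide_neg_pos)
  define t where "t = min (min a b) b2 / 2"
  have t: "0 < t" "t < a" "t < b" "t < b2" using a b b2 by (auto simp: t_def)
  have "t * (h \<bullet> h) < - 2 * (h \<bullet> (p - x))" using t(4) hh unfolding b2_def by (simp only: pos_less_divide_eq)
  then have neg: "t * (2 * (h \<bullet> (p - x)) + t * (h \<bullet> h)) < 0" using t by (intro mult_pos_neg) auto
  have "(norm (p + t *\<^sub>R h - x))\<^sup>2 = (norm (p - x))\<^sup>2 + t * (2 * (h \<bullet> (p - x)) + t * (h \<bullet> h))"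
    unfolding power2_norm_eq_inner
    by (simp add: inner_diff_left inner_diff_right inner_add_left inner_add_right inner_commute algebra_simps)
  then have "(norm (p + t *\<^sub>R h - x))\<^sup>2 < (norm (p - x))\<^sup>2" using neg by simp
  then have "norm (p + t *\<^sub>R h - x) < norm (p - x)" by (rule power2_less_imp_less) simp
  then have "p + t *\<^sub>R h \<in> ball x \<delta>" using d by (simp add: dist_norm norm_minus_commute)
  then have "\<sigma> * \<rho> (p + t *\<^sub>R h) \<le> 0" using side b t by blast
  then show False using a(2)[of t] t by simp
qed

text \<open>The ball around \<open>x\<close> with radius the distance to the boundary lies entirely inside or entirely outside \<open>D\<close>, and touches the
  boundary at \<open>p\<close>; so its radius to \<open>p\<close> is normal to the boundary.\<close>

lemma nearest_boundary_point_normal: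
  fixes D :: "'a::euclidean_space set"
  assumes ld: "local_defining_function D \<xi> W \<rho>" and p: "p \<in> frontier D" "p \<in> W"
    and d: "dist x p = infdist x (frontier D)"
  shows "x = p - ((if x \<in> D then 1 else -1) * dist x p) *\<^sub>R outer_normal D p"
proof (cases "x = p")
  case True then show ?thesis by simp
next
  case False
  define \<delta> where "\<delta> = dist x p"
  define \<sigma> :: real where "\<sigma> = (if x \<in> D then 1 else -1)"
  have \<delta>: "\<delta> > 0" using False by (simp add: \<delta>_def)
  have off: "ball x \<delta> \<inter> frontier D = {}"
  proof (rule ccontr)
    assume "\<not> ?thesis"
    then obtain q where "q \<in> frontier D" "dist x q < \<delta>" by auto
    then show False using infdist_le[of q "frontier D" x] d by (simp add: \<delta>_def)
  qed
  have xin: "x \<in> ball x \<delta>" using \<delta> by simp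
  have side: "\<sigma> * \<rho> y \<le> 0" if y: "y \<in> ball x \<delta>" "y \<in> W" for y
  proof (cases "x \<in> D")
    case True
    then have "ball x \<delta> \<inter> D \<noteq> {}" using xin by blast
    then have "ball x \<delta> - D = {}" using connected_Int_frontier[OF connected_ball] off by metis
    then have "y \<in> D" using y by blast
    then have "y \<in> {x \<in> W. \<rho> x < 0}" using ld y unfolding local_defining_function_def by blast
    then show ?thesis using True by (simp add: \<sigma>_def)
  next
    case F: False
    then have "ball x \<delta> - D \<noteq> {}" using xin by blast
    then have "ball x \<delta> \<inter> D = {}" using connected_Int_frontier[OF connected_ball] off by metis
    then have "y \<notin> D" using y by blast
    then have "\<not> \<rho> y < 0" using ld y unfolding local_defining_function_def by blast
    then show ?thesis using F by (simp add: \<sigma>_def)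
  qed
  have ldp: "local_defining_function D p W \<rho>" using ld p by (auto simp: local_defining_function_def)
  have gnz: "gradient \<rho> p \<noteq> 0" using ld p by (auto simp: local_defining_function_def)
  have \<sigma>2: "\<sigma> \<noteq> 0" "\<bar>\<sigma>\<bar> = 1" "\<sigma> * \<sigma> = 1" by (auto simp: \<sigma>_def)
  have "(\<sigma> *\<^sub>R gradient \<rho> p) /\<^sub>R norm (\<sigma> *\<^sub>R gradient \<rho> p) = (p - x) /\<^sub>R norm (p - x)"
  proof (rule half_space_unit_normal)
    show "p - x \<noteq> 0" using False by simp
    show "\<sigma> *\<^sub>R gradient \<rho> p \<noteq> 0" using gnz \<sigma>2 by simp
    show "\<And>h. h \<bullet> (p - x) < 0 \<Longrightarrow> h \<bullet> (\<sigma> *\<^sub>R gradient \<rho> p) \<le> 0"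
      by (rule gradient_at_ball_contact[OF ld p side]) (auto simp: \<delta>_def)
  qed
  then have "\<sigma> *\<^sub>R outer_normal D p = (p - x) /\<^sub>R \<delta>"
    unfolding outer_normal_eq[OF p(1) ldp] using \<sigma>2 by (simp add: \<delta>_def dist_norm norm_minus_commute mult.commute)
  then have "\<delta> *\<^sub>R (\<sigma> *\<^sub>R outer_normal D p) = p - x" using \<delta> by simp
  then show ?thesis unfolding \<sigma>_def[symmetric] \<delta>_def[symmetric] by (simp add: algebra_simps)
qed

text \<open>If \<open>p\<close>, \<open>q\<close> have the same distance \<open>\<delta>\<close> from \<open>x = p \<mp> \<delta> n\<close>, then \<open>|q - p|^2 = \<mp> 2 \<delta> (q - p) \<bullet> n\<close>, which the quadratic estimate
  for chords makes smaller than \<open>|q - p|^2\<close>.\<close>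

lemma nearest_boundary_point_unique:
  fixes D :: "'a::euclidean_space set"
  assumes ld: "local_defining_function D \<xi> W \<rho>" and pq: "p \<in> frontier D \<inter> W" "q \<in> frontier D \<inter> W"
    and d: "dist x p = infdist x (frontier D)" "dist x q = infdist x (frontier D)"
    and K: "\<bar>(q - p) \<bullet> outer_normal D p\<bar> \<le> K * ((q - p) \<bullet> (q - p))" and small: "2 * infdist x (frontier D) * K < 1"
  shows "p = q"
proof (rule ccontr)
  assume ne: "p \<noteq> q"
  define \<delta> where "\<delta> = infdist x (frontier D)"
  define \<sigma> :: real where "\<sigma> = (if x \<in> D then 1 else -1)"
  define n where "n = outer_normal D p"
  have \<sigma>2: "\<bar>\<sigma>\<bar> = 1" by (auto simp: \<sigma>_def)
  have \<delta>: "\<delta> \<ge> 0" by (simp add: \<delta>_def infdist_nonneg)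
  have x: "x = p - (\<sigma> * \<delta>) *\<^sub>R n"
    using nearest_boundary_point_normal[OF ld _ _ d(1)] pq d(1) by (simp add: \<sigma>_def \<delta>_def n_def)
  define w where "w = q - p"
  have ww: "w \<bullet> w > 0" using ne by (simp add: w_def)
  have "(norm (x - q))\<^sup>2 = (norm (x - p))\<^sup>2" using d by (simp add: dist_norm)
  moreover have "x - q = (x - p) - w" by (simp add: w_def)
  ultimately have "w \<bullet> w = 2 * ((x - p) \<bullet> w)"
    unfolding power2_norm_eq_inner by (simp add: inner_diff_left inner_diff_right inner_commute)
  also have "(x - p) \<bullet> w = - (\<sigma> * \<delta> * (w \<bullet> n))" using x by (simp add: inner_commute)
  finally have "w \<bullet> w = \<bar>2 * (\<sigma> * \<delta> * (w \<bullet> n))\<bar>" using ww by simp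
  also have "\<dots> = 2 * \<delta> * \<bar>w \<bullet> n\<bar>" using \<sigma>2 \<delta> by (simp add: abs_mult)
  also have "\<dots> \<le> 2 * \<delta> * (K * (w \<bullet> w))" using K \<delta> unfolding w_def n_def by (intro mult_left_mono) auto
  also have "\<dots> = (2 * \<delta> * K) * (w \<bullet> w)" by simp
  also have "\<dots> < 1 * (w \<bullet> w)" using small ww unfolding \<delta>_def by (intro mult_strict_right_mono) auto
  finally show False by simp
qed

section \<open>Affine discs\<close>

lemma harmonic_affine: "harmonic_on S (\<lambda>z::'a::euclidean_space. z \<bullet> k + c)"
proof -
  have G: "GDERIV (\<lambda>z. z \<bullet> k + c) x :> k" for x
    unfolding gderiv_def by (auto intro!: derivative_eq_intros)
  then have g: "gradient (\<lambda>z. z \<bullet> k + c) = (\<lambda>x. k)" by (intro ext gradient_eq)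
  have h: "hessian (\<lambda>z. z \<bullet> k + c) x v = 0" for x v
    unfolding hessian_def g by (simp add: frechet_derivative_const)
  have "(\<lambda>z. z \<bullet> k + c) differentiable (at x)" for x
    using G unfolding gderiv_def differentiable_def by blast
  then show ?thesis unfolding harmonic_on_def C2_on_def by (auto simp: h g)
qed

text \<open>The set in the definition of the minimal metric must be nonempty for its infimum to be a greatest lower bound.\<close>

lemma affine_disc_exists:
  fixes v x :: "'a::euclidean_space"
  assumes D: "open D" "x \<in> D" and dim: "DIM('a) \<ge> 2"
  shows "\<exists>r>0. \<exists>f \<in> conformal_harmonic_maps D. f 0 = x \<and> partial_x f 0 = r *\<^sub>R v"
proof -
  obtain \<epsilon> where \<epsilon>: "\<epsilon> > 0" "ball x \<epsilon> \<subseteq> D" using D open_contains_ball by blast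
  obtain y where y: "y \<noteq> 0" "orthogonal v y" using orthogonal_to_vector_exists[OF dim] by blast
  define w where "w = norm v *\<^sub>R sgn y"
  have w: "norm w = norm v" "v \<bullet> w = 0" using y by (auto simp: w_def norm_sgn orthogonal_def sgn_div_norm)
  define r where "r = \<epsilon> / (2 * norm v + 1)"
  have pos: "2 * norm v + 1 > 0" by (simp add: add_nonneg_pos)
  have r: "r > 0" using \<epsilon> pos by (simp add: r_def)
  define f where "f z = x + Re z *\<^sub>R (r *\<^sub>R v) + Im z *\<^sub>R (r *\<^sub>R w)" for z
  have df: "(f has_derivative (\<lambda>h. Re h *\<^sub>R (r *\<^sub>R v) + Im h *\<^sub>R (r *\<^sub>R w))) (at z)" for z
    unfolding f_def by (auto intro!: derivative_eq_intros)
  have p: "partial_x f z = r *\<^sub>R v" "partial_y f z = r *\<^sub>R w" for z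
    unfolding partial_x_def partial_y_def frechet_derivative_at[OF df, symmetric] by auto
  have "f z \<in> D" if z: "z \<in> ball 0 1" for z
  proof -
    have "norm (f z - x) \<le> \<bar>Re z\<bar> * (r * norm v) + \<bar>Im z\<bar> * (r * norm w)"
      using norm_triangle_ineq[of "Re z *\<^sub>R (r *\<^sub>R v)" "Im z *\<^sub>R (r *\<^sub>R w)"] r
      by (simp add: f_def abs_mult mult.assoc)
    also have "\<dots> \<le> 1 * (r * norm v) + 1 * (r * norm w)"
      using abs_Re_le_cmod[of z] abs_Im_le_cmod[of z] z r by (intro add_mono mult_right_mono) auto
    also have "\<dots> = r * (2 * norm v)" using w by simp
    also have "\<dots> < r * (2 * norm v + 1)" using r by simp
    also have "\<dots> = \<epsilon>" using pos by (simp add: r_def)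
    finally show ?thesis using \<epsilon>(2) by (auto simp: dist_norm norm_minus_commute)
  qed
  moreover have "harmonic_on (ball 0 1) (\<lambda>z. f z \<bullet> b)" for b
  proof -
    have "(\<lambda>z. f z \<bullet> b) = (\<lambda>z. z \<bullet> Complex (r * (v \<bullet> b)) (r * (w \<bullet> b)) + x \<bullet> b)"
      by (auto simp: f_def inner_add_left inner_complex_def)
    then show ?thesis by (simp add: harmonic_affine)
  qed
  moreover have "norm (partial_x f z) = norm (partial_y f z)" "partial_x f z \<bullet> partial_y f z = 0" for z
    using w by (auto simp: p)
  ultimately have "f \<in> conformal_harmonic_maps D" by (auto simp: conformal_harmonic_maps_def)
  moreover have "f 0 = x" by (simp add: f_def)
  ultimately show ?thesis using r p by blast
qed

lemma minimal_metric_ge: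
  fixes v x :: "'a::euclidean_space"
  assumes D: "open D" "x \<in> D" and dim: "DIM('a) \<ge> 2"
    and low: "\<And>r f. r > 0 \<Longrightarrow> f \<in> conformal_harmonic_maps D \<Longrightarrow> f 0 = x \<Longrightarrow> partial_x f 0 = r *\<^sub>R v \<Longrightarrow> m * r \<le> 1"
  shows "m \<le> minimal_metric D x v"
  unfolding minimal_metric_def
proof (rule cInf_greatest)
  show "{1 / r |r. 0 < r \<and> (\<exists>f\<in>conformal_harmonic_maps D. f 0 = x \<and> partial_x f 0 = r *\<^sub>R v)} \<noteq> {}"
    using affine_disc_exists[OF D dim, of v] by blast
  fix s assume "s \<in> {1 / r |r. 0 < r \<and> (\<exists>f\<in>conformal_harmonic_maps D. f 0 = x \<and> partial_x f 0 = r *\<^sub>R v)}"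
  then obtain r f where "s = 1 / r" "r > 0" "f \<in> conformal_harmonic_maps D" "f 0 = x" "partial_x f 0 = r *\<^sub>R v" by blast
  with low show "m \<le> s" by (simp add: pos_le_divide_eq)
qed

section \<open>The lower bound for the minimal metric\<close>

theorem proposition4p10:
  fixes D :: "(real ^ 'n) set" and \<xi> :: "real ^ 'n"
  assumes "CARD('n) \<ge> 3"
    and "open D" and "connected D"
    and "strongly_minimally_convex D \<xi>"
    and "locally_convex_at D \<xi>"
  shows "\<exists>U c1 c2. open U \<and> \<xi> \<in> U \<and> c1 > 0 \<and> c2 > 0 \<and>
    (\<forall>x\<in>U. unique_nearest_boundary_point D x \<and> C2_boundary_point D (boundary_proj D x)) \<and>
    (\<forall>x \<in> D \<inter> U. \<forall>v.
       minimal_metric D x v \<ge>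
         max ((1 - c1 * boundary_dist D x) *
                (norm (normal_part D x v) / (2 * boundary_dist D x)))
             (c2 * (norm (tangential_part D x v) / boundary_dist D x powr (1/2))))"
proof -
  have dim: "DIM(real ^ 'n) \<ge> 3" using assms(1) by simp
  obtain W \<rho> r A c e K where ld: "local_defining_function D \<xi> W \<rho>" and k: "r > 0" "A \<ge> 0" "c > 0" "K > 0"
    and rW: "ball \<xi> r \<subseteq> W"
    and qs: "\<And>p. p \<in> frontier D \<inter> ball \<xi> r \<Longrightarrow> quadratic_support D p r A c e (outer_normal D p)"
    and Kpq: "\<And>p q. p \<in> frontier D \<inter> ball \<xi> r \<Longrightarrow> q \<in> frontier D \<inter> ball \<xi> r \<Longrightarrow>
        \<bar>(q - p) \<bullet> outer_normal D p\<bar> \<le> K * ((q - p) \<bullet> (q - p))"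
    by (rule local_boundary_geometry[OF dim assms(4,5)]) blast
  have \<xi>: "\<xi> \<in> frontier D" using assms(4) by (simp add: strongly_minimally_convex_def)
  obtain C M d where CM: "C > 0" "M > 0" "d > 0"
    and est: "\<And>(f :: complex \<Rightarrow> real ^ 'n) G p e n \<delta>.
       \<lbrakk>quadratic_support G p r A c e n; open G; f \<in> conformal_harmonic_maps G; f 0 = p - \<delta> *\<^sub>R n; 0 < \<delta>; \<delta> < d\<rbrakk>
       \<Longrightarrow> (1 - C * \<delta>) * \<bar>partial_x f 0 \<bullet> n\<bar> \<le> 2 * \<delta> \<and> norm (partial_x f 0) \<le> M * sqrt \<delta>"
    by (rule conformal_disc_derivative_estimates[OF k(1-3), where ?'a = "real ^ 'n"]) blast
  \<comment> \<open>Nearest points of points of \<open>ball \<xi> r0\<close> lie in \<open>ball \<xi> r\<close>, and \<open>2 \<delta> K < 1\<close> there, as uniqueness requires.\<close>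
  define r0 where "r0 = min (min (r / 2) (1 / (2 * K))) d"
  have r0: "r0 > 0" "r0 \<le> r / 2" "r0 \<le> 1 / (2 * K)" "r0 \<le> d" using k CM by (auto simp: r0_def)
  have nearest: "\<exists>p. p \<in> frontier D \<inter> ball \<xi> r \<and> dist x p = boundary_dist D x \<and> boundary_dist D x < r0 \<and>
      (\<forall>q. q \<in> frontier D \<and> dist x q = boundary_dist D x \<longrightarrow> q = p)" if x: "x \<in> ball \<xi> r0" for x
  proof -
    have small: "boundary_dist D x < r0"
      using infdist_le[OF \<xi>, of x] x by (simp add: boundary_dist_def dist_commute)
    have inb: "q \<in> ball \<xi> r" if "dist x q = boundary_dist D x" for q
      using dist_triangle[of \<xi> q x] that small x r0 by (auto simp: dist_commute)
    obtain p where p: "p \<in> frontier D" "boundary_dist D x = dist x p"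
      using infdist_attains_inf[of "frontier D" x] \<xi> unfolding boundary_dist_def by auto
    have "q = p" if q: "q \<in> frontier D" "dist x q = boundary_dist D x" for q
    proof (rule sym, rule nearest_boundary_point_unique[OF ld])
      have pr: "p \<in> frontier D \<inter> ball \<xi> r" "q \<in> frontier D \<inter> ball \<xi> r" using p q inb by auto
      then show "p \<in> frontier D \<inter> W" "q \<in> frontier D \<inter> W" using rW by auto
      show "dist x p = infdist x (frontier D)" "dist x q = infdist x (frontier D)"
        using p q by (auto simp: boundary_dist_def)
      show "\<bar>(q - p) \<bullet> outer_normal D p\<bar> \<le> K * ((q - p) \<bullet> (q - p))" using Kpq pr by blast
      have "boundary_dist D x < 1 / (2 * K)" using small r0 by linarith
      then show "2 * infdist x (frontier D) * K < 1"
        using k by (simp add: boundary_dist_def pos_less_divide_eq mult_ac)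
    qed
    then show ?thesis using p inb small by (intro exI[of _ p]) auto
  qed
  have proj: "boundary_proj D x = p" if p: "p \<in> frontier D" "dist x p = boundary_dist D x"
    and unique: "\<forall>q. q \<in> frontier D \<and> dist x q = boundary_dist D x \<longrightarrow> q = p" for x p
    unfolding boundary_proj_def
  proof (rule the_equality)
    show "p \<in> frontier D \<and> dist x p = boundary_dist D x" using p by blast
    show "\<And>q. q \<in> frontier D \<and> dist x q = boundary_dist D x \<Longrightarrow> q = p" using unique by blast
  qed
  have U1: "unique_nearest_boundary_point D x \<and> C2_boundary_point D (boundary_proj D x)" if x: "x \<in> ball \<xi> r0" for x
  proof -
    obtain p where p: "p \<in> frontier D \<inter> ball \<xi> r" "dist x p = boundary_dist D x"
      "\<forall>q. q \<in> frontier D \<and> dist x q = boundary_dist D x \<longrightarrow> q = p" using nearest[OF x] by blast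
    have "local_defining_function D p W \<rho>" using ld p(1) rW by (auto simp: local_defining_function_def)
    then have "C2_boundary_point D p" using p(1) by (auto simp: C2_boundary_point_def)
    moreover have "boundary_proj D x = p" using proj p by blast
    moreover have "unique_nearest_boundary_point D x" unfolding unique_nearest_boundary_point_def using p by blast
    ultimately show ?thesis by simp
  qed
  have U2: "max ((1 - C * boundary_dist D x) * (norm (normal_part D x v) / (2 * boundary_dist D x)))
             (1 / M * (norm (tangential_part D x v) / boundary_dist D x powr (1/2))) \<le> minimal_metric D x v"
    if x: "x \<in> D \<inter> ball \<xi> r0" for x v
  proof -
    define \<delta> where "\<delta> = boundary_dist D x"
    obtain p where p: "p \<in> frontier D \<inter> ball \<xi> r" "dist x p = \<delta>" "\<delta> < r0"
      "\<forall>q. q \<in> frontier D \<and> dist x q = boundary_dist D x \<longrightarrow> q = p" using nearest[of x] x unfolding \<delta>_def by blast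
    have bp: "boundary_proj D x = p" using proj p unfolding \<delta>_def by blast
    define n where "n = outer_normal D p"
    have qsp: "quadratic_support D p r A c e n" unfolding n_def by (rule qs[OF p(1)])
    have n: "norm n = 1" using qsp by (simp add: quadratic_support_def)
    have "frontier D \<inter> D = {}" using assms(2) by (simp add: frontier_disjoint_eq)
    then have "x \<noteq> p" using x p(1) by auto
    then have \<delta>: "0 < \<delta>" "\<delta> < d" using p(2,3) r0 by auto
    have xp: "x = p - \<delta> *\<^sub>R n"
      using nearest_boundary_point_normal[OF ld, of p x] p(1,2) rW x by (auto simp: n_def \<delta>_def boundary_dist_def)
    have np: "norm (normal_part D x v) = \<bar>v \<bullet> n\<bar>" by (simp add: normal_part_def bp n_def[symmetric] n)
    have tp: "norm (tangential_part D x v) \<le> norm v"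
    proof (rule power2_le_imp_le)
      have "(norm (tangential_part D x v))\<^sup>2 = (norm v)\<^sup>2 - (v \<bullet> n)\<^sup>2"
        using n unfolding tangential_part_def normal_part_def bp n_def[symmetric] power2_norm_eq_inner
        by (simp add: inner_diff_left inner_diff_right inner_commute power2_eq_square norm_eq_1)
      then show "(norm (tangential_part D x v))\<^sup>2 \<le> (norm v)\<^sup>2" by simp
    qed simp
    have D2: "2 \<le> DIM(real ^ 'n)" using dim by linarith
    have sq: "\<delta> powr (1/2) = sqrt \<delta>" using \<delta> by (simp add: powr_half_sqrt)
    have xD: "x \<in> D" using x by simp
    have disc: "(1 - C * \<delta>) * \<bar>(s *\<^sub>R v) \<bullet> n\<bar> \<le> 2 * \<delta> \<and> norm (s *\<^sub>R v) \<le> M * sqrt \<delta>"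
      if "f \<in> conformal_harmonic_maps D" "f 0 = x" "partial_x f 0 = s *\<^sub>R v" for s f
      using est[OF qsp assms(2) that(1) _ \<delta>] that(2,3) xp by simp
    have 1: "(1 - C * \<delta>) * (\<bar>v \<bullet> n\<bar> / (2 * \<delta>)) \<le> minimal_metric D x v"
    proof (rule minimal_metric_ge[OF assms(2) xD D2])
      fix s f assume s: "s > 0" and f: "f \<in> conformal_harmonic_maps D" "f 0 = x" "partial_x f 0 = s *\<^sub>R v"
      have "(1 - C * \<delta>) * (s * \<bar>v \<bullet> n\<bar>) \<le> 2 * \<delta>" using disc[OF f] s by (simp add: abs_mult)
      then have "(1 - C * \<delta>) * (s * \<bar>v \<bullet> n\<bar>) / (2 * \<delta>) \<le> 1" using \<delta> by (simp add: pos_divide_le_eq)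
      then show "(1 - C * \<delta>) * (\<bar>v \<bullet> n\<bar> / (2 * \<delta>)) * s \<le> 1" by (simp add: mult_ac)
    qed
    have 2: "1 / M * (norm (tangential_part D x v) / sqrt \<delta>) \<le> minimal_metric D x v"
    proof (rule minimal_metric_ge[OF assms(2) xD D2])
      fix s f assume s: "s > 0" and f: "f \<in> conformal_harmonic_maps D" "f 0 = x" "partial_x f 0 = s *\<^sub>R v"
      have "s * norm (tangential_part D x v) \<le> s * norm v" using tp s by (intro mult_left_mono) auto
      also have "\<dots> \<le> M * sqrt \<delta>" using disc[OF f] s by simp
      finally have "s * norm (tangential_part D x v) / (M * sqrt \<delta>) \<le> 1" using CM \<delta> by (simp add: pos_divide_le_eq)
      then show "1 / M * (norm (tangential_part D x v) / sqrt \<delta>) * s \<le> 1" by (simp add: mult_ac)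
    qed
    show ?thesis unfolding np sq \<delta>_def[symmetric] using 1 2 by (rule max.boundedI)
  qed
  show ?thesis
    by (rule exI[of _ "ball \<xi> r0"], rule exI[of _ C], rule exI[of _ "1 / M"])
       (use U1 U2 r0 CM in \<open>auto simp del: max.bounded_iff mem_ball\<close>)
qed

end
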